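(* Assume $E$ is countable with the discrete metric. Let $p\ge1$ be an integer and $f\in\mathrm{Lip}(E^{\mathbb Z},\mathbb R)\cap L^{2p}(\mathbb P_\nu)$. Then for every $\epsilon>0$, $$\mathbb E\big(f-\mathbb E(f)\big)^{2p}\le C_p\,\|\delta(f)\|_2^{2p},$$ where $$C_p=(2p-1)^{2p}\Big(\frac{\zeta(1+\epsilon)}2\Big)^p\sum_{x,y\in E}\nu(x)p(x,y)\Big(\sum_{z\in E}p(x,z)\,\hat{\mathbb E}_{y,z}\big((T+1)^{1+\epsilon/2}\big)\Big)^{2p}.$$ Consequently, for all $t>0$, $\mathbb P_\nu(|f-\mathbb E(f)|\ge t)\le C_p\,\|\delta(f)\|_2^{2p}/t^{2p}$.
   Context: $E$ is a countable set with the discrete metric $d(x,y)=\mathbf 1\{x\ne y\}$. $(X_n)_{n\in\mathbb Z}$ is a two-sided stationary ergodic Markov chain on $E$ with transition matrix $p(x,y)$ and stationary distribution $\nu$; $\mathbb P_\nu$ is its law on $E^{\mathbb Z}$, $\mathbb E$ the expectation, and the tail $\sigma$-field is assumed $\mathbb P_\nu$-trivial. For $y,z\in E$, $\hat{\mathbb P}_{y,z}$ is the law of a Markovian coupling $((U_n,V_n))_{n\ge0}$ (a Markov chain on $E\times E$ with $U_0=y,V_0=z$ whose coordinates are each Markov chains with matrix $p$), $\hat{\mathbb E}_{y,z}$ its expectation, and $T=\inf\{k\ge0:U_j=V_j\ \forall j\ge k\}$ the coupling time. For $f:E^{\mathbb Z}\to\mathbb R$, $\delta_i(f)=\sup\{(f(\bar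 x)-f(\bar y))/d(x_i,y_i): x_j=y_j\ \forall j\ne i,\ x_i\ne y_i\}$; $\mathrm{Lip}(E^{\mathbb Z},\mathbb R)$ is the set of measurable $f$ with all $\delta_i(f)<\infty$; $\|\delta(f)\|_2^2=\sum_i\delta_i(f)^2$. $\zeta(s)=\sum_{n\ge1}n^{-s}$. *)

theory Defs
  imports "HOL-Probability.Probability"
begin

definition stochastic :: "('a \<Rightarrow> 'a \<Rightarrow> real) \<Rightarrow> bool" where
  "stochastic K \<longleftrightarrow> (\<forall>x y. K x y \<ge> 0) \<and> (\<forall>x. (K x has_sum 1) UNIV)"

definition stationary_dist :: "('a \<Rightarrow> 'a \<Rightarrow> real) \<Rightarrow> ('a \<Rightarrow> real) \<Rightarrow> bool" where
  "stationary_dist K nu \<longleftrightarrow> (\<forall>x. nu x \<ge> 0) \<and> (nu has_sum 1) UNIV \<and>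
     (\<forall>y. ((\<lambda>x. nu x * K x y) has_sum nu y) UNIV)"

definition reach :: "('a \<Rightarrow> 'a \<Rightarrow> real) \<Rightarrow> nat \<Rightarrow> 'a \<Rightarrow> 'a \<Rightarrow> bool" where
  "reach K n x y \<longleftrightarrow> (\<exists>xs. length xs = Suc n \<and> xs ! 0 = x \<and> xs ! n = y \<and>
       (\<forall>i<n. K (xs ! i) (xs ! Suc i) > 0))"

text \<open>Ergodic: irreducible and aperiodic (positive recurrence follows from the
  existence of a stationary distribution).\<close>
definition ergodic_chain :: "('a \<Rightarrow> 'a \<Rightarrow> real) \<Rightarrow> bool" where
  "ergodic_chain K \<longleftrightarrow> (\<forall>x y. \<exists>n. reach K n x y) \<and>
     (\<forall>x. Gcd {n. n > 0 \<and> reach K n x x} = 1)"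

definition path_space :: "('i \<Rightarrow> 'a) measure" where
  "path_space = Pi\<^sub>M UNIV (\<lambda>_. count_space UNIV)"

definition stationary_chain_law ::
  "('a \<Rightarrow> 'a \<Rightarrow> real) \<Rightarrow> ('a \<Rightarrow> real) \<Rightarrow> (int \<Rightarrow> 'a) measure \<Rightarrow> bool" where
  "stationary_chain_law K nu M \<longleftrightarrow> prob_space M \<and> sets M = sets path_space \<and>
     (\<forall>(n::int) (m::nat) xs. length xs = Suc m \<longrightarrow>
        measure M {\<omega> \<in> space M. \<forall>i\<le>m. \<omega> (n + int i) = xs ! i}
        = nu (xs ! 0) * (\<Prod>i<m. K (xs ! i) (xs ! Suc i)))"

definition chain_law_from ::
  "('b \<Rightarrow> 'b \<Rightarrow> real) \<Rightarrow> 'b \<Rightarrow> (nat \<Rightarrow> 'b) measure \<Rightarrow> bool" where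
  "chain_law_from K s M \<longleftrightarrow> prob_space M \<and> sets M = sets path_space \<and>
     (\<forall>(m::nat) xs. length xs = Suc m \<longrightarrow>
        measure M {\<omega> \<in> space M. \<forall>i\<le>m. \<omega> i = xs ! i}
        = (if xs ! 0 = s then 1 else 0) * (\<Prod>i<m. K (xs ! i) (xs ! Suc i)))"

definition markovian_coupling ::
  "('a \<Rightarrow> 'a \<Rightarrow> real) \<Rightarrow> ('a \<times> 'a \<Rightarrow> 'a \<times> 'a \<Rightarrow> real) \<Rightarrow> bool" where
  "markovian_coupling K Q \<longleftrightarrow> stochastic Q \<and>
     (\<forall>u v u'. ((\<lambda>v'. Q (u, v) (u', v')) has_sum K u u') UNIV) \<and>
     (\<forall>u v v'. ((\<lambda>u'. Q (u, v) (u', v')) has_sum K v v') UNIV)"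

definition coupling_time :: "(nat \<Rightarrow> 'a \<times> 'a) \<Rightarrow> enat" where
  "coupling_time \<omega> = Inf {enat k | k. \<forall>j\<ge>k. fst (\<omega> j) = snd (\<omega> j)}"

definition time_pow :: "enat \<Rightarrow> real \<Rightarrow> ennreal" where
  "time_pow t a = (case t of enat k \<Rightarrow> ennreal ((real k + 1) powr a) | \<infinity> \<Rightarrow> \<infinity>)"

definition two_sided_tail :: "(int \<Rightarrow> 'a) set \<Rightarrow> (int \<Rightarrow> 'a) set set" where
  "two_sided_tail \<Omega> = (\<Inter>n::nat. sigma_sets \<Omega>
       {(\<lambda>\<omega>. \<omega> k) -` A \<inter> \<Omega> | k A. \<bar>k\<bar> \<ge> int n})"

definition tail_trivial :: "(int \<Rightarrow> 'a) measure \<Rightarrow> bool" where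
  "tail_trivial M \<longleftrightarrow> (\<forall>A \<in> two_sided_tail (space M). measure M A = 0 \<or> measure M A = 1)"

definition dmetric :: "'a \<Rightarrow> 'a \<Rightarrow> real" where
  "dmetric x y = (if x = y then 0 else 1)"

definition osc_set :: "((int \<Rightarrow> 'a) \<Rightarrow> real) \<Rightarrow> int \<Rightarrow> real set" where
  "osc_set f i = {(f x - f y) / dmetric (x i) (y i) | x y. (\<forall>j. j \<noteq> i \<longrightarrow> x j = y j) \<and> x i \<noteq> y i}"

text \<open>delta_i(f); the set is symmetric under swapping x and y, so adding 0 only
  fixes the convention delta_i(f) = 0 when E is a singleton.\<close>
definition delta :: "((int \<Rightarrow> 'a) \<Rightarrow> real) \<Rightarrow> int \<Rightarrow> real" where
  "delta f i = Sup ({0} \<union> osc_set f i)"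

definition lip :: "(int \<Rightarrow> 'a) measure \<Rightarrow> ((int \<Rightarrow> 'a) \<Rightarrow> real) \<Rightarrow> bool" where
  "lip M f \<longleftrightarrow> f \<in> borel_measurable M \<and> (\<forall>i. bdd_above (osc_set f i))"

definition delta_norm2 :: "((int \<Rightarrow> 'a) \<Rightarrow> real) \<Rightarrow> ennreal" where
  "delta_norm2 f = (\<Sum>\<^sub>\<infinity> i. ennreal ((delta f i)\<^sup>2))"

definition zeta_real :: "real \<Rightarrow> real" where
  "zeta_real s = (\<Sum>n. 1 / (real (Suc n)) powr s)"

definition C_const ::
  "('a \<Rightarrow> 'a \<Rightarrow> real) \<Rightarrow> ('a \<Rightarrow> real) \<Rightarrow> ('a \<Rightarrow> 'a \<Rightarrow> (nat \<Rightarrow> 'a \<times> 'a) measure)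
    \<Rightarrow> nat \<Rightarrow> real \<Rightarrow> ennreal" where
  "C_const K nu Ph p \<epsilon> =
     ennreal ((2 * real p - 1) ^ (2 * p) * (zeta_real (1 + \<epsilon>) / 2) ^ p) *
     (\<Sum>\<^sub>\<infinity> (x, y). ennreal (nu x * K x y) *
        (\<Sum>\<^sub>\<infinity> z. ennreal (K x z) *
           (\<integral>\<^sup>+ \<omega>. time_pow (coupling_time \<omega>) (1 + \<epsilon> / 2) \<partial>(Ph y z))) ^ (2 * p))"

end

(*
  Write g_i for the conditional expectation of f given the coordinates up to i.  The increment
  g_i - g_(i-1) is the average over z, with weights p(X_(i-1), z), of a difference of two
  expectations, in which the future of the chain is started at time i from X_i and from z.  Run the coupling from (X_i, z):
  the two futures differ only at the times i, ..., i+T-1, so the difference is at most the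
  expectation of delta_i + ... + delta_(i+T-1).  By Cauchy-Schwarz with weights j^(1+eps), and
  because 1^(1+eps) + ... + T^(1+eps) <= (T+1)^(2+eps)/2, this is at most
  sqrt(a_i) (T+1)^(1+eps/2), where a_i = 1/2 sum_j delta_(i+j)^2 (j+1)^(-1-eps) and the a_i add
  up to at most zeta(1+eps)/2 * ||delta||^2.

  No square function inequality is needed: the increments are bounded in L^2p, by multiples of
  identically distributed variables, so it suffices that
  ||X + Y||_2p^2 <= ||X||_2p^2 + (2p-1)^2 ||Y||_2p^2 whenever E(X^(2p-1) Y) = 0.  By Hoelder this
  reduces to (1+t)^2p - 2pt <= (1 + (2p-1)^2 t^2)^p for t >= 0.

  The g_i form an L^1 Cauchy sequence in both directions.  The limit at +infinity is f; the limit
  at -infinity is tail measurable, hence equal to the mean by triviality of the tail.  Triviality is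
  used once more when ||delta|| = 0, as C_p may then be infinite and the bound reads infinity * 0 = 0.
*)
theory Submission
  imports Defs
begin

text \<open>Conditional expectations are explicit integrals over a restarted chain, defined at every
  path, not classes modulo null sets. This lets g_i and g_(i-1) be compared along one path, and
  makes the limit at -infinity a function of far coordinates at every path. The price is a Markov
  property in integrated form (\<open>disintegration\<close>) and a restarted function that is
  integrable only almost surely; discreteness of the state space turns this into a statement on all
  transitions of positive probability. The chain from a single state is not among the data: it is
  obtained as a marginal of the coupling, whose coordinates must be shown to be chains from the
  marginal sums of \<open>Q\<close> alone. The inequality for X + Y is used for squared norms: each
  increment adds (2p-1)^2 times its squared norm, and the p-th power of the final sum gives
  (2p-1)^(2p). As the a_i have a finite sum, convergence along the filtration follows from the same
  moment estimate, without a martingale convergence theorem; almost sure convergence of subsequences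
  is enough to conclude by Fatou.\<close>

subsection \<open>A moment inequality for martingale increments\<close>

text \<open>The difference \<open>g\<close> of the two sides vanishes at 0 and is nondecreasing on
  the half line. With \<open>m\<close> = 2p-1, the sign of its derivative rests on two losses of a
  factor \<open>m\<close>: one from the geometric sum for (1+u)^(2p-1) - 1, one from replacing
  (1+u)^2 by a multiple of 1 + m^2 u^2. Together they account for the coefficient m^2.\<close>

lemma binomial_minus_linear_term_le:
  fixes t :: real and p :: nat
  assumes "p \<ge> 1" "t \<ge> 0"
  shows "(1 + t) ^ (2 * p) - 2 * real p * t \<le> (1 + (2 * real p - 1)\<^sup>2 * t\<^sup>2) ^ p"
proof -
  define m where "m = 2 * real p - 1"
  define g where "g u = (1 + m\<^sup>2 * u\<^sup>2) ^ p - (1 + u) ^ (2 * p) + 2 * real p * u" for u :: real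
  define g' where "g' u = 2 * real p * (m\<^sup>2 * u * (1 + m\<^sup>2 * u\<^sup>2) ^ (p - 1) - (1 + u) ^ (2 * p - 1) + 1)" for u :: real
  have m1: "m \<ge> 1" using assms by (simp add: m_def)
  have deriv: "(g has_real_derivative g' u) (at u)" for u
  proof -
    have "(g has_real_derivative real p * (1 + m\<^sup>2 * u\<^sup>2) ^ (p - 1) * (m\<^sup>2 * (2 * u)) -
        real (2 * p) * (1 + u) ^ (2 * p - 1) + 2 * real p) (at u)"
      unfolding g_def by (rule derivative_eq_intros refl | simp)+
    then show ?thesis
      by (rule back_subst [of "\<lambda>d. (g has_real_derivative d) (at u)"])
         (simp add: g'_def algebra_simps)
  qed
  \<comment> \<open>The exponent p-1 is (m-1)/2, and (m-1)/(2m^2) \<le> 1 - 1/m \<le> ln m.\<close>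
  have exp_le: "(1 + 1 / m\<^sup>2) ^ (p - 1) \<le> m"
  proof -
    have "(1 + 1 / m\<^sup>2) ^ (p - 1) \<le> exp (1 / m\<^sup>2) ^ (p - 1)"
      by (intro power_mono exp_ge_add_one_self) simp
    also have "\<dots> = exp (real (p - 1) / m\<^sup>2)"
      by (simp add: exp_of_nat_mult [symmetric])
    also have "real (p - 1) = (m - 1) / 2"
      using assms by (simp add: m_def of_nat_diff)
    also have "(m - 1) / 2 / m\<^sup>2 \<le> 1 - 1 / m"
    proof -
      have "(m - 1) / 2 / m\<^sup>2 = (1 - 1 / m) * (1 / (2 * m))"
        using m1 by (simp add: field_simps power2_eq_square)
      also have "\<dots> \<le> (1 - 1 / m) * 1"
        using m1 by (intro mult_left_mono) (auto simp: field_simps)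
      finally show ?thesis by simp
    qed
    also have "exp (1 - 1 / m) \<le> m"
    proof -
      have "ln (1 / m) \<le> 1 / m - 1" using m1 by (intro ln_le_minus_one) simp
      then have "1 - 1 / m \<le> ln m" using m1 by (simp add: ln_div)
      then show ?thesis using m1 by (simp add: ln_ge_iff)
    qed
    finally show ?thesis by simp
  qed
  have g'_nonneg: "g' u \<ge> 0" if u: "u \<ge> 0" for u
  proof -
    have "(1 + u) ^ (2 * p - 1) - 1 \<le> m * u * (1 + u) ^ (2 * p - 2)"
    proof -
      have "(1 + u) ^ (2 * p - 1) - 1 = u * (\<Sum>i<2 * p - 1. (1 + u) ^ i)"
        using power_diff_1_eq [of "1 + u" "2 * p - 1"] by simp
      also have "\<dots> \<le> u * (\<Sum>i<2 * p - 1. (1 + u) ^ (2 * p - 2))"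
        using u by (intro mult_left_mono sum_mono power_increasing) auto
      also have "\<dots> = m * u * (1 + u) ^ (2 * p - 2)"
        using assms by (simp add: m_def of_nat_diff)
      finally show ?thesis .
    qed
    also have "m * u * (1 + u) ^ (2 * p - 2) = m * u * ((1 + u)\<^sup>2) ^ (p - 1)"
      unfolding power_mult [symmetric] diff_mult_distrib2 by simp
    also have "\<dots> \<le> m * u * ((1 + 1 / m\<^sup>2) * (1 + m\<^sup>2 * u\<^sup>2)) ^ (p - 1)"
    proof (intro mult_left_mono power_mono)
      \<comment> \<open>Cauchy-Schwarz for the vectors (1, 1/m) and (1, mu), whose inner product is
        1+u; the defect is an exact square.\<close>
      have "(1 + 1 / m\<^sup>2) * (1 + m\<^sup>2 * u\<^sup>2) - (1 + u)\<^sup>2 = (m * u - 1 / m)\<^sup>2"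
        using m1 by (simp add: field_simps power2_eq_square)
      also have "\<dots> \<ge> 0" by simp
      finally show "(1 + u)\<^sup>2 \<le> (1 + 1 / m\<^sup>2) * (1 + m\<^sup>2 * u\<^sup>2)" by simp
    qed (use m1 u in auto)
    also have "\<dots> = m * u * (1 + 1 / m\<^sup>2) ^ (p - 1) * (1 + m\<^sup>2 * u\<^sup>2) ^ (p - 1)"
      by (simp add: power_mult_distrib)
    also have "\<dots> \<le> m * u * m * (1 + m\<^sup>2 * u\<^sup>2) ^ (p - 1)"
      using m1 u exp_le by (intro mult_right_mono mult_left_mono) auto
    finally have "0 \<le> m\<^sup>2 * u * (1 + m\<^sup>2 * u\<^sup>2) ^ (p - 1) - (1 + u) ^ (2 * p - 1) + 1"
      by (simp add: power2_eq_square algebra_simps)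
    then show ?thesis by (simp add: g'_def)
  qed
  have "g 0 \<le> g t"
  proof (rule DERIV_nonneg_imp_nondecreasing [OF assms(2)])
    fix u :: real assume "0 \<le> u"
    then show "\<exists>y. (g has_real_derivative y) (at u) \<and> 0 \<le> y"
      using deriv [of u] g'_nonneg [of u] by blast
  qed
  then show ?thesis by (simp add: g_def m_def)
qed

text \<open>Young's inequality for u^n and v^n with weights (n-k)/n and k/n. The boundary cases are
  split off because the passage through real exponents is made for positive bases.\<close>

lemma weighted_AM_GM_power:
  fixes u v :: real
  assumes "u \<ge> 0" "v \<ge> 0" "k \<le> n" "n > 0"
  shows "u ^ (n - k) * v ^ k \<le> (real (n - k) * u ^ n + real k * v ^ n) / real n"
proof (cases "k = 0 \<or> k = n \<or> u = 0 \<or> v = 0")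
  case True
  then show ?thesis using assms by (auto simp: zero_power power_0_left)
next
  case False
  then have k: "0 < k" "k < n" "u > 0" "v > 0" using assms by auto
  have a: "real (n - k) / n + real k / n = 1" using k by (simp add: of_nat_diff field_simps)
  have *: "(u ^ n) powr (real (n - k) / n) = u ^ (n - k)" "(v ^ n) powr (real k / n) = v ^ k"
  proof -
    have "(w ^ n) powr (real l / n) = w ^ l" if "w > 0" for w :: real and l
      using that k powr_powr [of w "real n" "real l / n"] by (simp add: powr_realpow)
    then show "(u ^ n) powr (real (n - k) / n) = u ^ (n - k)" "(v ^ n) powr (real k / n) = v ^ k"
      using k by blast+
  qed
  show ?thesis
    using Youngs_inequality_0 [of "real (n - k) / n" "real k / n" "u ^ n" "v ^ n"] a assms k
    unfolding * by (simp add: add_divide_distrib zero_less_power)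
qed

text \<open>The pointwise source of both the integrability of mixed products and the Hoelder bound
  on their integrals.\<close>

lemma mixed_power_le:
  fixes x y :: real
  assumes "p \<ge> 1" "k \<le> 2 * p"
  shows "\<bar>x ^ (2 * p - k) * y ^ k\<bar> \<le> (real (2 * p - k) * x ^ (2 * p) + real k * y ^ (2 * p)) / real (2 * p)"
  using weighted_AM_GM_power [of "\<bar>x\<bar>" "\<bar>y\<bar>" k "2 * p"] assms
  by (simp add: abs_mult power_abs [symmetric] power_even_abs)

lemma integrable_mixed_power:
  fixes X Y :: "'a \<Rightarrow> real"
  assumes p: "p \<ge> 1"
    and [measurable]: "X \<in> borel_measurable M" "Y \<in> borel_measurable M"
    and int: "integrable M (\<lambda>x. X x ^ (2 * p))" "integrable M (\<lambda>x. Y x ^ (2 * p))"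
    and k: "k \<le> 2 * p"
  shows "integrable M (\<lambda>x. X x ^ (2 * p - k) * Y x ^ k)"
  by (rule Bochner_Integration.integrable_bound
      [where f = "\<lambda>x. (real (2 * p - k) * X x ^ (2 * p) + real k * Y x ^ (2 * p)) / real (2 * p)"])
    (use int mixed_power_le [OF p k] in \<open>auto intro!: AE_I2 order_trans [OF _ abs_ge_self]\<close>)

lemma add_even_power_eq:
  "(x + y) ^ (2 * p) = (\<Sum>k\<le>2 * p. real (2 * p choose k) * (x ^ (2 * p - k) * y ^ k))" for x y :: real
  by (subst add.commute, subst binomial_ring) (simp add: mult_ac)

lemma integrable_even_power_add:
  fixes X Y :: "'a \<Rightarrow> real"
  assumes "p \<ge> 1" "X \<in> borel_measurable M" "Y \<in> borel_measurable M"
    "integrable M (\<lambda>x. X x ^ (2 * p))" "integrable M (\<lambda>x. Y x ^ (2 * p))"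
  shows "integrable M (\<lambda>x. (X x + Y x) ^ (2 * p))"
  unfolding add_even_power_eq using assms
  by (intro Bochner_Integration.integrable_sum integrable_mult_right integrable_mixed_power) auto

text \<open>In the binomial expansion of (X+Y)^(2p) the hypothesis \<open>orth\<close> removes
  exactly the term linear in Y; Hoelder bounds the others, so they sum to at most (a+b)^(2p) - 2p
  a^(2p-1) b, and the scalar inequality applies with t = b/a. \<open>A\<close> and \<open>B\<close>
  are upper bounds for the squared norms rather than the norms themselves, so that the conclusion
  has the shape of a hypothesis and the lemma can be iterated.\<close>

lemma even_moment_add_le:
  fixes X Y :: "'a \<Rightarrow> real"
  assumes p: "p \<ge> 1"
    and [measurable]: "X \<in> borel_measurable M" "Y \<in> borel_measurable M"
    and int: "integrable M (\<lambda>x. X x ^ (2 * p))" "integrable M (\<lambda>x. Y x ^ (2 * p))"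
    and le: "(\<integral>x. X x ^ (2 * p) \<partial>M) \<le> A ^ p" "(\<integral>x. Y x ^ (2 * p) \<partial>M) \<le> B ^ p"
    and AB: "A \<ge> 0" "B \<ge> 0"
    and orth: "(\<integral>x. X x ^ (2 * p - 1) * Y x \<partial>M) = 0"
  shows "(\<integral>x. (X x + Y x) ^ (2 * p) \<partial>M) \<le> (A + (2 * real p - 1)\<^sup>2 * B) ^ p"
proof -
  let ?n = "2 * p"
  have n: "?n > 0" using p by simp
  note mixed = mixed_power_le [OF p]
  have int_mixed: "integrable M (\<lambda>x. X x ^ (?n - k) * Y x ^ k)" if "k \<le> ?n" for k
    using p int that by (intro integrable_mixed_power) auto
  note binom = add_even_power_eq
  have main: "(\<integral>x. (X x + Y x) ^ ?n \<partial>M) \<le> (a\<^sup>2 + (2 * real p - 1)\<^sup>2 * b\<^sup>2) ^ p"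
    if a: "a > 0" and b: "b > 0" and aX: "(\<integral>x. X x ^ ?n \<partial>M) \<le> a ^ ?n"
      and bY: "(\<integral>x. Y x ^ ?n \<partial>M) \<le> b ^ ?n" for a b
  proof -
    \<comment> \<open>Hoelder by normalisation: Young's inequality for X/a and Y/b is integrated,
      and each normalised moment is at most 1.\<close>
    have hoelder: "(\<integral>x. X x ^ (?n - k) * Y x ^ k \<partial>M) \<le> a ^ (?n - k) * b ^ k" if k: "k \<le> ?n" for k
    proof -
      have "(\<integral>x. X x ^ (?n - k) * Y x ^ k \<partial>M) \<le>
          (\<integral>x. a ^ (?n - k) * b ^ k * ((real (?n - k) * (X x ^ ?n / a ^ ?n) + real k * (Y x ^ ?n / b ^ ?n)) / real ?n) \<partial>M)"
      proof (rule integral_mono)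
        fix x
        have "(X x / a) ^ (?n - k) * (Y x / b) ^ k \<le>
            (real (?n - k) * (X x / a) ^ ?n + real k * (Y x / b) ^ ?n) / real ?n"
          using mixed [OF k, of "X x / a" "Y x / b"] by linarith
        then have "a ^ (?n - k) * b ^ k * ((X x / a) ^ (?n - k) * (Y x / b) ^ k) \<le>
            a ^ (?n - k) * b ^ k * ((real (?n - k) * (X x / a) ^ ?n + real k * (Y x / b) ^ ?n) / real ?n)"
          using a b by (intro mult_left_mono) auto
        moreover have "a ^ (?n - k) * b ^ k * ((X x / a) ^ (?n - k) * (Y x / b) ^ k) = X x ^ (?n - k) * Y x ^ k"
          using a b by (simp add: power_divide)
        ultimately show "X x ^ (?n - k) * Y x ^ k \<le>
            a ^ (?n - k) * b ^ k * ((real (?n - k) * (X x ^ ?n / a ^ ?n) + real k * (Y x ^ ?n / b ^ ?n)) / real ?n)"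
          by (simp add: power_divide)
      qed (use int int_mixed k in auto)
      also have "\<dots> = a ^ (?n - k) * b ^ k * ((real (?n - k) * ((\<integral>x. X x ^ ?n \<partial>M) / a ^ ?n) +
          real k * ((\<integral>x. Y x ^ ?n \<partial>M) / b ^ ?n)) / real ?n)"
        using int by simp
      also have "\<dots> \<le> a ^ (?n - k) * b ^ k * ((real (?n - k) * 1 + real k * 1) / real ?n)"
        using a b aX bY by (intro mult_left_mono divide_right_mono add_mono) (auto simp: field_simps)
      also have "\<dots> = a ^ (?n - k) * b ^ k"
        using k n by (simp add: of_nat_diff del: of_nat_mult)
      finally show ?thesis .
    qed
    have split: "(\<Sum>k\<le>?n. F k) = F 1 + (\<Sum>k\<in>{..?n} - {1}. F k)" for F :: "nat \<Rightarrow> real"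
      using p by (subst sum.remove [of _ 1]) auto
    have "(\<integral>x. (X x + Y x) ^ ?n \<partial>M) = (\<Sum>k\<le>?n. real (?n choose k) * (\<integral>x. X x ^ (?n - k) * Y x ^ k \<partial>M))"
      unfolding binom using int_mixed by (subst Bochner_Integration.integral_sum) auto
    also have "\<dots> = (\<Sum>k\<in>{..?n} - {1}. real (?n choose k) * (\<integral>x. X x ^ (?n - k) * Y x ^ k \<partial>M))"
      using orth unfolding split by simp
    also have "\<dots> \<le> (\<Sum>k\<in>{..?n} - {1}. real (?n choose k) * (a ^ (?n - k) * b ^ k))"
      by (intro sum_mono mult_left_mono hoelder) auto
    also have "\<dots> = (a + b) ^ ?n - real ?n * (a ^ (?n - 1) * b)"
      using split [of "\<lambda>k. real (?n choose k) * (a ^ (?n - k) * b ^ k)"]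
      by (subst add.commute [of a b], subst binomial_ring) (simp add: mult_ac)
    also have "\<dots> = a ^ ?n * ((1 + b / a) ^ ?n - 2 * real p * (b / a))"
    proof -
      have "a ^ ?n = a * a ^ (?n - 1)" using n by (metis power_eq_if less_irrefl)
      moreover have "a ^ ?n * (1 + b / a) ^ ?n = (a + b) ^ ?n"
        using a by (simp add: power_mult_distrib [symmetric] distrib_left)
      ultimately show ?thesis using a by (simp add: right_diff_distrib)
    qed
    also have "\<dots> \<le> a ^ ?n * (1 + (2 * real p - 1)\<^sup>2 * (b / a)\<^sup>2) ^ p"
      using a b p by (intro mult_left_mono binomial_minus_linear_term_le) auto
    also have "\<dots> = (a\<^sup>2 + (2 * real p - 1)\<^sup>2 * b\<^sup>2) ^ p"
    proof -
      have "a\<^sup>2 * (1 + (2 * real p - 1)\<^sup>2 * (b / a)\<^sup>2) = a\<^sup>2 + (2 * real p - 1)\<^sup>2 * b\<^sup>2"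
        using a by (simp add: distrib_left power_divide)
      then show ?thesis by (simp add: power_mult flip: power_mult_distrib)
    qed
    finally show ?thesis .
  qed
  \<comment> \<open>\<open>main\<close> divides by \<open>a\<close> and \<open>b\<close>, while
    \<open>A\<close> and \<open>B\<close> may be 0: an iteration starts from \<open>A\<close> = 0.
    Hence both are enlarged by \<open>e\<close>, which then tends to 0.\<close>
  have upper: "(\<integral>x. (X x + Y x) ^ ?n \<partial>M) \<le> (A + e + (2 * real p - 1)\<^sup>2 * (B + e)) ^ p" if e: "e > 0" for e
  proof -
    have "(\<integral>x. X x ^ ?n \<partial>M) \<le> (A + e) ^ p" "(\<integral>x. Y x ^ ?n \<partial>M) \<le> (B + e) ^ p"
      using le power_mono [of A "A + e" p] power_mono [of B "B + e" p] AB e by linarith+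
    then show ?thesis
      using main [of "sqrt (A + e)" "sqrt (B + e)"] AB e by (simp add: power_mult)
  qed
  have "\<forall>\<^sub>F e in at_right 0. (\<integral>x. (X x + Y x) ^ ?n \<partial>M) \<le> (A + e + (2 * real p - 1)\<^sup>2 * (B + e)) ^ p"
    using eventually_at_right_less [of "0 :: real"] by (rule eventually_mono) (rule upper)
  moreover have "((\<lambda>e. (A + e + (2 * real p - 1)\<^sup>2 * (B + e)) ^ p) \<longlongrightarrow>
      (A + 0 + (2 * real p - 1)\<^sup>2 * (B + 0)) ^ p) (at_right 0)"
    by (intro tendsto_intros)
  ultimately show "(\<integral>x. (X x + Y x) ^ (2 * p) \<partial>M) \<le> (A + (2 * real p - 1)\<^sup>2 * B) ^ p"
    by (simp add: tendsto_lowerbound)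
qed

subsection \<open>Measures on path spaces\<close>

text \<open>Turns the infinite sums of the statement into integrals over counting measure, where
  Tonelli and monotone convergence are at hand. The nontrivial bound exhausts the type by the finite
  sets on which \<open>to_nat\<close> is below n.\<close>

lemma infsum_eq_nn_integral_count_space:
  fixes f :: "'a::countable \<Rightarrow> ennreal"
  shows "(\<Sum>\<^sub>\<infinity>x. f x) = (\<integral>\<^sup>+x. f x \<partial>count_space UNIV)"
proof (rule antisym)
  have "(\<Sum>\<^sub>\<infinity>x. f x) = (SUP F\<in>{F. finite F \<and> F \<subseteq> UNIV}. sum f F)"
    by (rule nonneg_infsum_complete) simp
  also have "\<dots> \<le> (\<integral>\<^sup>+x. f x \<partial>count_space UNIV)"
  proof (rule SUP_least)
    fix F :: "'a set" assume "F \<in> {F. finite F \<and> F \<subseteq> UNIV}"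
    then have "sum f F = (\<integral>\<^sup>+x. f x * indicator F x \<partial>count_space UNIV)"
      by (subst nn_integral_count_space' [of F]) auto
    also have "\<dots> \<le> (\<integral>\<^sup>+x. f x \<partial>count_space UNIV)"
      by (intro nn_integral_mono) (auto split: split_indicator)
    finally show "sum f F \<le> (\<integral>\<^sup>+x. f x \<partial>count_space UNIV)" .
  qed
  finally show "(\<Sum>\<^sub>\<infinity>x. f x) \<le> (\<integral>\<^sup>+x. f x \<partial>count_space UNIV)" .
next
  define F where "F n = {x::'a. to_nat x < n}" for n
  have fin: "finite (F n)" for n
    unfolding F_def by (rule finite_imageD [of to_nat]) (auto intro: finite_subset [of _ "{..<n}"] inj_on_subset [OF inj_to_nat])
  have "(\<integral>\<^sup>+x. f x \<partial>count_space UNIV) = (\<integral>\<^sup>+x. (SUP n. f x * indicator (F n) x) \<partial>count_space UNIV)"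
  proof (intro nn_integral_cong antisym)
    fix x
    have "f x = f x * indicator (F (Suc (to_nat x))) x" by (simp add: F_def)
    then show "f x \<le> (SUP n. f x * indicator (F n) x)" by (metis SUP_upper UNIV_I)
    show "(SUP n. f x * indicator (F n) x) \<le> f x"
      by (intro SUP_least) (auto split: split_indicator)
  qed
  also have "\<dots> = (SUP n. \<integral>\<^sup>+x. f x * indicator (F n) x \<partial>count_space UNIV)"
    by (intro nn_integral_monotone_convergence_SUP)
       (auto simp: incseq_def le_fun_def F_def split: split_indicator)
  also have "\<dots> \<le> (\<Sum>\<^sub>\<infinity>x. f x)"
  proof (rule SUP_least)
    fix n
    have "(\<integral>\<^sup>+x. f x * indicator (F n) x \<partial>count_space UNIV) = sum f (F n)"
      using fin by (subst nn_integral_count_space' [of "F n"]) auto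
    also have "\<dots> \<le> (\<Sum>\<^sub>\<infinity>x. f x)"
      using fin by (subst nonneg_infsum_complete) (auto intro!: SUP_upper)
    finally show "(\<integral>\<^sup>+x. f x * indicator (F n) x \<partial>count_space UNIV) \<le> (\<Sum>\<^sub>\<infinity>x. f x)" .
  qed
  finally show "(\<integral>\<^sup>+x. f x \<partial>count_space UNIV) \<le> (\<Sum>\<^sub>\<infinity>x. f x)" .
qed

lemma space_path_space [simp]: "space path_space = UNIV"
  by (simp add: path_space_def space_PiM)

lemma sets_path_space_imp_space: "sets M = sets path_space \<Longrightarrow> space M = UNIV"
  using sets_eq_imp_space_eq by fastforce

lemma measurable_path_component [measurable]:
  "(\<lambda>\<omega>. \<omega> i) \<in> measurable path_space (count_space UNIV)"
  unfolding path_space_def by measurable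

lemma measurable_path_spaceI:
  assumes "\<And>i. (\<lambda>\<omega>. f \<omega> i) \<in> measurable M (count_space UNIV)"
  shows "f \<in> measurable M path_space"
  unfolding path_space_def using assms by (intro measurable_PiM_single') auto

lemma measurable_map_path:
  fixes \<phi> :: "'a::countable \<Rightarrow> 'b"
  shows "(\<lambda>\<omega> n. \<phi> (\<omega> n)) \<in> measurable path_space path_space"
  by (rule measurable_path_spaceI) (rule measurable_compose [OF measurable_path_component], simp)

section \<open>Cylinder sets determine measures on path spaces\<close>

text \<open>The prescribed values come from a whole path, of which only the part on \<open>J\<close>
  counts; index sets can thus grow without a change of the path.\<close>

definition cylinder :: "'i set \<Rightarrow> ('i \<Rightarrow> 'a) \<Rightarrow> ('i \<Rightarrow> 'a) set" where
  "cylinder J x = {\<omega>. \<forall>k\<in>J. \<omega> k = x k}"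

lemma cylinder_sets [measurable]:
  fixes J :: "'i::countable set"
  shows "cylinder J x \<in> sets path_space"
proof -
  have "Measurable.pred path_space (\<lambda>\<omega>. \<forall>k\<in>J. \<omega> k = x k)" by measurable
  then show ?thesis by (simp add: pred_def cylinder_def)
qed

text \<open>Along an increasing sequence of index sets two cylinders are either disjoint or nested,
  so with the empty set they form a pi-system. Each index set is finite and the state space
  countable, so there are countably many cylinders at each level; those of level 0 already cover the
  space.\<close>

lemma path_space_measure_eqI:
  fixes A B :: "('i::countable \<Rightarrow> 'a::countable) measure" and J :: "nat \<Rightarrow> 'i set"
  assumes J: "incseq J" "(\<Union>n. J n) = UNIV" "\<And>n. finite (J n)"
    and sets: "sets A = sets path_space" "sets B = sets path_space"
    and "finite_measure A"
    and eq: "\<And>n x. emeasure A (cylinder (J n) x) = emeasure B (cylinder (J n) x)"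
  shows "A = B"
proof (rule measure_eqI_generator_eq_countable)
  define E where "E = insert {} (range (\<lambda>(n, x). cylinder (J n) x) :: ('i \<Rightarrow> 'a) set set)"
  interpret A: finite_measure A by fact
  have nested: "cylinder (J n) x \<inter> cylinder (J m) y \<in> {{}, cylinder (J m) y}"
    if "J n \<subseteq> J m" for n m and x y :: "'i \<Rightarrow> 'a"
  proof (cases "\<forall>k\<in>J n. y k = x k")
    case True
    then show ?thesis using that by (auto simp: cylinder_def)
  next
    case False
    then have "cylinder (J n) x \<inter> cylinder (J m) y = {}"
      using that by (auto simp: cylinder_def) (metis subsetD)
    then show ?thesis by simp
  qed
  show "Int_stable E"
  proof (rule Int_stableI)
    fix a b assume "a \<in> E" "b \<in> E"
    consider "a = {} \<or> b = {}" | n x m y where "a = cylinder (J n) x" "b = cylinder (J m) y"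
      using \<open>a \<in> E\<close> \<open>b \<in> E\<close> by (auto simp: E_def)
    then show "a \<inter> b \<in> E"
    proof cases
      case 1 then show ?thesis by (auto simp: E_def)
    next
      case 2
      have "J n \<subseteq> J m \<or> J m \<subseteq> J n"
        using J(1) by (metis incseqD nat_le_linear)
      then have "a \<inter> b \<in> {{}, a, b}"
        using nested [of n m x y] nested [of m n y x] 2 by blast
      then show ?thesis using 2 by (auto simp: E_def)
    qed
  qed
  show "E \<subseteq> Pow UNIV" by simp
  show "emeasure A X = emeasure B X" if "X \<in> E" for X
    using that eq by (auto simp: E_def)
  have cyl_count: "countable (range (\<lambda>x. cylinder (J n) x :: ('i \<Rightarrow> 'a) set))" for n
  proof -
    have "range (\<lambda>x. cylinder (J n) x :: ('i \<Rightarrow> 'a) set) \<subseteq> cylinder (J n) ` PiE (J n) (\<lambda>_. UNIV)"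
    proof (rule image_subsetI)
      fix x :: "'i \<Rightarrow> 'a"
      show "cylinder (J n) x \<in> cylinder (J n) ` PiE (J n) (\<lambda>_. UNIV)"
        by (rule image_eqI [of _ _ "restrict x (J n)"]) (auto simp: cylinder_def)
    qed
    moreover have "countable (cylinder (J n) ` PiE (J n) (\<lambda>_. UNIV :: 'a set))"
      using J(3) by (intro countable_image countable_PiE) auto
    ultimately show ?thesis by (rule countable_subset)
  qed
  show "range (\<lambda>x. cylinder (J 0) x) \<subseteq> E" by (auto simp: E_def)
  show "(\<Union>x. cylinder (J 0) x) = UNIV" by (auto simp: cylinder_def)
  show "countable (range (\<lambda>x. cylinder (J 0) x :: ('i \<Rightarrow> 'a) set))" by (rule cyl_count)
  show "emeasure A a \<noteq> \<infinity>" for a by simp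
  have E_sub: "E \<subseteq> sets path_space" by (auto simp: E_def)
  have "sets path_space = sigma_sets UNIV E"
  proof
    show "sigma_sets UNIV E \<subseteq> sets (path_space :: ('i \<Rightarrow> 'a) measure)"
      using sets.sigma_sets_subset [OF E_sub] by simp
    have "(\<lambda>\<omega>. \<omega>) \<in> measurable (sigma UNIV E) (path_space :: ('i \<Rightarrow> 'a) measure)"
    proof (rule measurable_path_spaceI)
      fix i :: 'i
      obtain n where n: "i \<in> J n" using J(2) by blast
      have "(\<lambda>\<omega>. \<omega> i) -` {a} \<inter> space (sigma UNIV E) \<in> sets (sigma UNIV E)" for a
      proof -
        \<comment> \<open>Once \<open>i\<close> lies in \<open>J n\<close>, the event that
          coordinate \<open>i\<close> equals \<open>a\<close> is a union of cylinders of level n,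
          and that union is countable.\<close>
        have *: "(\<lambda>\<omega>. \<omega> i) -` {a} = \<Union>{C \<in> range (\<lambda>x. cylinder (J n) x). C \<subseteq> (\<lambda>\<omega>. \<omega> i) -` {a}}"
        proof (intro equalityI subsetI)
          fix \<omega> :: "'i \<Rightarrow> 'a" assume "\<omega> \<in> (\<lambda>\<omega>. \<omega> i) -` {a}"
          then have "\<omega> \<in> cylinder (J n) \<omega>" "cylinder (J n) \<omega> \<subseteq> (\<lambda>\<omega>. \<omega> i) -` {a}"
            using n by (auto simp: cylinder_def)
          then show "\<omega> \<in> \<Union>{C \<in> range (\<lambda>x. cylinder (J n) x). C \<subseteq> (\<lambda>\<omega>. \<omega> i) -` {a}}" by blast
        qed auto
        have "(\<lambda>\<omega>. \<omega> i) -` {a} \<in> sets (sigma UNIV E)"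
          by (subst *, intro sets.countable_Union countable_subset [OF _ cyl_count [of n]])
             (auto simp: E_def)
        then show ?thesis
          by (simp add: space_measure_of_conv)
      qed
      then show "(\<lambda>\<omega>. \<omega> i) \<in> measurable (sigma UNIV E) (count_space (UNIV :: 'a set))"
        by (simp add: measurable_count_space_eq2_countable)
    qed
    then show "sets (path_space :: ('i \<Rightarrow> 'a) measure) \<subseteq> sigma_sets UNIV E"
      by (auto simp: measurable_def sets_measure_of_conv space_measure_of_conv)
  qed
  then show "sets A = sigma_sets UNIV E" "sets B = sigma_sets UNIV E" using sets by auto
qed

subsection \<open>Disintegration\<close>

text \<open>An abstract Markov property: \<open>s \<omega> \<eta>\<close> replaces a part of
  \<open>\<omega>\<close> by \<open>\<eta>\<close>, and drawing \<open>\<eta>\<close> from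
  \<open>P z\<close> on the event X = z leaves the law \<open>N\<close> unchanged. It is stated for
  the unnormalised restriction of \<open>N\<close> to each value of \<open>X\<close>, so values of
  probability 0 need no convention for conditioning on them.\<close>

locale disintegration = prob_space N
  for N :: "'w measure" +
  fixes X :: "'w \<Rightarrow> 'z::countable" and P :: "'z \<Rightarrow> 'v measure" and s :: "'w \<Rightarrow> 'v \<Rightarrow> 'w"
    and V :: "'v measure"
  assumes X [measurable]: "X \<in> measurable N (count_space UNIV)"
    and P: "\<And>z. prob_space (P z)" and sets_P [measurable_cong]: "\<And>z. sets (P z) = sets V"
    and s [measurable]: "case_prod s \<in> measurable (N \<Otimes>\<^sub>M V) N"
    and disint: "\<And>z. density N (indicator {\<omega>. X \<omega> = z}) =
      distr (density N (indicator {\<omega>. X \<omega> = z}) \<Otimes>\<^sub>M P z) N (case_prod s)"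
begin

lemma measurable_nn_kernel [measurable]:
  assumes [measurable]: "case_prod F \<in> borel_measurable (N \<Otimes>\<^sub>M V)"
  shows "(\<lambda>\<omega>. \<integral>\<^sup>+\<eta>. F \<omega> \<eta> \<partial>P (X \<omega>)) \<in> borel_measurable N"
proof (rule measurable_compose_countable [OF _ X])
  fix z
  interpret Pz: prob_space "P z" by (rule P)
  show "(\<lambda>\<omega>. \<integral>\<^sup>+\<eta>. F \<omega> \<eta> \<partial>P z) \<in> borel_measurable N" by measurable
qed

lemma measurable_kernel:
  fixes F :: "'w \<Rightarrow> 'v \<Rightarrow> real"
  assumes [measurable]: "case_prod F \<in> borel_measurable (N \<Otimes>\<^sub>M V)"
  shows "(\<lambda>\<omega>. \<integral>\<eta>. F \<omega> \<eta> \<partial>P (X \<omega>)) \<in> borel_measurable N"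
proof (rule measurable_compose_countable [OF _ X])
  fix z
  interpret Pz: prob_space "P z" by (rule P)
  show "(\<lambda>\<omega>. \<integral>\<eta>. F \<omega> \<eta> \<partial>P z) \<in> borel_measurable N" by measurable
qed

lemma nn_integral_disint:
  assumes F [measurable]: "F \<in> borel_measurable N"
  shows "(\<integral>\<^sup>+\<omega>. F \<omega> \<partial>N) = (\<integral>\<^sup>+\<omega>. \<integral>\<^sup>+\<eta>. F (s \<omega> \<eta>) \<partial>P (X \<omega>) \<partial>N)"
proof -
  have decomp: "(\<integral>\<^sup>+\<omega>. G \<omega> \<partial>N) = (\<integral>\<^sup>+z. (\<integral>\<^sup>+\<omega>. G \<omega> \<partial>density N (indicator {\<omega>. X \<omega> = z})) \<partial>count_space UNIV)"
    if [measurable]: "G \<in> borel_measurable N" for G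
  proof -
    have "(\<integral>\<^sup>+\<omega>. G \<omega> \<partial>N) = (\<integral>\<^sup>+\<omega>. \<integral>\<^sup>+z. indicator {\<omega>. X \<omega> = z} \<omega> * G \<omega> \<partial>count_space UNIV \<partial>N)"
    proof (intro nn_integral_cong)
      fix \<omega>
      show "G \<omega> = (\<integral>\<^sup>+z. indicator {\<omega>. X \<omega> = z} \<omega> * G \<omega> \<partial>count_space UNIV)"
        by (subst nn_integral_count_space' [of "{X \<omega>}"]) auto
    qed
    also have "\<dots> = (\<integral>\<^sup>+z. \<integral>\<^sup>+\<omega>. indicator {\<omega>. X \<omega> = z} \<omega> * G \<omega> \<partial>N \<partial>count_space UNIV)"
      by (rule nn_integral_count_space_nn_integral) auto
    also have "\<dots> = (\<integral>\<^sup>+z. (\<integral>\<^sup>+\<omega>. G \<omega> \<partial>density N (indicator {\<omega>. X \<omega> = z})) \<partial>count_space UNIV)"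
      by (simp add: nn_integral_density)
    finally show ?thesis .
  qed
  have "(\<integral>\<^sup>+\<omega>. F \<omega> \<partial>density N (indicator {\<omega>. X \<omega> = z})) =
      (\<integral>\<^sup>+\<omega>. \<integral>\<^sup>+\<eta>. F (s \<omega> \<eta>) \<partial>P (X \<omega>) \<partial>density N (indicator {\<omega>. X \<omega> = z}))" for z
  proof -
    interpret Pz: prob_space "P z" by (rule P)
    have "(\<integral>\<^sup>+\<omega>. F \<omega> \<partial>density N (indicator {\<omega>. X \<omega> = z})) =
        (\<integral>\<^sup>+\<omega>. \<integral>\<^sup>+\<eta>. F (s \<omega> \<eta>) \<partial>P z \<partial>density N (indicator {\<omega>. X \<omega> = z}))"
      by (subst disint, subst nn_integral_distr)
         (auto simp: Pz.nn_integral_fst [symmetric] split_beta')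
    also have "\<dots> = (\<integral>\<^sup>+\<omega>. \<integral>\<^sup>+\<eta>. F (s \<omega> \<eta>) \<partial>P (X \<omega>) \<partial>density N (indicator {\<omega>. X \<omega> = z}))"
      by (subst (1 2) nn_integral_density) (auto intro!: nn_integral_cong split: split_indicator)
    finally show ?thesis .
  qed
  then show ?thesis by (simp add: decomp)
qed

lemma AE_integrable_disint:
  fixes F :: "'w \<Rightarrow> real"
  assumes F: "integrable N F"
  shows "AE \<omega> in N. integrable (P (X \<omega>)) (\<lambda>\<eta>. F (s \<omega> \<eta>))"
proof -
  have [measurable]: "F \<in> borel_measurable N" using F by simp
  have "(\<integral>\<^sup>+\<omega>. \<integral>\<^sup>+\<eta>. ennreal \<bar>F (s \<omega> \<eta>)\<bar> \<partial>P (X \<omega>) \<partial>N) < \<infinity>"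
    using F by (subst nn_integral_disint [of "\<lambda>\<omega>. ennreal \<bar>F \<omega>\<bar>", symmetric])
      (auto simp: integrable_iff_bounded)
  then have "AE \<omega> in N. (\<integral>\<^sup>+\<eta>. ennreal \<bar>F (s \<omega> \<eta>)\<bar> \<partial>P (X \<omega>)) \<noteq> \<infinity>"
    by (intro nn_integral_PInf_AE) auto
  then show ?thesis
    using AE_space
  proof eventually_elim
    case (elim \<omega>)
    have "(\<lambda>\<eta>. F (s \<omega> \<eta>)) \<in> borel_measurable V"
      using measurable_compose [OF measurable_Pair2 [OF s elim(2)], of F] by simp
    then have "(\<lambda>\<eta>. F (s \<omega> \<eta>)) \<in> borel_measurable (P (X \<omega>))" by simp
    then show ?case using elim(1) by (simp add: integrable_iff_bounded less_top)
  qed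
qed

text \<open>Reduces to the nonnegative version for the positive parts of F and -F. The inner Bochner
  integral is their difference only where the inner function is integrable, which holds almost
  surely; elsewhere its value is the default 0.\<close>

lemma
  fixes F :: "'w \<Rightarrow> real"
  assumes F: "integrable N F"
  shows integrable_disint: "integrable N (\<lambda>\<omega>. \<integral>\<eta>. F (s \<omega> \<eta>) \<partial>P (X \<omega>))"
    and integral_disint: "(\<integral>\<omega>. F \<omega> \<partial>N) = (\<integral>\<omega>. \<integral>\<eta>. F (s \<omega> \<eta>) \<partial>P (X \<omega>) \<partial>N)"
proof -
  have [measurable]: "F \<in> borel_measurable N" using F by simp
  define pos where "pos G \<omega> = (\<integral>\<^sup>+\<eta>. ennreal (G (s \<omega> \<eta>)) \<partial>P (X \<omega>))" for G :: "'w \<Rightarrow> real" and \<omega>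
  have fin: "(\<integral>\<^sup>+\<omega>. pos G \<omega> \<partial>N) < \<infinity>" "integrable N (\<lambda>\<omega>. enn2real (pos G \<omega>))"
    "(\<integral>\<omega>. enn2real (pos G \<omega>) \<partial>N) = enn2real (\<integral>\<^sup>+\<omega>. ennreal (G \<omega>) \<partial>N)"
    if G: "integrable N G" for G
  proof -
    have [measurable]: "G \<in> borel_measurable N" using G by simp
    have [measurable]: "pos G \<in> borel_measurable N" unfolding pos_def by measurable
    have eq: "(\<integral>\<^sup>+\<omega>. pos G \<omega> \<partial>N) = (\<integral>\<^sup>+\<omega>. ennreal (G \<omega>) \<partial>N)"
      unfolding pos_def by (rule nn_integral_disint [symmetric]) measurable
    have "(\<integral>\<^sup>+\<omega>. ennreal (G \<omega>) \<partial>N) \<le> (\<integral>\<^sup>+\<omega>. ennreal (norm (G \<omega>)) \<partial>N)"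
      by (intro nn_integral_mono ennreal_leI) auto
    also have "\<dots> < \<infinity>" using G by (simp add: integrable_iff_bounded)
    finally show fin: "(\<integral>\<^sup>+\<omega>. pos G \<omega> \<partial>N) < \<infinity>" using eq by simp
    then have "AE \<omega> in N. pos G \<omega> \<noteq> \<infinity>" by (intro nn_integral_PInf_AE) auto
    then have eq2: "(\<integral>\<^sup>+\<omega>. ennreal (enn2real (pos G \<omega>)) \<partial>N) = (\<integral>\<^sup>+\<omega>. pos G \<omega> \<partial>N)"
      by (intro nn_integral_cong_AE) (auto simp: less_top)
    show "integrable N (\<lambda>\<omega>. enn2real (pos G \<omega>))"
      using fin eq2 by (simp add: integrable_iff_bounded)
    show "(\<integral>\<omega>. enn2real (pos G \<omega>) \<partial>N) = enn2real (\<integral>\<^sup>+\<omega>. ennreal (G \<omega>) \<partial>N)"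
      using eq2 eq by (subst integral_eq_nn_integral) auto
  qed
  have F': "integrable N (\<lambda>\<omega>. - F \<omega>)" using F by simp
  have ae: "AE \<omega> in N. (\<integral>\<eta>. F (s \<omega> \<eta>) \<partial>P (X \<omega>)) = enn2real (pos F \<omega>) - enn2real (pos (\<lambda>\<omega>. - F \<omega>) \<omega>)"
    using AE_integrable_disint [OF F]
    by eventually_elim (simp add: pos_def real_lebesgue_integral_def)
  have [measurable]: "(\<lambda>\<omega>. \<integral>\<eta>. F (s \<omega> \<eta>) \<partial>P (X \<omega>)) \<in> borel_measurable N"
    by (rule measurable_kernel) measurable
  have int: "integrable N (\<lambda>\<omega>. enn2real (pos F \<omega>) - enn2real (pos (\<lambda>\<omega>. - F \<omega>) \<omega>))"
    using fin(2) [OF F] fin(2) [OF F'] by simp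
  then show "integrable N (\<lambda>\<omega>. \<integral>\<eta>. F (s \<omega> \<eta>) \<partial>P (X \<omega>))"
    by (rule integrable_cong_AE_imp) (use ae in \<open>auto elim: eventually_mono\<close>)
  have "(\<integral>\<omega>. \<integral>\<eta>. F (s \<omega> \<eta>) \<partial>P (X \<omega>) \<partial>N) = (\<integral>\<omega>. enn2real (pos F \<omega>) - enn2real (pos (\<lambda>\<omega>. - F \<omega>) \<omega>) \<partial>N)"
    by (rule integral_cong_AE [OF _ _ ae]) (use int in auto)
  also have "\<dots> = (\<integral>\<omega>. F \<omega> \<partial>N)"
    using fin(2,3) [OF F] fin(2,3) [OF F'] by (simp add: real_lebesgue_integral_def [OF F])
  finally show "(\<integral>\<omega>. F \<omega> \<partial>N) = (\<integral>\<omega>. \<integral>\<eta>. F (s \<omega> \<eta>) \<partial>P (X \<omega>) \<partial>N)" ..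
qed

end

subsection \<open>Chain laws on cylinders\<close>

lemma nn_integral_countable_image:
  fixes Y :: "'w \<Rightarrow> 'b::countable" and g :: "'b \<Rightarrow> ennreal"
  assumes [measurable]: "Y \<in> measurable N (count_space UNIV)"
  shows "(\<integral>\<^sup>+\<omega>. g (Y \<omega>) \<partial>N) = (\<integral>\<^sup>+y. emeasure N {\<omega> \<in> space N. Y \<omega> = y} * g y \<partial>count_space UNIV)"
proof -
  have "(\<integral>\<^sup>+\<omega>. g (Y \<omega>) \<partial>N) = (\<integral>\<^sup>+\<omega>. \<integral>\<^sup>+y. g y * indicator {\<omega> \<in> space N. Y \<omega> = y} \<omega> \<partial>count_space UNIV \<partial>N)"
  proof (rule nn_integral_cong)
    fix \<omega> assume "\<omega> \<in> space N"
    then show "g (Y \<omega>) = (\<integral>\<^sup>+y. g y * indicator {\<omega> \<in> space N. Y \<omega> = y} \<omega> \<partial>count_space UNIV)"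
      by (subst nn_integral_count_space' [of "{Y \<omega>}"]) auto
  qed
  also have "\<dots> = (\<integral>\<^sup>+y. \<integral>\<^sup>+\<omega>. g y * indicator {\<omega> \<in> space N. Y \<omega> = y} \<omega> \<partial>N \<partial>count_space UNIV)"
    by (rule nn_integral_count_space_nn_integral) auto
  also have "\<dots> = (\<integral>\<^sup>+y. emeasure N {\<omega> \<in> space N. Y \<omega> = y} * g y \<partial>count_space UNIV)"
    by (intro nn_integral_cong) (subst nn_integral_cmult_indicator; simp add: mult.commute)
  finally show ?thesis .
qed

text \<open>Passes from the lists in the definition of a chain law to paths restricted to an initial
  segment, the form in which cylinders are manipulated from here on.\<close>

lemma chain_law_from_cylinder:
  assumes "chain_law_from K s N"
  shows "measure N (cylinder {..m} x) = (if x 0 = s then 1 else 0) * (\<Prod>i<m. K (x i) (x (Suc i)))"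
proof -
  have sp: "space N = UNIV"
    using assms by (auto simp: chain_law_from_def sets_path_space_imp_space)
  define xs where "xs = map x [0..<Suc m]"
  have nth: "xs ! i = x i" if "i \<le> m" for i
    using that unfolding xs_def by (subst nth_map) (auto simp del: upt_Suc)
  have "length xs = Suc m" by (simp add: xs_def)
  then have "measure N {\<omega> \<in> space N. \<forall>i\<le>m. \<omega> i = xs ! i}
      = (if xs ! 0 = s then 1 else 0) * (\<Prod>i<m. K (xs ! i) (xs ! Suc i))"
    using assms unfolding chain_law_from_def by blast
  moreover have "{\<omega> \<in> space N. \<forall>i\<le>m. \<omega> i = xs ! i} = cylinder {..m} x"
    using nth by (auto simp: cylinder_def sp)
  moreover have "(\<Prod>i<m. K (xs ! i) (xs ! Suc i)) = (\<Prod>i<m. K (x i) (x (Suc i)))"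
    using nth by (intro prod.cong) auto
  ultimately show ?thesis using nth [of 0] by simp
qed

lemma stationary_chain_law_cylinder:
  assumes "stationary_chain_law K nu M"
  shows "measure M (cylinder {a..a + int m} x) =
    nu (x a) * (\<Prod>i<m. K (x (a + int i)) (x (a + int (Suc i))))"
proof -
  have sp: "space M = UNIV"
    using assms by (auto simp: stationary_chain_law_def sets_path_space_imp_space)
  define xs where "xs = map (\<lambda>i. x (a + int i)) [0..<Suc m]"
  have nth: "xs ! i = x (a + int i)" if "i \<le> m" for i
    using that unfolding xs_def by (subst nth_map) (auto simp del: upt_Suc)
  have "length xs = Suc m" by (simp add: xs_def)
  then have "measure M {\<omega> \<in> space M. \<forall>i\<le>m. \<omega> (a + int i) = xs ! i}
      = nu (xs ! 0) * (\<Prod>i<m. K (xs ! i) (xs ! Suc i))"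
    using assms unfolding stationary_chain_law_def by blast
  moreover have "{\<omega> \<in> space M. \<forall>i\<le>m. \<omega> (a + int i) = xs ! i} = cylinder {a..a + int m} x"
  proof -
    have "(\<forall>i\<le>m. \<omega> (a + int i) = x (a + int i)) \<longleftrightarrow> (\<forall>k\<in>{a..a + int m}. \<omega> k = x k)" for \<omega>
    proof
      assume *: "\<forall>i\<le>m. \<omega> (a + int i) = x (a + int i)"
      show "\<forall>k\<in>{a..a + int m}. \<omega> k = x k"
      proof
        fix k assume "k \<in> {a..a + int m}"
        then show "\<omega> k = x k" using * [rule_format, of "nat (k - a)"] by auto
      qed
    qed auto
    then show ?thesis using nth by (auto simp: cylinder_def sp)
  qed
  moreover have "(\<Prod>i<m. K (xs ! i) (xs ! Suc i)) = (\<Prod>i<m. K (x (a + int i)) (x (a + int (Suc i))))"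
    using nth by (intro prod.cong) auto
  ultimately show ?thesis using nth [of 0] by simp
qed

lemma chain_law_fromI_cylinder:
  assumes "prob_space N" "sets N = sets path_space"
    and "\<And>m x. measure N (cylinder {..m} x) = (if x 0 = s then 1 else 0) * (\<Prod>i<m. K (x i) (x (Suc i)))"
  shows "chain_law_from K s N"
  unfolding chain_law_from_def
proof (intro conjI allI impI)
  fix m :: nat and xs :: "'a list"
  have "{\<omega> \<in> space N. \<forall>i\<le>m. \<omega> i = xs ! i} = cylinder {..m} (\<lambda>i. xs ! i)"
    using assms(2) by (auto simp: cylinder_def sets_path_space_imp_space)
  then show "measure N {\<omega> \<in> space N. \<forall>i\<le>m. \<omega> i = xs ! i} =
      (if xs ! 0 = s then 1 else 0) * (\<Prod>i<m. K (xs ! i) (xs ! Suc i))"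
    using assms(3) [of m "\<lambda>i. xs ! i"] by simp
qed (use assms in auto)

lemma chain_law_from_unique:
  fixes K :: "'a::countable \<Rightarrow> 'a \<Rightarrow> real"
  assumes "chain_law_from K s A" "chain_law_from K s B"
  shows "A = B"
proof (rule path_space_measure_eqI [where J = "\<lambda>n. {..n}"])
  interpret A: prob_space A using assms(1) by (simp add: chain_law_from_def)
  interpret B: prob_space B using assms(2) by (simp add: chain_law_from_def)
  show "finite_measure A" by (rule A.finite_measure_axioms)
  show "emeasure A (cylinder {..n} x) = emeasure B (cylinder {..n} x)" for n x
    using chain_law_from_cylinder [OF assms(1)] chain_law_from_cylinder [OF assms(2)]
    by (simp add: A.emeasure_eq_measure B.emeasure_eq_measure)
qed (use assms in \<open>auto simp: chain_law_from_def incseq_def\<close>)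

lemma AE_chain_law_from_start:
  fixes K :: "'a::countable \<Rightarrow> 'a \<Rightarrow> real"
  assumes "chain_law_from K s N"
  shows "AE \<omega> in N. \<omega> 0 = s"
proof -
  interpret prob_space N using assms by (simp add: chain_law_from_def)
  have [measurable_cong]: "sets N = sets path_space" using assms by (simp add: chain_law_from_def)
  have "prob (cylinder {..0} (\<lambda>_. s)) = 1"
    using chain_law_from_cylinder [OF assms, of 0 "\<lambda>_. s"] by simp
  then have "AE \<omega> in N. \<omega> \<in> cylinder {..0} (\<lambda>_. s)"
    by (subst (asm) prob_eq_1) auto
  then show ?thesis by eventually_elim (simp add: cylinder_def)
qed

lemma nn_integral_chain_first_step:
  fixes K :: "'a::countable \<Rightarrow> 'a \<Rightarrow> real"
  assumes "chain_law_from K s N"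
  shows "(\<integral>\<^sup>+\<omega>. g (\<omega> 1) \<partial>N) = (\<integral>\<^sup>+t. ennreal (K s t) * g t \<partial>count_space UNIV)"
proof -
  interpret prob_space N using assms by (simp add: chain_law_from_def)
  have sets_N [measurable_cong]: "sets N = sets path_space" using assms by (simp add: chain_law_from_def)
  have "emeasure N {\<omega> \<in> space N. \<omega> 1 = t} = ennreal (K s t)" for t
  proof -
    have "emeasure N {\<omega> \<in> space N. \<omega> 1 = t} = emeasure N (cylinder {..1} (\<lambda>i. if i = 0 then s else t))"
    proof (rule emeasure_eq_AE)
      show "AE \<omega> in N. (\<omega> \<in> {\<omega> \<in> space N. \<omega> 1 = t}) = (\<omega> \<in> cylinder {..1} (\<lambda>i. if i = 0 then s else t))"
        using AE_chain_law_from_start [OF assms] AE_space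
        by eventually_elim (auto simp: cylinder_def le_Suc_eq)
    qed auto
    also have "\<dots> = ennreal (K s t)"
      using chain_law_from_cylinder [OF assms, of 1 "\<lambda>i. if i = 0 then s else t"]
      by (simp add: emeasure_eq_measure)
    finally show ?thesis .
  qed
  then show ?thesis by (subst nn_integral_countable_image) simp_all
qed

text \<open>The right-hand side does not contain \<open>i\<close>: functions of two consecutive
  states are identically distributed in time. This is also how the double sum over x and y in the
  constant becomes an expectation.\<close>

lemma nn_integral_stationary_pair:
  fixes K :: "'a::countable \<Rightarrow> 'a \<Rightarrow> real"
  assumes "stationary_chain_law K nu M"
  shows "(\<integral>\<^sup>+\<omega>. g (\<omega> (i - 1)) (\<omega> i) \<partial>M) =
    (\<integral>\<^sup>+(x, y). ennreal (nu x * K x y) * g x y \<partial>count_space UNIV)"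
proof -
  interpret prob_space M using assms by (simp add: stationary_chain_law_def)
  have sets_M [measurable_cong]: "sets M = sets path_space"
    using assms by (simp add: stationary_chain_law_def)
  have "{\<omega> \<in> space M. (\<omega> (i - 1), \<omega> i) = (x, y)} = cylinder {i - 1..i - 1 + int 1} (\<lambda>k. if k = i then y else x)" for x y
  proof -
    have "{i - 1..i - 1 + int 1} = {i - 1, i}" by auto
    then show ?thesis using sets_path_space_imp_space [OF sets_M] by (auto simp: cylinder_def)
  qed
  then have "emeasure M {\<omega> \<in> space M. (\<omega> (i - 1), \<omega> i) = (x, y)} = ennreal (nu x * K x y)" for x y
    using stationary_chain_law_cylinder [OF assms, of "i - 1" 1 "\<lambda>k. if k = i then y else x"]
    by (simp only: emeasure_eq_measure) simp
  then have "emeasure M {\<omega> \<in> space M. (\<omega> (i - 1), \<omega> i) = xy} = ennreal (nu (fst xy) * K (fst xy) (snd xy))" for xy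
    by (cases xy) (simp only: fst_conv snd_conv)
  then show ?thesis
    using nn_integral_countable_image [of "\<lambda>\<omega>. (\<omega> (i - 1), \<omega> i)" M "case_prod g"]
    by (simp only: split_beta' fst_conv snd_conv) simp
qed

subsection \<open>Markov properties\<close>

lemma prod_lessThan_add: "(\<Prod>j<m + n. f j) = (\<Prod>j<m. f j) * (\<Prod>j<n. f (m + j))"
  for f :: "nat \<Rightarrow> 'a::comm_monoid_mult"
  by (induction n) (simp_all add: mult.assoc)

text \<open>Two finite measures on the path space are compared on cylinders only. There it suffices
  that the preimage of a cylinder under \<open>s\<close> is a rectangle and that its weight factors,
  given the state at time \<open>i\<close>.\<close>

lemma disintegration_pathI:
  fixes N :: "('i::countable \<Rightarrow> 'a::countable) measure" and P :: "'a \<Rightarrow> ('j \<Rightarrow> 'a) measure"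
    and J :: "nat \<Rightarrow> 'i set"
  assumes J: "incseq J" "(\<Union>n. J n) = UNIV" "\<And>n. finite (J n)"
    and "prob_space N" and sets_N [measurable_cong]: "sets N = sets path_space"
    and P: "\<And>z. prob_space (P z)" and sets_P [measurable_cong]: "\<And>z. sets (P z) = sets path_space"
    and s [measurable]: "case_prod s \<in> measurable (path_space \<Otimes>\<^sub>M path_space) path_space"
    and A [measurable]: "\<And>n x. A n x \<in> sets path_space"
    and B [measurable]: "\<And>n x. B n x \<in> sets path_space"
    and rect: "\<And>n x \<omega> \<eta>. s \<omega> \<eta> \<in> cylinder (J n) x \<longleftrightarrow> \<omega> \<in> A n x \<and> \<eta> \<in> B n x"
    and factor: "\<And>n x z. measure N (cylinder (J n) x \<inter> {\<omega>. \<omega> i = z}) =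
      measure N (A n x \<inter> {\<omega>. \<omega> i = z}) * measure (P z) (B n x)"
  shows "disintegration N (\<lambda>\<omega>. \<omega> i) P s path_space"
proof (intro disintegration.intro disintegration_axioms.intro P sets_P)
  interpret N: prob_space N by fact
  show "prob_space N" by fact
  show "(\<lambda>\<omega>. \<omega> i) \<in> measurable N (count_space UNIV)" by measurable
  show "case_prod s \<in> measurable (N \<Otimes>\<^sub>M path_space) N" by measurable
  fix z
  interpret Pz: prob_space "P z" by (rule P)
  define D where "D = density N (indicator {\<omega>. \<omega> i = z})"
  have [measurable_cong]: "sets D = sets path_space" by (simp add: D_def sets_N)
  have [measurable]: "{\<omega>. \<omega> i = z} \<in> sets path_space"
  proof -
    have "Measurable.pred path_space (\<lambda>\<omega>. \<omega> i = z)" by measurable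
    then show ?thesis by (simp add: pred_def)
  qed
  have D: "emeasure D S = ennreal (measure N (S \<inter> {\<omega>. \<omega> i = z}))" if [measurable]: "S \<in> sets path_space" for S
    unfolding D_def
    by (subst emeasure_density)
       (auto simp: N.emeasure_eq_measure [symmetric] nn_integral_indicator [symmetric]
          indicator_inter_arith mult.commute simp del: nn_integral_indicator)
  have space: "space D = UNIV" "space (P z) = UNIV"
    by (simp_all add: sets_path_space_imp_space \<open>sets D = sets path_space\<close> sets_P)
  show "density N (indicator {\<omega>. \<omega> i = z}) = distr (density N (indicator {\<omega>. \<omega> i = z}) \<Otimes>\<^sub>M P z) N (case_prod s)"
    unfolding D_def [symmetric]
  proof (rule path_space_measure_eqI [OF J])
    show "finite_measure D"
      by (rule finite_measureI) (use D [of UNIV] space in \<open>simp add: sets.top [of path_space, simplified]\<close>)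
    fix n x
    have "emeasure (distr (D \<Otimes>\<^sub>M P z) N (case_prod s)) (cylinder (J n) x) = emeasure (D \<Otimes>\<^sub>M P z) (A n x \<times> B n x)"
      by (subst emeasure_distr)
         (auto simp: rect space space_pair_measure intro!: arg_cong [where f = "emeasure (D \<Otimes>\<^sub>M P z)"])
    also have "\<dots> = emeasure D (A n x) * emeasure (P z) (B n x)"
      by (rule Pz.emeasure_pair_measure_Times) measurable
    also have "\<dots> = emeasure D (cylinder (J n) x)"
      by (simp add: D factor Pz.emeasure_eq_measure ennreal_mult)
    finally show "emeasure D (cylinder (J n) x) = emeasure (distr (D \<Otimes>\<^sub>M P z) N (case_prod s)) (cylinder (J n) x)" ..
  qed (auto simp: sets_N \<open>sets D = sets path_space\<close>)
qed

section \<open>Splicing of paths and the Markov property\<close>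

text \<open>Time 0 of the second path becomes time 1. Of the first path only the initial state is
  kept; its state at time 1 enters through the law from which the second path is drawn.\<close>

definition prepend :: "(nat \<Rightarrow> 'a) \<Rightarrow> (nat \<Rightarrow> 'a) \<Rightarrow> nat \<Rightarrow> 'a" where
  "prepend \<omega> \<eta> k = (if k = 0 then \<omega> 0 else \<eta> (k - 1))"

text \<open>The second path takes over at time \<open>i\<close> inclusive. Under
  \<open>P (\<omega> i)\<close> this rewrites the state at time \<open>i\<close> by itself almost
  surely, but it also permits a restart from any other state, as the comparison of increments
  requires.\<close>

definition graft :: "int \<Rightarrow> (int \<Rightarrow> 'a) \<Rightarrow> (nat \<Rightarrow> 'a) \<Rightarrow> int \<Rightarrow> 'a" where
  "graft i \<omega> \<eta> k = (if k < i then \<omega> k else \<eta> (nat (k - i)))"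

lemma measurable_prepend [measurable]:
  "case_prod prepend \<in> measurable (path_space \<Otimes>\<^sub>M path_space) path_space"
  by (rule measurable_path_spaceI) (simp add: prepend_def split_beta')

lemma measurable_graft [measurable]:
  "case_prod (graft i) \<in> measurable (path_space \<Otimes>\<^sub>M path_space) path_space"
  by (rule measurable_path_spaceI) (simp add: graft_def split_beta')

text \<open>The Markov property at time 1: in the weight of a cylinder the first transition stays
  with the old path, and the remaining ones form the weight of a shifted cylinder under the chain
  from the state at time 1.\<close>

lemma chain_family_disintegration:
  fixes K :: "'a::countable \<Rightarrow> 'a \<Rightarrow> real"
  assumes law: "\<And>s. chain_law_from K s (P s)"
  shows "disintegration (P s) (\<lambda>\<omega>. \<omega> 1) P prepend path_space"
\<comment> \<open>The smallest index set is already {0, 1}, so the conditioning time 1 belongs to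
  every cylinder.\<close>
proof (rule disintegration_pathI [where J = "\<lambda>n. {..Suc n}" and A = "\<lambda>n x. cylinder {0} x"
      and B = "\<lambda>n x. cylinder {..n} (\<lambda>k. x (Suc k))"])
  show "(prepend \<omega> \<eta> \<in> cylinder {..Suc n} x) = (\<omega> \<in> cylinder {0} x \<and> \<eta> \<in> cylinder {..n} (\<lambda>k. x (Suc k)))"
    for \<omega> \<eta> :: "nat \<Rightarrow> 'a" and n x
  proof -
    have "(\<forall>k\<le>Suc n. R k) \<longleftrightarrow> R 0 \<and> (\<forall>k\<le>n. R (Suc k))" for R
      by (metis le0 not0_implies_Suc Suc_le_mono)
    then show ?thesis by (simp add: cylinder_def prepend_def Ball_def)
  qed
  show "measure (P s) (cylinder {..Suc n} x \<inter> {\<omega>. \<omega> 1 = z}) =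
      measure (P s) (cylinder {0} x \<inter> {\<omega>. \<omega> 1 = z}) * measure (P z) (cylinder {..n} (\<lambda>k. x (Suc k)))"
    for n x z
  proof (cases "x 1 = z")
    case True
    have "cylinder {..Suc n} x \<inter> {\<omega>. \<omega> 1 = z} = cylinder {..Suc n} x"
      "cylinder {0} x \<inter> {\<omega>. \<omega> 1 = z} = cylinder {..1} x"
      using True by (auto simp: cylinder_def le_Suc_eq)
    then show ?thesis
      using True chain_law_from_cylinder [OF law, of s _ x] chain_law_from_cylinder [OF law, of z n "\<lambda>k. x (Suc k)"]
      by (simp add: prod.lessThan_Suc_shift del: prod.lessThan_Suc)
  \<comment> \<open>Both sides vanish: the cylinder contradicts the conditioning, and on the right
    \<open>P z\<close> starts from \<open>z\<close> almost surely.\<close>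
  next
    case False
    then have "cylinder {..Suc n} x \<inter> {\<omega>. \<omega> 1 = z} = {}"
      by (auto simp: cylinder_def)
    then show ?thesis
      using False chain_law_from_cylinder [OF law, of z n "\<lambda>k. x (Suc k)"] by simp
  qed
  show "(\<Union>n. {..Suc n}) = UNIV" by auto
qed (use law in \<open>auto simp: chain_law_from_def incseq_def\<close>)

text \<open>The Markov property at time \<open>i\<close> of the two-sided chain. The windows are
  symmetric about \<open>i\<close>; the product of transitions is cut at \<open>i\<close>, and the
  right half is the weight of a cylinder under the chain from the state at time
  \<open>i\<close>.\<close>

lemma stationary_chain_disintegration:
  fixes K :: "'a::countable \<Rightarrow> 'a \<Rightarrow> real"
  assumes M: "stationary_chain_law K nu M" and law: "\<And>s. chain_law_from K s (P s)"
  shows "disintegration M (\<lambda>\<omega>. \<omega> i) P (graft i) path_space"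
proof (rule disintegration_pathI [where J = "\<lambda>n. {i - int n..i + int n}"
      and A = "\<lambda>n x. cylinder {i - int n..<i} x" and B = "\<lambda>n x. cylinder {..n} (\<lambda>k. x (i + int k))"])
  show "(graft i \<omega> \<eta> \<in> cylinder {i - int n..i + int n} x) =
      (\<omega> \<in> cylinder {i - int n..<i} x \<and> \<eta> \<in> cylinder {..n} (\<lambda>k. x (i + int k)))"
    for \<omega> :: "int \<Rightarrow> 'a" and \<eta> n x
  proof (intro iffI conjI)
    assume *: "graft i \<omega> \<eta> \<in> cylinder {i - int n..i + int n} x"
    show "\<omega> \<in> cylinder {i - int n..<i} x"
    proof -
      have "\<omega> k = x k" if "k \<in> {i - int n..<i}" for k
        using * that by (auto simp: cylinder_def graft_def dest!: bspec [of _ _ k])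
      then show ?thesis by (simp add: cylinder_def)
    qed
    have "graft i \<omega> \<eta> (i + int k) = x (i + int k)" if "k \<le> n" for k
      using * that by (auto simp: cylinder_def)
    then show "\<eta> \<in> cylinder {..n} (\<lambda>k. x (i + int k))"
      by (auto simp: cylinder_def graft_def)
  next
    assume *: "\<omega> \<in> cylinder {i - int n..<i} x \<and> \<eta> \<in> cylinder {..n} (\<lambda>k. x (i + int k))"
    have "graft i \<omega> \<eta> k = x k" if "k \<in> {i - int n..i + int n}" for k
    proof (cases "k < i")
      case False
      then have "\<eta> (nat (k - i)) = x (i + int (nat (k - i)))"
        using * that by (auto simp: cylinder_def)
      then show ?thesis using False by (simp add: graft_def)
    qed (use * that in \<open>auto simp: cylinder_def graft_def\<close>)
    then show "graft i \<omega> \<eta> \<in> cylinder {i - int n..i + int n} x" by (simp add: cylinder_def)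
  qed
  show "measure M (cylinder {i - int n..i + int n} x \<inter> {\<omega>. \<omega> i = z}) =
      measure M (cylinder {i - int n..<i} x \<inter> {\<omega>. \<omega> i = z}) * measure (P z) (cylinder {..n} (\<lambda>k. x (i + int k)))"
    for n x z
  proof (cases "x i = z")
    case True
    let ?K = "\<lambda>j. K (x (i - int n + int j)) (x (i - int n + int (Suc j)))"
    have "cylinder {i - int n..i + int n} x \<inter> {\<omega>. \<omega> i = z} = cylinder {i - int n..i - int n + int (n + n)} x"
      "cylinder {i - int n..<i} x \<inter> {\<omega>. \<omega> i = z} = cylinder {i - int n..i - int n + int n} x"
    proof -
      have iv: "{i - int n..i - int n + int (n + n)} = {i - int n..i + int n}"
        "{i - int n..i - int n + int n} = insert i {i - int n..<i}" by auto
      have "\<omega> i = z" if "\<omega> \<in> cylinder {i - int n..i + int n} x" for \<omega>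
        using that True by (simp add: cylinder_def)
      then show "cylinder {i - int n..i + int n} x \<inter> {\<omega>. \<omega> i = z} = cylinder {i - int n..i - int n + int (n + n)} x"
        unfolding iv by blast
      show "cylinder {i - int n..<i} x \<inter> {\<omega>. \<omega> i = z} = cylinder {i - int n..i - int n + int n} x"
        unfolding iv using True by (auto simp: cylinder_def)
    qed
    moreover have "(\<Prod>j<n + n. ?K j) = (\<Prod>j<n. ?K j) * (\<Prod>j<n. ?K (n + j))"
      by (rule prod_lessThan_add)
    moreover have "?K (n + j) = K (x (i + int j)) (x (i + int (Suc j)))" for j
      by (simp add: algebra_simps)
    ultimately show ?thesis
      using True chain_law_from_cylinder [OF law, of z n "\<lambda>k. x (i + int k)"]
        stationary_chain_law_cylinder [OF M, of "i - int n" "n + n" x]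
        stationary_chain_law_cylinder [OF M, of "i - int n" n x]
      by (simp del: of_nat_Suc of_nat_add)
  next
    case False
    then have "cylinder {i - int n..i + int n} x \<inter> {\<omega>. \<omega> i = z} = {}"
      by (auto simp: cylinder_def)
    then show ?thesis
      using False chain_law_from_cylinder [OF law, of z n "\<lambda>k. x (i + int k)"] by simp
  qed
  show "(\<Union>n. {i - int n..i + int n}) = UNIV"
  proof (intro equalityI subsetI)
    fix k :: int
    have "k \<in> {i - int (nat \<bar>k - i\<bar>)..i + int (nat \<bar>k - i\<bar>)}" by auto
    then show "k \<in> (\<Union>n. {i - int n..i + int n})" by blast
  qed auto
qed (use law M in \<open>auto simp: chain_law_from_def stationary_chain_law_def incseq_def\<close>)

text \<open>The lumping criterion: the probability of moving into a fibre of \<open>\<phi>\<close>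
  depends on the present state only through its image. Induction on the length of the cylinder, for
  all starting states at once, splits off the first step by the Markov property and applies the
  induction hypothesis from the state reached.\<close>

lemma chain_law_from_lumped:
  fixes Q :: "'s::countable \<Rightarrow> 's \<Rightarrow> real" and K :: "'a::countable \<Rightarrow> 'a \<Rightarrow> real"
  assumes law: "\<And>s. chain_law_from Q s (N s)"
    and nonneg: "\<And>x y. K x y \<ge> 0"
    and lump: "\<And>s a. (\<integral>\<^sup>+t. ennreal (Q s t) * indicator {t. \<phi> t = a} t \<partial>count_space UNIV) = ennreal (K (\<phi> s) a)"
  shows "chain_law_from K (\<phi> s) (distr (N s) path_space (\<lambda>\<omega> k. \<phi> (\<omega> k)))"
proof -
  have prob: "prob_space (N s)" and sets_N [measurable_cong]: "sets (N s) = sets path_space" for s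
    using law [of s] by (simp_all add: chain_law_from_def)
  note meas [measurable] = measurable_map_path [of \<phi>]
  have vimage: "(\<lambda>\<omega> k. \<phi> (\<omega> k)) -` cylinder {..m} x \<in> sets path_space" for m :: nat and x
    using measurable_sets [OF meas cylinder_sets] by simp
  have main: "emeasure (N s) ((\<lambda>\<omega> k. \<phi> (\<omega> k)) -` cylinder {..m} x) =
      ennreal ((if x 0 = \<phi> s then 1 else 0) * (\<Prod>i<m. K (x i) (x (Suc i))))" for m s x
  proof (induction m arbitrary: s x)
    case 0
    interpret prob_space "N s" by (rule prob)
    show ?case
    proof (cases "x 0 = \<phi> s")
      case True
      have "emeasure (N s) ((\<lambda>\<omega> k. \<phi> (\<omega> k)) -` cylinder {..0} x) = 1"
      proof (rule emeasure_eq_1_AE)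
        show "AE \<omega> in N s. \<omega> \<in> (\<lambda>\<omega> k. \<phi> (\<omega> k)) -` cylinder {..0} x"
          using AE_chain_law_from_start [OF law] by eventually_elim (simp add: True cylinder_def)
      qed (use vimage [of 0 x] in \<open>simp add: sets_N\<close>)
      then show ?thesis using True by simp
    next
      case False
      have "emeasure (N s) ((\<lambda>\<omega> k. \<phi> (\<omega> k)) -` cylinder {..0} x) = emeasure (N s) {}"
      proof (rule emeasure_eq_AE)
        show "AE \<omega> in N s. (\<omega> \<in> (\<lambda>\<omega> k. \<phi> (\<omega> k)) -` cylinder {..0} x) = (\<omega> \<in> {})"
          using AE_chain_law_from_start [OF law] by eventually_elim (use False in \<open>auto simp: cylinder_def\<close>)
      qed (use vimage [of 0 x] in \<open>simp_all add: sets_N\<close>)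
      then show ?thesis using False by simp
    qed
  next
    case (Suc m)
    interpret disintegration "N s" "\<lambda>\<omega>. \<omega> 1" N prepend path_space
      by (rule chain_family_disintegration [OF law])
    define S where "S = (\<lambda>\<omega> k. \<phi> (\<omega> k)) -` cylinder {..Suc m} x"
    define c where "c = (\<Prod>i<m. K (x (Suc i)) (x (Suc (Suc i))))"
    have c: "c \<ge> 0" unfolding c_def using nonneg by (simp add: prod_nonneg)
    have S [measurable]: "S \<in> sets path_space" unfolding S_def by (rule vimage)
    have mem: "prepend \<omega> \<eta> \<in> S \<longleftrightarrow> \<phi> (\<omega> 0) = x 0 \<and> \<eta> \<in> (\<lambda>\<omega> k. \<phi> (\<omega> k)) -` cylinder {..m} (\<lambda>k. x (Suc k))" for \<omega> \<eta>
    proof -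
      have "(\<forall>k\<le>Suc m. R k) \<longleftrightarrow> R 0 \<and> (\<forall>k\<le>m. R (Suc k))" for R
        by (metis le0 not0_implies_Suc Suc_le_mono)
      then show ?thesis by (simp add: S_def cylinder_def prepend_def Ball_def)
    qed
    have inner: "(\<integral>\<^sup>+\<eta>. indicator S (prepend \<omega> \<eta>) \<partial>N t) =
        indicator {x 0} (\<phi> (\<omega> 0)) * ennreal ((if x 1 = \<phi> t then 1 else 0) * c)" for \<omega> t
    proof -
      have "(\<integral>\<^sup>+\<eta>. indicator S (prepend \<omega> \<eta>) \<partial>N t) =
          (\<integral>\<^sup>+\<eta>. indicator {x 0} (\<phi> (\<omega> 0)) * indicator ((\<lambda>\<omega> k. \<phi> (\<omega> k)) -` cylinder {..m} (\<lambda>k. x (Suc k))) \<eta> \<partial>N t)"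
        by (intro nn_integral_cong) (auto simp: mem split: split_indicator)
      also have "\<dots> = indicator {x 0} (\<phi> (\<omega> 0)) * emeasure (N t) ((\<lambda>\<omega> k. \<phi> (\<omega> k)) -` cylinder {..m} (\<lambda>k. x (Suc k)))"
        using vimage by (intro nn_integral_cmult_indicator) (simp add: sets_N)
      finally show ?thesis by (simp add: Suc.IH c_def)
    qed
    have "emeasure (N s) S = (\<integral>\<^sup>+\<omega>. indicator S \<omega> \<partial>N s)" by simp
    also have "\<dots> = (\<integral>\<^sup>+\<omega>. indicator {x 0} (\<phi> (\<omega> 0)) * ennreal ((if x 1 = \<phi> (\<omega> 1) then 1 else 0) * c) \<partial>N s)"
      by (subst nn_integral_disint) (simp_all add: inner)
    also have "\<dots> = (\<integral>\<^sup>+\<omega>. (indicator {x 0} (\<phi> s) * ennreal c) * indicator {t. \<phi> t = x 1} (\<omega> 1) \<partial>N s)"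
    proof (rule nn_integral_cong_AE)
      show "AE \<omega> in N s. indicator {x 0} (\<phi> (\<omega> 0)) * ennreal ((if x 1 = \<phi> (\<omega> 1) then 1 else 0) * c) =
          (indicator {x 0} (\<phi> s) * ennreal c) * indicator {t. \<phi> t = x 1} (\<omega> 1)"
        using AE_chain_law_from_start [OF law] by eventually_elim (auto split: split_indicator)
    qed
    also have "\<dots> = (indicator {x 0} (\<phi> s) * ennreal c) * ennreal (K (\<phi> s) (x 1))"
      by (subst nn_integral_cmult) (simp_all add: nn_integral_chain_first_step [OF law, unfolded One_nat_def] lump)
    also have "\<dots> = ennreal ((if x 0 = \<phi> s then 1 else 0) * (\<Prod>i<Suc m. K (x i) (x (Suc i))))"
      using c nonneg by (auto simp: prod.lessThan_Suc_shift c_def ennreal_mult [symmetric] mult.commute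
          simp del: prod.lessThan_Suc)
    finally show ?case by (simp add: S_def)
  qed
  show ?thesis
  proof (rule chain_law_fromI_cylinder)
    interpret prob_space "N s" by (rule prob)
    interpret D: prob_space "distr (N s) path_space (\<lambda>\<omega> k. \<phi> (\<omega> k))"
      by (rule prob_space_distr) measurable
    show "prob_space (distr (N s) path_space (\<lambda>\<omega> k. \<phi> (\<omega> k)))" by (rule D.prob_space_axioms)
    fix m x
    have "0 \<le> (\<Prod>i<m. K (x i) (x (Suc i)))" using nonneg by (simp add: prod_nonneg)
    then show "measure (distr (N s) path_space (\<lambda>\<omega> k. \<phi> (\<omega> k))) (cylinder {..m} x) =
        (if x 0 = \<phi> s then 1 else 0) * (\<Prod>i<m. K (x i) (x (Suc i)))"
      using main [of s m x] sets_path_space_imp_space [OF sets_N]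
      by (subst measure_distr) (auto simp: measure_def)
  qed simp
qed

subsection \<open>Oscillations and the coupling time\<close>

lemma delta_nonneg: "lip M f \<Longrightarrow> delta f i \<ge> 0"
  unfolding delta_def lip_def by (intro cSup_upper) (auto simp: bdd_above_insert)

lemma diff_le_delta:
  assumes f: "lip M f" and eq: "\<And>j. j \<noteq> i \<Longrightarrow> x j = y j"
  shows "\<bar>f x - f y\<bar> \<le> delta f i"
proof (cases "x i = y i")
  case True
  then have "x = y" using eq by (metis ext)
  then show ?thesis using delta_nonneg [OF f] by simp
next
  case False
  have "f u - f v \<in> osc_set f i" if "\<And>j. j \<noteq> i \<Longrightarrow> u j = v j" "u i \<noteq> v i" for u v
    unfolding osc_set_def mem_Collect_eq
    by (rule exI [of _ u], rule exI [of _ v]) (use that in \<open>simp add: dmetric_def\<close>)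
  then have "f x - f y \<in> osc_set f i" "f y - f x \<in> osc_set f i"
    using False eq by metis+
  moreover have "bdd_above ({0} \<union> osc_set f i)"
    using f by (simp add: lip_def)
  ultimately have "f x - f y \<le> delta f i" "f y - f x \<le> delta f i"
    unfolding delta_def by (auto intro: cSup_upper)
  then show ?thesis by linarith
qed

lemma diff_le_sum_delta:
  assumes f: "lip M f" and "finite J" and "\<And>j. j \<notin> J \<Longrightarrow> x j = y j"
  shows "\<bar>f x - f y\<bar> \<le> (\<Sum>j\<in>J. delta f j)"
  using assms(2,3)
proof (induction J arbitrary: x)
  case empty
  then have "x = y" by (metis empty_iff ext)
  then show ?case by simp
next
  case (insert i J)
  define x' where "x' = x(i := y i)"
  have "\<bar>f x - f x'\<bar> \<le> delta f i"
    by (rule diff_le_delta [OF f]) (simp add: x'_def)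
  moreover have "\<bar>f x' - f y\<bar> \<le> (\<Sum>j\<in>J. delta f j)"
    using insert.prems by (intro insert.IH) (auto simp: x'_def)
  ultimately show ?case using insert.hyps by simp
qed

text \<open>A finite infimum comes from a nonempty set, and in \<open>enat\<close> it is attained by
  well-ordering; the defining condition then covers all later times.\<close>

lemma coupling_time_enat:
  assumes "coupling_time W = enat k" "j \<ge> k"
  shows "fst (W j) = snd (W j)"
proof -
  let ?S = "{enat k | k. \<forall>j\<ge>k. fst (W j) = snd (W j)}"
  have "?S \<noteq> {}"
    using assms(1) unfolding coupling_time_def by (metis Inf_empty enat.distinct(1) top_enat_def)
  then have "Inf ?S \<in> ?S"
    unfolding Inf_enat_def by (metis (mono_tags, lifting) LeastI ex_in_conv)
  then show ?thesis using assms unfolding coupling_time_def by auto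
qed

lemma coupling_time_le_iff:
  "coupling_time W \<le> enat k \<longleftrightarrow> (\<forall>j\<ge>k. fst (W j) = snd (W j))"
proof
  assume "coupling_time W \<le> enat k"
  then obtain l where "coupling_time W = enat l" "l \<le> k" by (cases "coupling_time W") auto
  then show "\<forall>j\<ge>k. fst (W j) = snd (W j)" using coupling_time_enat order_trans by metis
next
  assume "\<forall>j\<ge>k. fst (W j) = snd (W j)"
  then show "coupling_time W \<le> enat k"
    unfolding coupling_time_def by (intro Inf_lower) auto
qed

text \<open>The event that the time is at most k is a countable intersection of coordinate events,
  and each level set is a countable combination of such events.\<close>

lemma measurable_coupling_time [measurable]:
  "coupling_time \<in> measurable (path_space :: (nat \<Rightarrow> 'a::countable \<times> 'a) measure) (count_space UNIV)"
proof -
  have le: "Measurable.pred (path_space :: (nat \<Rightarrow> 'a \<times> 'a) measure) (\<lambda>W. coupling_time W \<le> enat k)" for k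
    unfolding coupling_time_le_iff by measurable
  have "Measurable.pred (path_space :: (nat \<Rightarrow> 'a \<times> 'a) measure) (\<lambda>W. coupling_time W = t)" for t
  proof (cases t)
    case (enat k)
    have "(n = k) = (n \<le> k \<and> (\<forall>l<k. \<not> n \<le> l))" for n
      by (metis le_neq_implies_less order_refl leD)
    then have "(coupling_time W = t) = (coupling_time W \<le> enat k \<and> (\<forall>l<k. \<not> coupling_time W \<le> enat l))"
      for W :: "nat \<Rightarrow> 'a \<times> 'a"
      unfolding enat
      by (cases "coupling_time W") auto
    then show ?thesis using le by simp
  next
    case infinity
    have "(coupling_time W = t) = (\<forall>l. \<not> coupling_time W \<le> enat l)" for W :: "nat \<Rightarrow> 'a \<times> 'a"
      unfolding infinity by (cases "coupling_time W") auto
    then show ?thesis using le by simp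
  qed
  then have "{W. coupling_time W = t} \<in> sets (path_space :: (nat \<Rightarrow> 'a \<times> 'a) measure)" for t
    by (simp add: pred_def)
  then show ?thesis
    by (simp add: measurable_count_space_eq2_countable vimage_def)
qed

section \<open>The weighted Cauchy-Schwarz estimate\<close>

text \<open>The induction step needs u^s (u+2) \<le> (u+1)^(s+1) with u = k+1. It follows from
  u(u+2) \<le> (u+1)^2 and from the monotonicity of the power s-1, which is where s \<ge> 1 enters.
  The factor 1/2 gained here is the one beside the zeta value in the constant.\<close>

lemma sum_powr_le:
  fixes s :: real
  assumes "s \<ge> 1"
  shows "(\<Sum>j<k. (real j + 1) powr s) \<le> (real k + 1) powr (s + 1) / 2"
proof (induction k)
  case 0
  then show ?case by simp
next
  case (Suc k)
  define u where "u = real k + 1"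
  have u: "u \<ge> 1" by (simp add: u_def)
  have "u powr s * (u + 2) \<le> u powr (s - 1) * (u + 1)\<^sup>2"
  proof -
    have "u powr s = u powr (s - 1) * u" using u by (simp add: powr_mult_base' powr_diff)
    then have "u powr s * (u + 2) = u powr (s - 1) * (u * (u + 2))" by simp
    also have "\<dots> \<le> u powr (s - 1) * (u + 1)\<^sup>2"
      by (intro mult_left_mono) (auto simp: power2_eq_square algebra_simps)
    finally show ?thesis .
  qed
  also have "\<dots> \<le> (u + 1) powr (s - 1) * (u + 1)\<^sup>2"
    using u assms by (intro mult_right_mono powr_mono2) auto
  also have "\<dots> = (u + 1) powr (s + 1)"
    using u by (simp flip: powr_numeral add: powr_add [symmetric] add.commute)
  finally have "u powr (s + 1) + 2 * u powr s \<le> (u + 1) powr (s + 1)"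
    using u by (simp add: powr_add algebra_simps)
  then show ?case using Suc.IH by (simp add: u_def algebra_simps)
qed

text \<open>The number a_i of the overview. Only coordinates from \<open>i\<close> onwards occur,
  since the restart takes place at \<open>i\<close>; the division by 2 absorbs the factor of
  \<open>sum_powr_le\<close>.\<close>

definition weighted_osc :: "((int \<Rightarrow> 'a) \<Rightarrow> real) \<Rightarrow> real \<Rightarrow> int \<Rightarrow> real" where
  "weighted_osc f \<epsilon> i = (\<Sum>j. (delta f (i + int j))\<^sup>2 * (real j + 1) powr - (1 + \<epsilon>)) / 2"

lemma summable_powr_weights:
  assumes "\<epsilon> > 0"
  shows "summable (\<lambda>j. (real j + 1) powr - (1 + \<epsilon>))"
proof -
  have "summable (\<lambda>n. real n powr - (1 + \<epsilon>))"
    using assms by (simp add: summable_real_powr_iff)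
  then show ?thesis
    using summable_Suc_iff [of "\<lambda>n. real n powr - (1 + \<epsilon>)"] by (simp add: add.commute)
qed

lemma zeta_real_eq: "zeta_real (1 + \<epsilon>) = (\<Sum>j. (real j + 1) powr - (1 + \<epsilon>))"
  unfolding zeta_real_def powr_minus_divide by (simp add: add.commute)

lemma zeta_real_pos: "\<epsilon> > 0 \<Longrightarrow> zeta_real (1 + \<epsilon>) > 0"
  unfolding zeta_real_eq by (rule suminf_pos [OF summable_powr_weights]) simp_all

text \<open>\<open>D\<close> is a real upper bound for the squared norm, imposed on finite partial
  sums; this keeps the estimates below in the reals although the norm in the statement is an
  extended number.\<close>

locale square_summable_osc =
  fixes M :: "(int \<Rightarrow> 'a) measure" and f :: "(int \<Rightarrow> 'a) \<Rightarrow> real" and \<epsilon> D :: real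
  assumes lip: "lip M f" and eps: "\<epsilon> > 0"
    and D: "\<And>I. finite I \<Longrightarrow> (\<Sum>i\<in>I. (delta f i)\<^sup>2) \<le> D"
begin

lemmas summable_weights = summable_powr_weights [OF eps]

lemma delta_sq_le: "(delta f i)\<^sup>2 \<le> D"
  using D [of "{i}"] by simp

lemma summable_weighted_osc: "summable (\<lambda>j. (delta f (i + int j))\<^sup>2 * (real j + 1) powr - (1 + \<epsilon>))"
  by (rule summable_comparison_test' [OF summable_mult [OF summable_weights, of D], of 0])
     (auto intro!: mult_right_mono delta_sq_le)

lemma weighted_osc_nonneg: "weighted_osc f \<epsilon> i \<ge> 0"
  unfolding weighted_osc_def by (intro divide_nonneg_pos suminf_nonneg summable_weighted_osc) auto

text \<open>Summing over \<open>i\<close> first: for each fixed shift \<open>j\<close> the shifted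
  index set is again finite, so its squares contribute at most \<open>D\<close>, and the weights sum
  to the zeta value.\<close>

lemma sum_weighted_osc_le:
  assumes "finite I"
  shows "(\<Sum>i\<in>I. weighted_osc f \<epsilon> i) \<le> zeta_real (1 + \<epsilon>) / 2 * D"
proof -
  have "2 * (\<Sum>i\<in>I. weighted_osc f \<epsilon> i) = (\<Sum>i\<in>I. \<Sum>j. (delta f (i + int j))\<^sup>2 * (real j + 1) powr - (1 + \<epsilon>))"
    by (simp add: weighted_osc_def sum_divide_distrib [symmetric])
  also have "\<dots> = (\<Sum>j. \<Sum>i\<in>I. (delta f (i + int j))\<^sup>2 * (real j + 1) powr - (1 + \<epsilon>))"
    by (rule suminf_sum [symmetric]) (rule summable_weighted_osc)
  also have "\<dots> \<le> (\<Sum>j. D * (real j + 1) powr - (1 + \<epsilon>))"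
  proof (rule suminf_le)
    fix j
    have "(\<Sum>i\<in>I. (delta f (i + int j))\<^sup>2) = (\<Sum>i\<in>(\<lambda>i. i + int j) ` I. (delta f i)\<^sup>2)"
      by (subst sum.reindex) auto
    also have "\<dots> \<le> D" using assms by (intro D) simp
    finally show "(\<Sum>i\<in>I. (delta f (i + int j))\<^sup>2 * (real j + 1) powr - (1 + \<epsilon>)) \<le> D * (real j + 1) powr - (1 + \<epsilon>)"
      unfolding sum_distrib_right [symmetric] by (rule mult_right_mono) simp
    next
    show "summable (\<lambda>j. \<Sum>i\<in>I. (delta f (i + int j))\<^sup>2 * (real j + 1) powr - (1 + \<epsilon>))"
      by (intro summable_sum summable_weighted_osc)
    show "summable (\<lambda>j. D * (real j + 1) powr - (1 + \<epsilon>))"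
      by (intro summable_mult summable_weights)
  qed
  also have "\<dots> = D * zeta_real (1 + \<epsilon>)"
    unfolding zeta_real_eq by (rule suminf_mult [OF summable_weights])
  finally show ?thesis by (simp add: mult.commute)
qed

lemma sum_delta_le:
  "(\<Sum>j<k. delta f (i + int j)) \<le> sqrt (weighted_osc f \<epsilon> i) * (real k + 1) powr (1 + \<epsilon> / 2)"
proof -
  \<comment> \<open>Each oscillation is the product of \<open>?v\<close> and \<open>?w\<close>: the
    squares of \<open>?v\<close> are the summands of \<open>weighted_osc\<close>, those of
    \<open>?w\<close> the powers estimated by \<open>sum_powr_le\<close>.\<close>
  let ?w = "\<lambda>j. (real j + 1) powr ((1 + \<epsilon>) / 2)" and ?v = "\<lambda>j. delta f (i + int j) * (real j + 1) powr - ((1 + \<epsilon>) / 2)"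
  have sq: "((real j + 1) powr a)\<^sup>2 = (real j + 1) powr (2 * a)" for j a
    by (simp add: power2_eq_square powr_add [symmetric])
  have "(\<Sum>j<k. ?v j * ?w j)\<^sup>2 \<le> (\<Sum>j<k. (?v j)\<^sup>2) * (\<Sum>j<k. (?w j)\<^sup>2)"
    by (rule Cauchy_Schwarz_ineq_sum)
  also have "\<dots> \<le> (2 * weighted_osc f \<epsilon> i) * ((real k + 1) powr (2 + \<epsilon>) / 2)"
  proof (rule mult_mono)
    have "(\<Sum>j<k. (?v j)\<^sup>2) = (\<Sum>j<k. (delta f (i + int j))\<^sup>2 * (real j + 1) powr - (1 + \<epsilon>))"
    proof -
      have "2 * - ((1 + \<epsilon>) / 2) = - (1 + \<epsilon>)" by (simp add: field_simps)
      then show ?thesis by (simp only: power_mult_distrib sq)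
    qed
    also have "\<dots> \<le> 2 * weighted_osc f \<epsilon> i"
      unfolding weighted_osc_def using sum_le_suminf [OF summable_weighted_osc [of i], of "{..<k}"] by simp
    finally show "(\<Sum>j<k. (?v j)\<^sup>2) \<le> 2 * weighted_osc f \<epsilon> i" .
    show "(\<Sum>j<k. (?w j)\<^sup>2) \<le> (real k + 1) powr (2 + \<epsilon>) / 2"
    proof -
      have "2 * ((1 + \<epsilon>) / 2) = 1 + \<epsilon>" by simp
      then have "(\<Sum>j<k. (?w j)\<^sup>2) = (\<Sum>j<k. (real j + 1) powr (1 + \<epsilon>))" by (simp only: sq)
      also have "\<dots> \<le> (real k + 1) powr (1 + \<epsilon> + 1) / 2" using eps by (intro sum_powr_le) simp
      finally show ?thesis by (simp add: add.commute)
    qed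
  qed (use weighted_osc_nonneg in \<open>auto intro!: sum_nonneg\<close>)
  also have "\<dots> = (sqrt (weighted_osc f \<epsilon> i) * (real k + 1) powr (1 + \<epsilon> / 2))\<^sup>2"
    using weighted_osc_nonneg by (simp add: power_mult_distrib sq)
  finally have "(\<Sum>j<k. ?v j * ?w j) \<le> sqrt (weighted_osc f \<epsilon> i) * (real k + 1) powr (1 + \<epsilon> / 2)"
    by (rule power2_le_imp_le) (use weighted_osc_nonneg in auto)
  moreover have "?v j * ?w j = delta f (i + int j)" for j
    by (simp add: powr_minus)
  ultimately show ?thesis by simp
qed

lemma diff_graft_le:
  assumes "coupling_time W = enat k"
  shows "\<bar>f (graft i \<omega> (\<lambda>n. fst (W n))) - f (graft i \<omega> (\<lambda>n. snd (W n)))\<bar>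
    \<le> sqrt (weighted_osc f \<epsilon> i) * (real k + 1) powr (1 + \<epsilon> / 2)"
proof -
  have "\<bar>f (graft i \<omega> (\<lambda>n. fst (W n))) - f (graft i \<omega> (\<lambda>n. snd (W n)))\<bar>
      \<le> (\<Sum>j\<in>(\<lambda>j. i + int j) ` {..<k}. delta f j)"
  proof (rule diff_le_sum_delta [OF lip])
    fix l assume l: "l \<notin> (\<lambda>j. i + int j) ` {..<k}"
    show "graft i \<omega> (\<lambda>n. fst (W n)) l = graft i \<omega> (\<lambda>n. snd (W n)) l"
    proof (cases "l < i")
      case False
      then have "nat (l - i) \<ge> k"
      proof -
        have "l = i + int (nat (l - i))" using False by simp
        then show ?thesis using l by (metis imageI lessThan_iff not_le)
      qed
      then show ?thesis using coupling_time_enat [OF assms] False by (simp add: graft_def)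
    qed (simp add: graft_def)
  qed simp
  also have "\<dots> = (\<Sum>j<k. delta f (i + int j))"
    by (subst sum.reindex) (auto simp: inj_on_def)
  finally show ?thesis using sum_delta_le [of i k] by linarith
qed

end

subsection \<open>Conditional expectations given the past\<close>

lemma has_sum_imp_nn_integral:
  fixes h :: "'b::countable \<Rightarrow> real"
  assumes "(h has_sum S) UNIV" "\<And>x. h x \<ge> 0"
  shows "(\<integral>\<^sup>+x. ennreal (h x) \<partial>count_space UNIV) = ennreal S"
proof -
  have "((\<lambda>F. ennreal (sum h F)) \<longlongrightarrow> ennreal S) (finite_subsets_at_top UNIV)"
    using assms(1) unfolding has_sum_def by (rule tendsto_ennrealI)
  moreover have "sum (\<lambda>x. ennreal (h x)) = (\<lambda>F. ennreal (sum h F))"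
    by (rule ext) (simp add: sum_ennreal assms(2))
  ultimately have "((\<lambda>x. ennreal (h x)) has_sum ennreal S) UNIV"
    unfolding has_sum_def by simp
  then show ?thesis by (simp add: infsum_eq_nn_integral_count_space [symmetric] infsumI)
qed

text \<open>Takes the place of measurability with respect to the sigma-field of the past. Being a
  pointwise condition, it combines directly with grafting, which leaves the past of a path
  untouched.\<close>

definition depends_on_past :: "int \<Rightarrow> ((int \<Rightarrow> 'a) \<Rightarrow> 'b) \<Rightarrow> bool" where
  "depends_on_past i h \<longleftrightarrow> (\<forall>\<omega> \<omega>'. (\<forall>k\<le>i. \<omega> k = \<omega>' k) \<longrightarrow> h \<omega> = h \<omega>')"

lemma depends_on_pastD: "depends_on_past i h \<Longrightarrow> (\<And>k. k \<le> i \<Longrightarrow> \<omega> k = \<omega>' k) \<Longrightarrow> h \<omega> = h \<omega>'"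
  by (auto simp: depends_on_past_def)

lemma depends_on_past_mono: "depends_on_past i h \<Longrightarrow> i \<le> j \<Longrightarrow> depends_on_past j h"
  unfolding depends_on_past_def by (meson order_trans)

text \<open>The pathwise form of the tower property: a restart at time i-1 followed by a restart one
  step later is a restart at time \<open>i\<close>. The hypothesis holds almost surely under the
  chain started from the state at time i-1.\<close>

lemma graft_prepend:
  assumes "\<eta> 0 = \<omega> (i - 1)"
  shows "graft (i - 1) \<omega> (prepend \<eta> \<eta>') = graft i \<omega> \<eta>'"
proof
  fix k
  have "nat (k - (i - 1)) - 1 = nat (k - i)" if "k \<ge> i" using that by arith
  then show "graft (i - 1) \<omega> (prepend \<eta> \<eta>') k = graft i \<omega> \<eta>' k"
    using assms by (cases "k = i - 1") (auto simp: graft_def prepend_def)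
qed

locale coupled_chain =
  fixes K :: "'e::countable \<Rightarrow> 'e \<Rightarrow> real" and nu :: "'e \<Rightarrow> real" and M :: "(int \<Rightarrow> 'e) measure"
    and Q :: "'e \<times> 'e \<Rightarrow> 'e \<times> 'e \<Rightarrow> real" and Ph :: "'e \<Rightarrow> 'e \<Rightarrow> (nat \<Rightarrow> 'e \<times> 'e) measure"
  assumes stoch: "stochastic K"
    and law_M: "stationary_chain_law K nu M"
    and coupling: "markovian_coupling K Q"
    and law_Ph: "\<And>y z. chain_law_from Q (y, z) (Ph y z)"

sublocale coupled_chain \<subseteq> prob_space M
  using law_M by (simp add: stationary_chain_law_def)

context coupled_chain
begin

lemma K_nonneg [simp]: "K x y \<ge> 0"
  using stoch by (simp add: stochastic_def)

lemma Q_nonneg [simp]: "Q s t \<ge> 0"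
  using coupling unfolding markovian_coupling_def stochastic_def by blast

lemma sets_M [measurable_cong]: "sets M = sets path_space"
  using law_M by (simp add: stationary_chain_law_def)

lemma space_M [simp]: "space M = UNIV"
  using sets_M by (rule sets_path_space_imp_space)

lemma sets_Ph [measurable_cong]: "sets (Ph y z) = sets path_space"
  using law_Ph [of y z] by (simp add: chain_law_from_def)

lemma prob_space_Ph: "prob_space (Ph y z)"
  using law_Ph [of y z] by (simp add: chain_law_from_def)

text \<open>The chain started from \<open>y\<close>, constructed as a marginal of the coupling
  started on the diagonal. By uniqueness of chain laws the marginals of every other coupled start
  give the same family.\<close>

definition P :: "'e \<Rightarrow> (nat \<Rightarrow> 'e) measure" where
  "P y = distr (Ph y y) path_space (\<lambda>W n. fst (W n))"

lemma measurable_projections [measurable]: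
  "(\<lambda>W n. fst (W n)) \<in> measurable (Ph y z) path_space"
  "(\<lambda>W n. snd (W n)) \<in> measurable (Ph y z) path_space"
  using measurable_map_path [of fst] measurable_map_path [of snd]
  unfolding measurable_cong_sets [OF sets_Ph refl] by blast+

text \<open>A fibre of a projection is a row or a column of the product space, and the defining sums
  of a Markovian coupling say that \<open>Q\<close> gives it the weight prescribed by
  \<open>K\<close>; this is the lumping criterion.\<close>

lemma
  shows law_fst: "chain_law_from K y (distr (Ph y z) path_space (\<lambda>W n. fst (W n)))"
    and law_snd: "chain_law_from K z (distr (Ph y z) path_space (\<lambda>W n. snd (W n)))"
proof -
  have law: "chain_law_from Q s (case_prod Ph s)" for s
    using law_Ph by (cases s) simp
  have row: "((\<lambda>v'. Q (u, v) (u', v')) has_sum K u u') UNIV" "((\<lambda>u'. Q (u, v) (u', v')) has_sum K v v') UNIV" for u v u' v'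
    using coupling by (auto simp: markovian_coupling_def)
  have "(\<integral>\<^sup>+t. ennreal (Q s t) * indicator {t. fst t = a} t \<partial>count_space UNIV) = ennreal (K (fst s) a)" for s a
  proof -
    have "(\<integral>\<^sup>+t. ennreal (Q s t) * indicator {t. fst t = a} t \<partial>count_space UNIV) =
        (\<integral>\<^sup>+u'. \<integral>\<^sup>+v'. ennreal (Q s (u', v')) * indicator {t. fst t = a} (u', v') \<partial>count_space UNIV \<partial>count_space UNIV)"
      by (rule nn_integral_fst_count_space [symmetric])
    also have "\<dots> = (\<integral>\<^sup>+u'. (\<integral>\<^sup>+v'. ennreal (Q s (a, v')) \<partial>count_space UNIV) * indicator {a} u' \<partial>count_space UNIV)"
      by (intro nn_integral_cong) (auto split: split_indicator)
    also have "\<dots> = (\<integral>\<^sup>+v'. ennreal (Q s (a, v')) \<partial>count_space UNIV)"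
      by (subst nn_integral_count_space' [of "{a}"]) auto
    also have "\<dots> = ennreal (K (fst s) a)"
      using row(1) [of "fst s" "snd s" a] by (intro has_sum_imp_nn_integral) auto
    finally show ?thesis .
  qed
  from chain_law_from_lumped [OF law _ this, of "(y, z)"]
  show "chain_law_from K y (distr (Ph y z) path_space (\<lambda>W n. fst (W n)))" by simp
  have "(\<integral>\<^sup>+t. ennreal (Q s t) * indicator {t. snd t = a} t \<partial>count_space UNIV) = ennreal (K (snd s) a)" for s a
  proof -
    have "(\<integral>\<^sup>+t. ennreal (Q s t) * indicator {t. snd t = a} t \<partial>count_space UNIV) =
        (\<integral>\<^sup>+v'. \<integral>\<^sup>+u'. ennreal (Q s (u', v')) * indicator {t. snd t = a} (u', v') \<partial>count_space UNIV \<partial>count_space UNIV)"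
      by (rule nn_integral_snd_count_space [symmetric])
    also have "\<dots> = (\<integral>\<^sup>+v'. (\<integral>\<^sup>+u'. ennreal (Q s (u', a)) \<partial>count_space UNIV) * indicator {a} v' \<partial>count_space UNIV)"
      by (intro nn_integral_cong) (auto split: split_indicator)
    also have "\<dots> = (\<integral>\<^sup>+u'. ennreal (Q s (u', a)) \<partial>count_space UNIV)"
      by (subst nn_integral_count_space' [of "{a}"]) auto
    also have "\<dots> = ennreal (K (snd s) a)"
      using row(2) [of "fst s" "snd s" a] by (intro has_sum_imp_nn_integral) auto
    finally show ?thesis .
  qed
  from chain_law_from_lumped [OF law _ this, of "(y, z)"]
  show "chain_law_from K z (distr (Ph y z) path_space (\<lambda>W n. snd (W n)))" by simp
qed

lemma law_P: "chain_law_from K y (P y)"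
  unfolding P_def by (rule law_fst)

lemma sets_P [measurable_cong]: "sets (P y) = sets path_space"
  by (simp add: P_def)

lemma distr_fst: "distr (Ph y z) path_space (\<lambda>W n. fst (W n)) = P y"
  using law_fst law_P by (rule chain_law_from_unique)

lemma distr_snd: "distr (Ph y z) path_space (\<lambda>W n. snd (W n)) = P z"
  using law_snd law_P by (rule chain_law_from_unique)

lemma disint_M: "disintegration M (\<lambda>\<omega>. \<omega> i) P (graft i) path_space"
  using law_M law_P by (rule stationary_chain_disintegration)

lemma disint_P: "disintegration (P x) (\<lambda>\<eta>. \<eta> 1) P prepend path_space"
  using law_P by (rule chain_family_disintegration)

text \<open>Exchanges almost sure statements on the first step for statements on every state that
  can be reached with positive probability. It is used in both directions.\<close>

lemma AE_P_step_iff: "(AE \<eta> in P x. R (\<eta> 1)) \<longleftrightarrow> (\<forall>z. K x z > 0 \<longrightarrow> R z)"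
proof -
  have "(AE \<eta> in P x. R (\<eta> 1)) \<longleftrightarrow> (\<integral>\<^sup>+\<eta>. indicator {z. \<not> R z} (\<eta> 1) \<partial>P x) = 0"
    by (subst nn_integral_0_iff_AE) (auto simp: indicator_def)
  also have "\<dots> \<longleftrightarrow> (\<integral>\<^sup>+z. ennreal (K x z) * indicator {z. \<not> R z} z \<partial>count_space UNIV) = 0"
    by (simp add: nn_integral_chain_first_step [OF law_P, unfolded One_nat_def])
  also have "\<dots> \<longleftrightarrow> (\<forall>z. K x z > 0 \<longrightarrow> R z)"
    by (subst nn_integral_0_iff_AE)
       (auto simp: AE_count_space indicator_def ennreal_eq_0_iff not_le, (metis linorder_not_less)+)
  finally show ?thesis .
qed

lemma AE_M_pair:
  assumes "\<And>x y. nu x * K x y > 0 \<Longrightarrow> R x y"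
  shows "AE \<omega> in M. R (\<omega> (i - 1)) (\<omega> i)"
proof -
  have "(\<integral>\<^sup>+\<omega>. indicator {xy. \<not> R (fst xy) (snd xy)} (\<omega> (i - 1), \<omega> i) \<partial>M) =
      (\<integral>\<^sup>+(x, y). ennreal (nu x * K x y) * indicator {xy. \<not> R (fst xy) (snd xy)} (x, y) \<partial>count_space UNIV)"
    by (rule nn_integral_stationary_pair [OF law_M])
  also have "\<dots> = (\<integral>\<^sup>+xy. 0 \<partial>count_space (UNIV :: ('e \<times> 'e) set))"
  proof (rule nn_integral_cong)
    fix xy :: "'e \<times> 'e"
    show "(case xy of (x, y) \<Rightarrow> ennreal (nu x * K x y) * indicator {xy. \<not> R (fst xy) (snd xy)} (x, y)) = 0"
      using assms [of "fst xy" "snd xy"]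
      by (cases xy) (auto simp: indicator_def ennreal_eq_0_iff not_le [symmetric])
  qed
  finally have "(\<integral>\<^sup>+\<omega>. indicator {xy. \<not> R (fst xy) (snd xy)} (\<omega> (i - 1), \<omega> i) \<partial>M) = 0"
    by simp
  then show ?thesis
    by (subst (asm) nn_integral_0_iff_AE) (auto simp: indicator_def)
qed

text \<open>Only the coordinates of \<open>\<omega>\<close> before \<open>i\<close> enter; the state
  at time \<open>i\<close> is the free parameter \<open>y\<close>. Taking for \<open>y\<close> the
  actual state gives g_i, and averaging over \<open>y\<close> with the transition weights from the
  state at i-1 gives g_(i-1).\<close>

definition cexp :: "((int \<Rightarrow> 'e) \<Rightarrow> real) \<Rightarrow> int \<Rightarrow> (int \<Rightarrow> 'e) \<Rightarrow> 'e \<Rightarrow> real" where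
  "cexp f i \<omega> y = (\<integral>\<eta>. f (graft i \<omega> \<eta>) \<partial>P y)"

definition past_exp :: "((int \<Rightarrow> 'e) \<Rightarrow> real) \<Rightarrow> int \<Rightarrow> (int \<Rightarrow> 'e) \<Rightarrow> real" where
  "past_exp f i \<omega> = cexp f i \<omega> (\<omega> i)"

lemma graft_measurable_snd [measurable]: "graft i \<omega> \<in> measurable path_space path_space"
  using measurable_Pair2 [OF measurable_graft, of \<omega> i] by simp

lemma depends_on_past_past_exp: "depends_on_past i (past_exp f i)"
proof -
  have "graft i \<omega> = graft i \<omega>'" if "\<forall>k\<le>i. \<omega> k = \<omega>' k" for \<omega> \<omega>' :: "int \<Rightarrow> 'e"
    using that by (auto simp: graft_def fun_eq_iff)
  then show ?thesis
    unfolding depends_on_past_def past_exp_def cexp_def by (metis order_refl)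
qed

lemma measurable_past_exp:
  assumes [measurable]: "f \<in> borel_measurable M"
  shows "past_exp f i \<in> borel_measurable M"
proof -
  interpret D: disintegration M "\<lambda>\<omega>. \<omega> i" P "graft i" path_space by (rule disint_M)
  have "(\<lambda>\<omega>. \<integral>\<eta>. f (graft i \<omega> \<eta>) \<partial>P (\<omega> i)) \<in> borel_measurable M"
    by (rule D.measurable_kernel) measurable
  then show ?thesis unfolding past_exp_def [abs_def] cexp_def .
qed

text \<open>The defining property of a conditional expectation, tested against functions of the
  past: grafting leaves \<open>h\<close> unchanged almost surely, so \<open>h\<close> leaves the
  inner integral. Only the product with \<open>f\<close> has to be integrable, because
  \<open>h\<close> will be an unbounded power of a martingale difference.\<close>

lemma
  assumes f: "integrable M f" and hf: "integrable M (\<lambda>\<omega>. h \<omega> * f \<omega>)" and h: "depends_on_past i h"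
  shows integrable_past_exp_mult: "integrable M (\<lambda>\<omega>. h \<omega> * past_exp f i \<omega>)"
    and integral_past_exp_mult: "(\<integral>\<omega>. h \<omega> * past_exp f i \<omega> \<partial>M) = (\<integral>\<omega>. h \<omega> * f \<omega> \<partial>M)"
proof -
  interpret D: disintegration M "\<lambda>\<omega>. \<omega> i" P "graft i" path_space by (rule disint_M)
  have [measurable]: "f \<in> borel_measurable M" "(\<lambda>\<omega>. h \<omega> * f \<omega>) \<in> borel_measurable M"
    using f hf by auto
  have eq: "(\<integral>\<eta>. h (graft i \<omega> \<eta>) * f (graft i \<omega> \<eta>) \<partial>P (\<omega> i)) = h \<omega> * past_exp f i \<omega>" for \<omega>
  proof -
    have "(\<integral>\<eta>. h (graft i \<omega> \<eta>) * f (graft i \<omega> \<eta>) \<partial>P (\<omega> i)) = (\<integral>\<eta>. h \<omega> * f (graft i \<omega> \<eta>) \<partial>P (\<omega> i))"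
    proof (rule integral_cong_AE)
      show "AE \<eta> in P (\<omega> i). h (graft i \<omega> \<eta>) * f (graft i \<omega> \<eta>) = h \<omega> * f (graft i \<omega> \<eta>)"
        using AE_chain_law_from_start [OF law_P]
      proof eventually_elim
        case (elim \<eta>)
        have "h (graft i \<omega> \<eta>) = h \<omega>"
          by (rule depends_on_pastD [OF h]) (use elim in \<open>auto simp: graft_def\<close>)
        then show ?case by simp
      qed
      have "(\<lambda>\<eta>. (\<lambda>\<omega>. h \<omega> * f \<omega>) (graft i \<omega> \<eta>)) \<in> borel_measurable (P (\<omega> i))" by measurable
      then show "(\<lambda>\<eta>. h (graft i \<omega> \<eta>) * f (graft i \<omega> \<eta>)) \<in> borel_measurable (P (\<omega> i))" by simp
    qed measurable
    then show ?thesis by (simp add: past_exp_def cexp_def)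
  qed
  show "integrable M (\<lambda>\<omega>. h \<omega> * past_exp f i \<omega>)"
    using D.integrable_disint [OF hf] by (simp add: eq)
  show "(\<integral>\<omega>. h \<omega> * past_exp f i \<omega> \<partial>M) = (\<integral>\<omega>. h \<omega> * f \<omega> \<partial>M)"
    using D.integral_disint [OF hf] by (simp add: eq)
qed

lemma integrable_past_exp: "integrable M f \<Longrightarrow> integrable M (past_exp f i)"
  using integrable_past_exp_mult [of f "\<lambda>_. 1" i] by (simp add: depends_on_past_def)

end

subsection \<open>Moments of the martingale increments\<close>

lemma abs_le_one_plus_even_power:
  fixes u :: real
  assumes "p \<ge> 1"
  shows "\<bar>u\<bar> \<le> 1 + u ^ (2 * p)"
proof (cases "\<bar>u\<bar> \<le> 1")
  case False
  then have "\<bar>u\<bar> ^ 1 \<le> \<bar>u\<bar> ^ (2 * p)" using assms by (intro power_increasing) auto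
  then show ?thesis by (simp add: power_even_abs)
qed (simp add: add_increasing2)

lemma (in finite_measure) integrable_if_even_moment:
  fixes f :: "'a \<Rightarrow> real"
  assumes "p \<ge> 1" "f \<in> borel_measurable M" "integrable M (\<lambda>x. f x ^ (2 * p))"
  shows "integrable M f"
proof (rule Bochner_Integration.integrable_bound)
  show "integrable M (\<lambda>x. 1 + f x ^ (2 * p))" using assms by simp
  show "AE x in M. norm (f x) \<le> norm (1 + f x ^ (2 * p))"
    using abs_le_one_plus_even_power [OF assms(1)] by (auto intro!: AE_I2 order_trans [OF _ abs_ge_self])
qed (fact assms)

context coupled_chain
begin

definition meeting_cost :: "real \<Rightarrow> 'e \<Rightarrow> 'e \<Rightarrow> ennreal" where
  "meeting_cost a y z = (\<integral>\<^sup>+W. time_pow (coupling_time W) a \<partial>Ph y z)"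

definition step_cost :: "real \<Rightarrow> 'e \<Rightarrow> 'e \<Rightarrow> ennreal" where
  "step_cost a x y = (\<Sum>\<^sub>\<infinity>z. ennreal (K x z) * meeting_cost a y z)"

lemma step_cost_eq: "step_cost a x y = (\<integral>\<^sup>+z. ennreal (K x z) * meeting_cost a y z \<partial>count_space UNIV)"
  unfolding step_cost_def by (rule infsum_eq_nn_integral_count_space)

lemma measurable_time_pow_coupling [measurable]:
  "(\<lambda>W. time_pow (coupling_time W) a) \<in> borel_measurable (Ph y z)"
proof -
  have "(\<lambda>W. time_pow (coupling_time W) a) \<in> borel_measurable (path_space :: (nat \<Rightarrow> 'e \<times> 'e) measure)"
    by (rule measurable_compose [OF measurable_coupling_time]) simp
  then show ?thesis unfolding measurable_cong_sets [OF sets_Ph refl] .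
qed

lemma meeting_cost_finite:
  assumes "step_cost a x y < \<infinity>" "K x z > 0"
  shows "meeting_cost a y z < \<infinity>"
proof -
  have "ennreal (K x z) * meeting_cost a y z \<le> step_cost a x y"
    unfolding step_cost_eq by (rule nn_integral_ge_point) simp
  then have "ennreal (K x z) * meeting_cost a y z < \<infinity>" using assms(1) by (rule le_less_trans)
  then show ?thesis using assms(2) by (auto simp: ennreal_mult_less_top)
qed

end

text \<open>The nondegenerate case, in which both the norm and the constant are finite; the
  remaining cases are separated in \<open>central_moment_le\<close>.\<close>

locale coupled_chain_lip = coupled_chain K nu M Q Ph + square_summable_osc M f \<epsilon> D
  for K :: "'e::countable \<Rightarrow> 'e \<Rightarrow> real" and nu M Q Ph and f :: "(int \<Rightarrow> 'e) \<Rightarrow> real" and \<epsilon> D +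
  fixes p :: nat
  assumes p: "p \<ge> 1" and moment: "integrable M (\<lambda>\<omega>. f \<omega> ^ (2 * p))"
    and cost_finite: "(\<Sum>\<^sub>\<infinity>(x, y). ennreal (nu x * K x y) * step_cost (1 + \<epsilon> / 2) x y ^ (2 * p)) < \<infinity>"
begin

lemma f_measurable [measurable]: "f \<in> borel_measurable M"
  using lip by (simp add: lip_def)

lemma f_integrable: "integrable M f"
  using p f_measurable moment by (rule integrable_if_even_moment)

abbreviation "osc \<equiv> weighted_osc f \<epsilon>"

abbreviation "cost \<equiv> step_cost (1 + \<epsilon> / 2)"

definition increment :: "int \<Rightarrow> (int \<Rightarrow> 'e) \<Rightarrow> real" where
  "increment i \<omega> = past_exp f i \<omega> - past_exp f (i - 1) \<omega>"

text \<open>Both expectations are written as integrals over the same coupled pair, using its two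
  marginals. The finite meeting cost makes the coupling time finite almost surely; it also excludes
  a right-hand side of the form 0 * infinity = 0.\<close>

lemma cexp_diff_le:
  assumes y: "integrable (P y) (\<lambda>\<eta>. f (graft i \<omega> \<eta>))" and z: "integrable (P z) (\<lambda>\<eta>. f (graft i \<omega> \<eta>))"
    and fin: "meeting_cost (1 + \<epsilon> / 2) y z < \<infinity>"
  shows "ennreal \<bar>cexp f i \<omega> y - cexp f i \<omega> z\<bar> \<le> ennreal (sqrt (osc i)) * meeting_cost (1 + \<epsilon> / 2) y z"
proof -
  let ?U = "\<lambda>W. f (graft i \<omega> (\<lambda>n. fst (W n)))" and ?V = "\<lambda>W. f (graft i \<omega> (\<lambda>n. snd (W n)))"
  have meas: "(\<lambda>\<eta>. f (graft i \<omega> \<eta>)) \<in> borel_measurable path_space" by measurable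
  have U: "integrable (Ph y z) ?U" "cexp f i \<omega> y = (\<integral>W. ?U W \<partial>Ph y z)"
    using y meas unfolding cexp_def distr_fst [of y z, symmetric]
    by (simp_all add: integrable_distr_eq integral_distr)
  have V: "integrable (Ph y z) ?V" "cexp f i \<omega> z = (\<integral>W. ?V W \<partial>Ph y z)"
    using z meas unfolding cexp_def distr_snd [of y z, symmetric]
    by (simp_all add: integrable_distr_eq integral_distr)
  have "ennreal \<bar>cexp f i \<omega> y - cexp f i \<omega> z\<bar> = ennreal (norm (\<integral>W. ?U W - ?V W \<partial>Ph y z))"
    using U V by simp
  also have "\<dots> \<le> (\<integral>\<^sup>+W. ennreal (norm (?U W - ?V W)) \<partial>Ph y z)"
    by (rule integral_norm_bound_ennreal) (use U V in simp)
  also have "\<dots> \<le> (\<integral>\<^sup>+W. ennreal (sqrt (osc i)) * time_pow (coupling_time W) (1 + \<epsilon> / 2) \<partial>Ph y z)"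
  proof (rule nn_integral_mono_AE)
    have "AE W in Ph y z. time_pow (coupling_time W) (1 + \<epsilon> / 2) \<noteq> \<infinity>"
      using fin unfolding meeting_cost_def by (intro nn_integral_PInf_AE) auto
    then show "AE W in Ph y z. ennreal (norm (?U W - ?V W)) \<le> ennreal (sqrt (osc i)) * time_pow (coupling_time W) (1 + \<epsilon> / 2)"
    proof eventually_elim
      case (elim W)
      then obtain k where k: "coupling_time W = enat k"
        by (cases "coupling_time W") (auto simp: time_pow_def)
      then show ?case
        using diff_graft_le [OF k, of i \<omega>] weighted_osc_nonneg [of i]
        by (simp add: time_pow_def ennreal_mult [symmetric])
    qed
  qed
  also have "\<dots> = ennreal (sqrt (osc i)) * meeting_cost (1 + \<epsilon> / 2) y z"
    unfolding meeting_cost_def by (rule nn_integral_cmult) measurable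
  finally show ?thesis .
qed

text \<open>A statement on a single path: the Markov property at time 1 of the chain restarted at
  i-1 rewrites g_(i-1) as the average over its next state z of \<open>cexp\<close> at time
  \<open>i\<close>, so the increment becomes an average of differences between the starts
  \<open>y\<close> and z.\<close>

lemma increment_le_pointwise:
  assumes int: "integrable (P (\<omega> (i - 1))) (\<lambda>\<eta>. f (graft (i - 1) \<omega> \<eta>))"
    and pos: "K (\<omega> (i - 1)) (\<omega> i) > 0" and fin: "cost (\<omega> (i - 1)) (\<omega> i) < \<infinity>"
  shows "ennreal \<bar>increment i \<omega>\<bar> \<le> ennreal (sqrt (osc i)) * cost (\<omega> (i - 1)) (\<omega> i)"
proof -
  define x y where "x = \<omega> (i - 1)" and "y = \<omega> i"
  interpret Px: disintegration "P x" "\<lambda>\<eta>. \<eta> 1" P prepend path_space by (rule disint_P)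
  define F where "F \<eta> = f (graft (i - 1) \<omega> \<eta>)" for \<eta>
  define R where "R z \<longleftrightarrow> integrable (P z) (\<lambda>\<eta>. f (graft i \<omega> \<eta>))" for z
  have F: "integrable (P x) F" using int by (simp add: F_def [abs_def] x_def)
  have start: "AE \<eta> in P x. \<eta> 0 = x" using law_P by (rule AE_chain_law_from_start)
  have F_prepend: "F (prepend \<eta> \<eta>') = f (graft i \<omega> \<eta>')" if "\<eta> 0 = x" for \<eta> \<eta>'
    using that graft_prepend [of \<eta> \<omega> i \<eta>'] by (simp add: F_def x_def)
  \<comment> \<open>Integrability after the restart at i-1 is inherited for almost every next state,
    hence for each state of positive transition probability; the actual state \<open>y\<close> is
    among these by \<open>pos\<close>.\<close>
  have "AE \<eta> in P x. R (\<eta> 1)"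
    using Px.AE_integrable_disint [OF F] start by eventually_elim (simp add: R_def F_prepend)
  then have R: "R z" if "K x z > 0" for z using that unfolding AE_P_step_iff by blast
  have past: "past_exp f (i - 1) \<omega> = (\<integral>\<eta>. F \<eta> \<partial>P x)"
    by (simp add: past_exp_def cexp_def F_def x_def)
  have ae: "AE \<eta> in P x. (\<integral>\<eta>'. F (prepend \<eta> \<eta>') \<partial>P (\<eta> 1)) = cexp f i \<omega> (\<eta> 1)"
    using start by eventually_elim (simp add: F_prepend cexp_def)
  have meas: "(\<lambda>\<eta>. cexp f i \<omega> (\<eta> 1)) \<in> borel_measurable (P x)"
    by (rule measurable_compose [OF Px.X]) simp
  have int': "integrable (P x) (\<lambda>\<eta>. cexp f i \<omega> (\<eta> 1))"
    by (rule integrable_cong_AE_imp [OF Px.integrable_disint [OF F] meas])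
       (use ae in \<open>auto elim: eventually_mono\<close>)
  have "past_exp f (i - 1) \<omega> = (\<integral>\<eta>. cexp f i \<omega> (\<eta> 1) \<partial>P x)"
    unfolding past Px.integral_disint [OF F]
    by (rule integral_cong_AE [OF _ meas ae]) (use Px.integrable_disint [OF F] in simp)
  then have "increment i \<omega> = (\<integral>\<eta>. cexp f i \<omega> y - cexp f i \<omega> (\<eta> 1) \<partial>P x)"
    using int' by (simp add: increment_def past_exp_def y_def Px.prob_space)
  then have "ennreal \<bar>increment i \<omega>\<bar> = ennreal (norm (\<integral>\<eta>. cexp f i \<omega> y - cexp f i \<omega> (\<eta> 1) \<partial>P x))"
    by simp
  also have "\<dots> \<le> (\<integral>\<^sup>+\<eta>. ennreal (norm (cexp f i \<omega> y - cexp f i \<omega> (\<eta> 1))) \<partial>P x)"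
    by (rule integral_norm_bound_ennreal) (use int' in simp)
  also have "\<dots> \<le> (\<integral>\<^sup>+\<eta>. ennreal (sqrt (osc i)) * meeting_cost (1 + \<epsilon> / 2) y (\<eta> 1) \<partial>P x)"
  proof (rule nn_integral_mono_AE)
    have bound: "ennreal (norm (cexp f i \<omega> y - cexp f i \<omega> z)) \<le> ennreal (sqrt (osc i)) * meeting_cost (1 + \<epsilon> / 2) y z"
      if z: "K x z > 0" for z
    proof -
      have "R y" "R z" using R pos z by (auto simp: x_def y_def)
      moreover have "meeting_cost (1 + \<epsilon> / 2) y z < \<infinity>"
        using meeting_cost_finite [OF _ z] fin by (simp add: x_def y_def)
      ultimately show ?thesis using cexp_diff_le unfolding R_def by simp
    qed
    show "AE \<eta> in P x. ennreal (norm (cexp f i \<omega> y - cexp f i \<omega> (\<eta> 1))) \<le>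
        ennreal (sqrt (osc i)) * meeting_cost (1 + \<epsilon> / 2) y (\<eta> 1)"
      unfolding AE_P_step_iff [of "\<lambda>z. ennreal (norm (cexp f i \<omega> y - cexp f i \<omega> z)) \<le>
        ennreal (sqrt (osc i)) * meeting_cost (1 + \<epsilon> / 2) y z" x] using bound by blast
  qed
  also have "\<dots> = ennreal (sqrt (osc i)) * (\<integral>\<^sup>+\<eta>. meeting_cost (1 + \<epsilon> / 2) y (\<eta> 1) \<partial>P x)"
    by (rule nn_integral_cmult) (rule measurable_compose [OF Px.X], simp)
  also have "(\<integral>\<^sup>+\<eta>. meeting_cost (1 + \<epsilon> / 2) y (\<eta> 1) \<partial>P x) = cost x y"
    unfolding step_cost_eq by (rule nn_integral_chain_first_step [OF law_P])
  finally show ?thesis by (simp add: x_def y_def)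
qed

definition total_cost :: real where
  "total_cost = enn2real (\<Sum>\<^sub>\<infinity>(x, y). ennreal (nu x * K x y) * cost x y ^ (2 * p))"

lemma ennreal_total_cost:
  "ennreal total_cost = (\<Sum>\<^sub>\<infinity>(x, y). ennreal (nu x * K x y) * cost x y ^ (2 * p))"
  unfolding total_cost_def using cost_finite by (simp add: less_top)

lemma nn_integral_cost: "(\<integral>\<^sup>+\<omega>. cost (\<omega> (i - 1)) (\<omega> i) ^ (2 * p) \<partial>M) = ennreal total_cost"
  unfolding ennreal_total_cost infsum_eq_nn_integral_count_space
  by (rule nn_integral_stationary_pair [OF law_M])

lemma increment_le:
  "AE \<omega> in M. ennreal \<bar>increment i \<omega>\<bar> \<le> ennreal (sqrt (osc i)) * cost (\<omega> (i - 1)) (\<omega> i)"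
proof -
  interpret D: disintegration M "\<lambda>\<omega>. \<omega> (i - 1)" P "graft (i - 1)" path_space by (rule disint_M)
  have pos: "AE \<omega> in M. K (\<omega> (i - 1)) (\<omega> i) > 0"
    by (rule AE_M_pair) (use K_nonneg in \<open>metis less_eq_real_def mult_zero_right\<close>)
  have "cost x y < \<infinity>" if "nu x * K x y > 0" for x y
  proof -
    have "ennreal (nu x * K x y) * cost x y ^ (2 * p) \<le> ennreal total_cost"
      unfolding ennreal_total_cost infsum_eq_nn_integral_count_space
      using nn_integral_ge_point [of "(x, y)" UNIV "\<lambda>(x, y). ennreal (nu x * K x y) * cost x y ^ (2 * p)"] by simp
    then have "ennreal (nu x * K x y) * cost x y ^ (2 * p) < \<infinity>" by (rule le_less_trans) simp
    then show ?thesis using that p by (auto simp: ennreal_mult_less_top power_less_top_ennreal)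
  qed
  then have "AE \<omega> in M. cost (\<omega> (i - 1)) (\<omega> i) < \<infinity>" by (rule AE_M_pair)
  with pos D.AE_integrable_disint [OF f_integrable] show ?thesis
    by eventually_elim (rule increment_le_pointwise)
qed

lemma measurable_increment [measurable]: "increment i \<in> borel_measurable M"
  unfolding increment_def [abs_def] using measurable_past_exp [OF f_measurable] by measurable

lemma nn_integral_increment_power:
  "(\<integral>\<^sup>+\<omega>. ennreal (increment i \<omega> ^ (2 * p)) \<partial>M) \<le> ennreal (osc i ^ p * total_cost)"
proof -
  have [measurable]: "(\<lambda>\<omega>. cost (\<omega> (i - 1)) (\<omega> i)) \<in> borel_measurable M"
    by (rule measurable_compose_countable [of "\<lambda>x \<omega>. cost x (\<omega> i)"]) (auto intro: measurable_compose [where f = "\<lambda>\<omega>. \<omega> i"])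
  have "(\<integral>\<^sup>+\<omega>. ennreal (increment i \<omega> ^ (2 * p)) \<partial>M) \<le>
      (\<integral>\<^sup>+\<omega>. ennreal (sqrt (osc i)) ^ (2 * p) * cost (\<omega> (i - 1)) (\<omega> i) ^ (2 * p) \<partial>M)"
  proof (rule nn_integral_mono_AE)
    show "AE \<omega> in M. ennreal (increment i \<omega> ^ (2 * p)) \<le> ennreal (sqrt (osc i)) ^ (2 * p) * cost (\<omega> (i - 1)) (\<omega> i) ^ (2 * p)"
      using increment_le [of i]
    proof eventually_elim
      case (elim \<omega>)
      have "ennreal (increment i \<omega> ^ (2 * p)) = ennreal \<bar>increment i \<omega>\<bar> ^ (2 * p)"
        by (simp add: ennreal_power power_even_abs)
      also have "\<dots> \<le> (ennreal (sqrt (osc i)) * cost (\<omega> (i - 1)) (\<omega> i)) ^ (2 * p)"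
        using elim by (rule power_mono) simp
      finally show ?case by (simp add: power_mult_distrib)
    qed
  qed
  also have "\<dots> = ennreal (sqrt (osc i)) ^ (2 * p) * ennreal total_cost"
    by (subst nn_integral_cmult) (simp_all add: nn_integral_cost)
  also have "ennreal (sqrt (osc i)) ^ (2 * p) = ennreal (osc i ^ p)"
    using weighted_osc_nonneg [of i] by (simp add: ennreal_power power_mult)
  finally show ?thesis
    using weighted_osc_nonneg [of i] by (simp add: ennreal_mult' total_cost_def)
qed

text \<open>The squared L^(2p) norm of the step cost, the common factor in the bounds on the squared
  norms of all increments.\<close>

definition cost_root :: real where "cost_root = root p total_cost"

lemma cost_root: "cost_root \<ge> 0" "cost_root ^ p = total_cost"
  using p by (simp_all add: cost_root_def total_cost_def)

lemma
  shows integrable_increment_power: "integrable M (\<lambda>\<omega>. increment i \<omega> ^ (2 * p))"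
    and integral_increment_power: "(\<integral>\<omega>. increment i \<omega> ^ (2 * p) \<partial>M) \<le> (osc i * cost_root) ^ p"
proof -
  have "(\<integral>\<^sup>+\<omega>. ennreal (norm (increment i \<omega> ^ (2 * p))) \<partial>M) < \<infinity>"
    using nn_integral_increment_power [of i] by (auto intro: le_less_trans)
  then show int: "integrable M (\<lambda>\<omega>. increment i \<omega> ^ (2 * p))"
    by (auto simp: integrable_iff_bounded)
  have "ennreal (\<integral>\<omega>. increment i \<omega> ^ (2 * p) \<partial>M) \<le> ennreal (osc i ^ p * total_cost)"
    using nn_integral_increment_power [of i] by (subst nn_integral_eq_integral [OF int, symmetric]) auto
  moreover have "osc i ^ p * total_cost \<ge> 0"
    using weighted_osc_nonneg by (simp add: total_cost_def)
  ultimately show "(\<integral>\<omega>. increment i \<omega> ^ (2 * p) \<partial>M) \<le> (osc i * cost_root) ^ p"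
    by (simp add: power_mult_distrib cost_root)
qed

text \<open>A function known at time i-1 is known at time \<open>i\<close> as well, so its integrals
  against g_i and against g_(i-1) both equal its integral against \<open>f\<close>.\<close>

lemma integral_past_mult_increment:
  assumes hf: "integrable M (\<lambda>\<omega>. h \<omega> * f \<omega>)" and h: "depends_on_past (i - 1) h"
  shows "(\<integral>\<omega>. h \<omega> * increment i \<omega> \<partial>M) = 0"
proof -
  have h': "depends_on_past i h" using h by (rule depends_on_past_mono) simp
  show ?thesis
    using integral_past_exp_mult [OF f_integrable hf h] integral_past_exp_mult [OF f_integrable hf h']
      integrable_past_exp_mult [OF f_integrable hf h] integrable_past_exp_mult [OF f_integrable hf h']
    by (simp add: increment_def right_diff_distrib)
qed

text \<open>Induction on the upper end, one increment at a time. Integrability of the 2p-th power is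
  carried along, since it comes from the bounds on the increments and not from a contraction
  property of conditional expectations.\<close>

lemma moment_past_exp_diff:
  assumes "n \<le> m"
  shows "integrable M (\<lambda>\<omega>. (past_exp f m \<omega> - past_exp f n \<omega>) ^ (2 * p)) \<and>
    (\<integral>\<omega>. (past_exp f m \<omega> - past_exp f n \<omega>) ^ (2 * p) \<partial>M) \<le>
      ((2 * real p - 1)\<^sup>2 * cost_root * (\<Sum>i\<in>{n<..m}. osc i)) ^ p"
  using assms
proof (induction m rule: int_ge_induct)
  case base
  show ?case using p by (simp add: power_0_left)
next
  case (step m)
  define X where "X \<omega> = past_exp f m \<omega> - past_exp f n \<omega>" for \<omega>
  define A where "A = (2 * real p - 1)\<^sup>2 * cost_root * (\<Sum>i\<in>{n<..m}. osc i)"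
  have [measurable]: "X \<in> borel_measurable M"
    unfolding X_def [abs_def] using measurable_past_exp [OF f_measurable] by measurable
  have X: "integrable M (\<lambda>\<omega>. X \<omega> ^ (2 * p))" "(\<integral>\<omega>. X \<omega> ^ (2 * p) \<partial>M) \<le> A ^ p"
    using step.IH by (simp_all add: X_def A_def)
  have A: "A \<ge> 0" unfolding A_def using cost_root weighted_osc_nonneg by (simp add: sum_nonneg)
  have past: "depends_on_past m (\<lambda>\<omega>. X \<omega> ^ (2 * p - 1))"
    unfolding depends_on_past_def
  proof (intro allI impI)
    fix \<omega> \<omega>' :: "int \<Rightarrow> 'e" assume "\<forall>k\<le>m. \<omega> k = \<omega>' k"
    then have "past_exp f m \<omega> = past_exp f m \<omega>'" "past_exp f n \<omega> = past_exp f n \<omega>'"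
      using \<open>n \<le> m\<close> by (auto intro!: depends_on_pastD [OF depends_on_past_past_exp])
    then show "X \<omega> ^ (2 * p - 1) = X \<omega>' ^ (2 * p - 1)" by (simp add: X_def)
  qed
  \<comment> \<open>The mixed product with a single factor \<open>f\<close>: this is what makes
    X^(2p-1) an admissible test function for orthogonality.\<close>
  have "integrable M (\<lambda>\<omega>. X \<omega> ^ (2 * p - 1) * f \<omega> ^ 1)"
    using p X(1) moment by (intro integrable_mixed_power) auto
  then have orth: "(\<integral>\<omega>. X \<omega> ^ (2 * p - 1) * increment (m + 1) \<omega> \<partial>M) = 0"
    using past by (intro integral_past_mult_increment) auto
  have osc_nonneg: "osc (m + 1) * cost_root \<ge> 0" using weighted_osc_nonneg cost_root by simp
  have "past_exp f (m + 1) \<omega> - past_exp f n \<omega> = X \<omega> + increment (m + 1) \<omega>" for \<omega>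
    by (simp add: X_def increment_def)
  moreover have "{n<..m + 1} = insert (m + 1) {n<..m}" using step.hyps by auto
  then have "A + (2 * real p - 1)\<^sup>2 * (osc (m + 1) * cost_root) =
      (2 * real p - 1)\<^sup>2 * cost_root * (\<Sum>i\<in>{n<..m + 1}. osc i)"
    by (simp add: A_def distrib_left mult_ac)
  ultimately show ?case
    using integrable_even_power_add [OF p _ _ X(1) integrable_increment_power]
      even_moment_add_le [OF p _ _ X(1) integrable_increment_power X(2) integral_increment_power A osc_nonneg orth]
    by simp
qed

end

subsection \<open>Limits along the filtration\<close>

text \<open>Along a subsequence the successive L^1 distances are at most 2^(-k), so the series of
  absolute differences has finite expectation and converges almost surely.\<close>

lemma L1_Cauchy_AE_convergent_subseq:
  fixes s :: "nat \<Rightarrow> 'w \<Rightarrow> real"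
  assumes int: "\<And>n. integrable M (s n)"
    and Cauchy: "\<And>e. e > 0 \<Longrightarrow> \<exists>N. \<forall>i\<ge>N. \<forall>j\<ge>N. (\<integral>x. \<bar>s i x - s j x\<bar> \<partial>M) < e"
  obtains r where "strict_mono r" "AE x in M. convergent (\<lambda>k. s (r k) x)"
proof -
  have [measurable]: "s n \<in> borel_measurable M" for n using int [of n] by simp
  obtain N where N: "\<And>k i j. i \<ge> N k \<Longrightarrow> j \<ge> N k \<Longrightarrow> (\<integral>x. \<bar>s i x - s j x\<bar> \<partial>M) < (1 / 2) ^ k"
    using Cauchy [of "(1 / 2) ^ k" for k] by (metis zero_less_divide_1_iff zero_less_numeral zero_less_power)
  \<comment> \<open>Partial sums of the successors make \<open>r\<close> strictly increasing while
    keeping it above every threshold \<open>N k\<close>.\<close>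
  define r where "r k = (\<Sum>j\<le>k. Suc (N j))" for k
  have r: "strict_mono r" by (rule strict_monoI_Suc) (simp add: r_def)
  have r_ge: "r k \<ge> N k" for k
    unfolding r_def by (rule order_trans [OF _ member_le_sum [of k]]) auto
  define d where "d k x = s (r (Suc k)) x - s (r k) x" for k x
  have "(\<integral>\<^sup>+x. (\<Sum>k. ennreal \<bar>d k x\<bar>) \<partial>M) = (\<Sum>k. \<integral>\<^sup>+x. ennreal \<bar>d k x\<bar> \<partial>M)"
    by (rule nn_integral_suminf) (simp add: d_def)
  also have "\<dots> \<le> (\<Sum>k. ennreal ((1 / 2) ^ k))"
  proof (rule suminf_le)
    fix k
    have "r (Suc k) \<ge> N k" using r_ge [of k] strict_monoD [OF r, of k "Suc k"] by simp
    then have "(\<integral>x. \<bar>d k x\<bar> \<partial>M) \<le> (1 / 2) ^ k"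
      using N [of k "r (Suc k)" "r k"] r_ge [of k] by (simp add: d_def less_imp_le)
    moreover have "(\<integral>\<^sup>+x. ennreal \<bar>d k x\<bar> \<partial>M) = ennreal (\<integral>x. \<bar>d k x\<bar> \<partial>M)"
      using int by (intro nn_integral_eq_integral) (auto simp: d_def)
    ultimately show "(\<integral>\<^sup>+x. ennreal \<bar>d k x\<bar> \<partial>M) \<le> ennreal ((1 / 2) ^ k)" by (simp add: ennreal_leI)
  qed auto
  also have "\<dots> = ennreal (\<Sum>k. (1 / 2) ^ k)"
    by (rule suminf_ennreal2) (auto intro: summable_geometric)
  also have "\<dots> < \<infinity>" by simp
  finally have "AE x in M. (\<Sum>k. ennreal \<bar>d k x\<bar>) \<noteq> \<infinity>"
    by (intro nn_integral_PInf_AE) (auto simp: d_def)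
  then have "AE x in M. convergent (\<lambda>k. s (r k) x)"
  proof eventually_elim
    case (elim x)
    then have "summable (\<lambda>k. \<bar>d k x\<bar>)" by (intro summable_suminf_not_top) auto
    then have "summable (\<lambda>k. d k x)" by (rule summable_rabs_cancel)
    then have "convergent (\<lambda>n. s (r 0) x + (\<Sum>k<n. d k x))"
      by (intro convergent_add convergent_const) (simp add: summable_iff_convergent)
    moreover have "s (r 0) x + (\<Sum>k<n. d k x) = s (r n) x" for n
      unfolding d_def by (subst sum_lessThan_telescope) simp
    ultimately show ?case by simp
  qed
  with r show thesis by (rule that)
qed

text \<open>The limit is the pointwise \<open>lim\<close> of the subsequence at every path, not
  merely some representative, so that it inherits invariance properties of the sequence exactly.
  Fatou along the subsequence upgrades almost sure convergence to L^1 convergence of the whole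
  sequence.\<close>

lemma L1_Cauchy_limit:
  fixes s :: "nat \<Rightarrow> 'w \<Rightarrow> real"
  assumes int: "\<And>n. integrable M (s n)"
    and Cauchy: "\<And>e. e > 0 \<Longrightarrow> \<exists>N. \<forall>i\<ge>N. \<forall>j\<ge>N. (\<integral>x. \<bar>s i x - s j x\<bar> \<partial>M) < e"
  obtains r where "strict_mono r"
    "AE x in M. (\<lambda>k. s (r k) x) \<longlonglongrightarrow> lim (\<lambda>k. s (r k) x)"
    "integrable M (\<lambda>x. lim (\<lambda>k. s (r k) x))"
    "(\<lambda>n. \<integral>x. \<bar>s n x - lim (\<lambda>k. s (r k) x)\<bar> \<partial>M) \<longlonglongrightarrow> 0"
proof -
  have [measurable]: "s n \<in> borel_measurable M" for n using int [of n] by simp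
  obtain r where r: "strict_mono r" and conv: "AE x in M. convergent (\<lambda>i. s (r i) x)"
    using L1_Cauchy_AE_convergent_subseq [OF int Cauchy] by blast
  define L where "L x = lim (\<lambda>k. s (r k) x)" for x
  have lim: "AE x in M. (\<lambda>k. s (r k) x) \<longlonglongrightarrow> L x"
    using conv unfolding L_def by eventually_elim (simp add: convergent_LIMSEQ_iff)
  have [measurable]: "L \<in> borel_measurable M"
    unfolding L_def [abs_def] by (rule borel_measurable_lim_metric) measurable
  have approx: "\<exists>N. \<forall>n\<ge>N. (\<integral>\<^sup>+x. ennreal \<bar>s n x - L x\<bar> \<partial>M) \<le> ennreal e" if e: "e > 0" for e
  proof -
    obtain N where N: "\<And>i j. i \<ge> N \<Longrightarrow> j \<ge> N \<Longrightarrow> (\<integral>x. \<bar>s i x - s j x\<bar> \<partial>M) < e"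
      using Cauchy [OF e] by blast
    have "(\<integral>\<^sup>+x. ennreal \<bar>s n x - L x\<bar> \<partial>M) \<le> ennreal e" if n: "n \<ge> N" for n
    proof -
      have "(\<integral>\<^sup>+x. ennreal \<bar>s n x - L x\<bar> \<partial>M) = (\<integral>\<^sup>+x. liminf (\<lambda>k. ennreal \<bar>s n x - s (r k) x\<bar>) \<partial>M)"
      proof (rule nn_integral_cong_AE)
        show "AE x in M. ennreal \<bar>s n x - L x\<bar> = liminf (\<lambda>k. ennreal \<bar>s n x - s (r k) x\<bar>)"
          using lim
        proof eventually_elim
          case (elim x)
          then have "(\<lambda>k. ennreal \<bar>s n x - s (r k) x\<bar>) \<longlonglongrightarrow> ennreal \<bar>s n x - L x\<bar>"
            by (intro tendsto_ennrealI tendsto_intros)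
          then show ?case by (rule lim_imp_Liminf [OF trivial_limit_sequentially, symmetric])
        qed
      qed
      also have "\<dots> \<le> liminf (\<lambda>k. \<integral>\<^sup>+x. ennreal \<bar>s n x - s (r k) x\<bar> \<partial>M)"
        by (rule nn_integral_liminf) measurable
      also have "\<dots> \<le> ennreal e"
      proof (rule Liminf_le)
        have "(\<integral>\<^sup>+x. ennreal \<bar>s n x - s (r k) x\<bar> \<partial>M) \<le> ennreal e" if "k \<ge> N" for k
        proof -
          have "r k \<ge> N" using that strict_mono_imp_increasing [OF r, of k] by simp
          then have "(\<integral>x. \<bar>s n x - s (r k) x\<bar> \<partial>M) \<le> e" using N [OF n] by (simp add: less_imp_le)
          moreover have "(\<integral>\<^sup>+x. ennreal \<bar>s n x - s (r k) x\<bar> \<partial>M) = ennreal (\<integral>x. \<bar>s n x - s (r k) x\<bar> \<partial>M)"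
            using int by (intro nn_integral_eq_integral) auto
          ultimately show ?thesis by (simp add: ennreal_leI)
        qed
        then show "\<forall>\<^sub>F k in sequentially. (\<integral>\<^sup>+x. ennreal \<bar>s n x - s (r k) x\<bar> \<partial>M) \<le> ennreal e"
          by (auto simp: eventually_sequentially)
      qed simp
      finally show ?thesis .
    qed
    then show ?thesis by blast
  qed
  have int_L: "integrable M L"
  proof -
    obtain N where "(\<integral>\<^sup>+x. ennreal \<bar>s N x - L x\<bar> \<partial>M) \<le> ennreal 1"
      using approx [of 1] by auto
    then have "(\<integral>\<^sup>+x. ennreal \<bar>s N x - L x\<bar> \<partial>M) < \<infinity>" by (rule le_less_trans) simp
    then have "integrable M (\<lambda>x. s N x - L x)" by (simp add: integrable_iff_bounded)
    from Bochner_Integration.integrable_diff [OF int [of N] this] show ?thesis by simp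
  qed
  have "(\<lambda>n. \<integral>x. \<bar>s n x - L x\<bar> \<partial>M) \<longlonglongrightarrow> 0"
  proof (rule LIMSEQ_I)
    fix e :: real assume e: "e > 0"
    then obtain N where N: "\<And>n. n \<ge> N \<Longrightarrow> (\<integral>\<^sup>+x. ennreal \<bar>s n x - L x\<bar> \<partial>M) \<le> ennreal (e / 2)"
      using approx [of "e / 2"] by auto
    have "norm ((\<integral>x. \<bar>s n x - L x\<bar> \<partial>M) - 0) < e" if "n \<ge> N" for n
    proof -
      have "ennreal (\<integral>x. \<bar>s n x - L x\<bar> \<partial>M) \<le> ennreal (e / 2)"
        using N [OF that] int int_L by (subst nn_integral_eq_integral [symmetric]) auto
      then have "(\<integral>x. \<bar>s n x - L x\<bar> \<partial>M) \<le> e / 2" using e by (simp add: ennreal_le_iff)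
      moreover have "(\<integral>x. \<bar>s n x - L x\<bar> \<partial>M) \<ge> 0" by simp
      ultimately show ?thesis using e by simp
    qed
    then show "\<exists>N. \<forall>n\<ge>N. norm ((\<integral>x. \<bar>s n x - L x\<bar> \<partial>M) - 0) < e" by blast
  qed
  then show thesis using r lim int_L by (intro that [of r]) (simp_all add: L_def [abs_def])
qed

lemma L1_limit_set_integral:
  fixes s :: "nat \<Rightarrow> 'w \<Rightarrow> real"
  assumes int: "\<And>n. integrable M (s n)" "integrable M L" and [measurable]: "A \<in> sets M"
    and lim: "(\<lambda>n. \<integral>x. \<bar>s n x - L x\<bar> \<partial>M) \<longlonglongrightarrow> 0"
  shows "(\<lambda>n. \<integral>x. indicator A x * s n x \<partial>M) \<longlonglongrightarrow> (\<integral>x. indicator A x * L x \<partial>M)"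
proof (rule LIM_zero_cancel, rule Lim_null_comparison [OF _ lim], rule always_eventually, rule allI)
  fix n
  have i: "integrable M (\<lambda>x. indicator A x * s n x)" "integrable M (\<lambda>x. indicator A x * L x)"
    using int integrable_mult_indicator [of A M "s n"] integrable_mult_indicator [of A M L] by simp_all
  have "norm ((\<integral>x. indicator A x * s n x \<partial>M) - (\<integral>x. indicator A x * L x \<partial>M)) =
      norm (\<integral>x. indicator A x * s n x - indicator A x * L x \<partial>M)"
    using i by simp
  also have "\<dots> \<le> (\<integral>x. norm (indicator A x * s n x - indicator A x * L x) \<partial>M)"
    by (rule integral_norm_bound)
  also have "\<dots> \<le> (\<integral>x. \<bar>s n x - L x\<bar> \<partial>M)"
    using i int by (intro integral_mono) (auto simp: indicator_def)
  finally show "norm ((\<integral>x. indicator A x * s n x \<partial>M) - (\<integral>x. indicator A x * L x \<partial>M)) \<le> (\<integral>x. \<bar>s n x - L x\<bar> \<partial>M)" .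
qed

text \<open>The measures with densities the positive and the negative part of \<open>W\<close> agree
  on cylinders, hence everywhere, and a density is unique almost everywhere.\<close>

lemma AE_zero_if_cylinder_integrals_zero:
  fixes M :: "('i::countable \<Rightarrow> 'a::countable) measure" and J :: "nat \<Rightarrow> 'i set"
  assumes J: "incseq J" "(\<Union>n. J n) = UNIV" "\<And>n. finite (J n)"
    and "prob_space M" and sets_M [measurable_cong]: "sets M = sets path_space"
    and W: "integrable M (W :: _ \<Rightarrow> real)"
    and zero: "\<And>n x. (\<integral>\<omega>. indicator (cylinder (J n) x) \<omega> * W \<omega> \<partial>M) = 0"
  shows "AE \<omega> in M. W \<omega> = 0"
proof -
  interpret prob_space M by fact
  have [measurable]: "W \<in> borel_measurable M" using W by simp
  have dens: "emeasure (density M (\<lambda>\<omega>. ennreal (V \<omega>))) A = ennreal (\<integral>\<omega>. indicator A \<omega> * max 0 (V \<omega>) \<partial>M)"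
    if V: "integrable M (V :: _ \<Rightarrow> real)" and A [measurable]: "A \<in> sets M" for V A
  proof -
    have [measurable]: "V \<in> borel_measurable M" using V by simp
    have "emeasure (density M (\<lambda>\<omega>. ennreal (V \<omega>))) A = (\<integral>\<^sup>+\<omega>. ennreal (indicator A \<omega> * max 0 (V \<omega>)) \<partial>M)"
      by (subst emeasure_density) (auto intro!: nn_integral_cong split: split_indicator simp: max_def ennreal_neg)
    also have "\<dots> = ennreal (\<integral>\<omega>. indicator A \<omega> * max 0 (V \<omega>) \<partial>M)"
      using V integrable_mult_indicator [OF A, of "\<lambda>\<omega>. max 0 (V \<omega>)"] by (intro nn_integral_eq_integral) auto
    finally show ?thesis .
  qed
  \<comment> \<open>\<open>ennreal\<close> sends negative numbers to 0, so these two densities are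
    the positive and the negative part of \<open>W\<close>.\<close>
  have "density M (\<lambda>\<omega>. ennreal (W \<omega>)) = density M (\<lambda>\<omega>. ennreal (- W \<omega>))"
  proof (rule path_space_measure_eqI [OF J])
    show "finite_measure (density M (\<lambda>\<omega>. ennreal (W \<omega>)))"
      by (rule finite_measureI) (use dens [OF W, of "space M"] in simp)
    fix n x
    have C: "cylinder (J n) x \<in> sets M" by measurable
    have W': "integrable M (\<lambda>\<omega>. - W \<omega>)" using W by simp
    have "(\<integral>\<omega>. indicator (cylinder (J n) x) \<omega> * max 0 (W \<omega>) \<partial>M) - (\<integral>\<omega>. indicator (cylinder (J n) x) \<omega> * max 0 (- W \<omega>) \<partial>M)
        = (\<integral>\<omega>. indicator (cylinder (J n) x) \<omega> * max 0 (W \<omega>) - indicator (cylinder (J n) x) \<omega> * max 0 (- W \<omega>) \<partial>M)"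
      using W integrable_mult_indicator [OF C, of "\<lambda>\<omega>. max 0 (W \<omega>)"]
        integrable_mult_indicator [OF C, of "\<lambda>\<omega>. max 0 (- W \<omega>)"]
      by (intro Bochner_Integration.integral_diff [symmetric]) auto
    also have "\<dots> = (\<integral>\<omega>. indicator (cylinder (J n) x) \<omega> * W \<omega> \<partial>M)"
      by (intro Bochner_Integration.integral_cong) (auto simp: max_def)
    finally show "emeasure (density M (\<lambda>\<omega>. ennreal (W \<omega>))) (cylinder (J n) x) =
        emeasure (density M (\<lambda>\<omega>. ennreal (- W \<omega>))) (cylinder (J n) x)"
      using dens [OF W C] dens [OF W' C] zero by simp
  qed (simp_all add: sets_M)
  then have "AE \<omega> in M. ennreal (W \<omega>) = ennreal (- W \<omega>)"
    by (intro density_unique) auto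
  then show ?thesis
  proof eventually_elim
    case (elim \<omega>)
    then show ?case by (cases "W \<omega> \<ge> 0") (simp_all add: ennreal_neg)
  qed
qed

text \<open>Every event defined by \<open>h\<close> is a tail event. With c the mean, the events
  that h is below c or above c have probability 0 or 1, and probability 1 for either would
  contradict that c is the mean.\<close>

lemma AE_const_if_tail_dependent:
  fixes M :: "(int \<Rightarrow> 'a::countable) measure"
  assumes "prob_space M" and sets_M [measurable_cong]: "sets M = sets path_space" and tail: "tail_trivial M"
    and h: "integrable M (h :: _ \<Rightarrow> real)"
    and dep: "\<And>n \<omega> \<omega>'. (\<And>k. \<bar>k\<bar> \<ge> int n \<Longrightarrow> \<omega> k = \<omega>' k) \<Longrightarrow> h \<omega> = h \<omega>'"
  shows "AE \<omega> in M. h \<omega> = (\<integral>\<omega>. h \<omega> \<partial>M)"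
proof -
  interpret prob_space M by fact
  have sp: "space M = UNIV" using sets_M by (rule sets_path_space_imp_space)
  have [measurable]: "h \<in> borel_measurable M" using h by simp
  have mem: "h -` B \<in> two_sided_tail UNIV" if B: "B \<in> sets borel" for B
    unfolding two_sided_tail_def
  proof (rule INT_I)
    fix n
    let ?G = "{(\<lambda>\<omega>. \<omega> k) -` A \<inter> UNIV |k A. int n \<le> \<bar>k\<bar>} :: (int \<Rightarrow> 'a) set set"
    define c :: "int \<Rightarrow> 'a" where "c = (\<lambda>_. undefined)"
    \<comment> \<open>\<open>r\<close> overwrites the window of radius n by a fixed state. Composing
      with \<open>r\<close> leaves \<open>h\<close> unchanged by \<open>dep\<close> and exhibits it
      as a function of the coordinates outside the window.\<close>
    define r where "r \<omega> k = (if \<bar>k\<bar> \<ge> int n then \<omega> k else c k)" for \<omega> :: "int \<Rightarrow> 'a" and k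
    have "r \<in> measurable (sigma UNIV ?G) path_space"
    proof (rule measurable_path_spaceI)
      fix k
      show "(\<lambda>\<omega>. r \<omega> k) \<in> measurable (sigma UNIV ?G) (count_space UNIV)"
      proof (cases "\<bar>k\<bar> \<ge> int n")
        case True
        have "(\<lambda>\<omega>. \<omega> k) -` A \<in> sigma_sets UNIV ?G" for A
          using True by (intro sigma_sets.Basic) blast
        then show ?thesis
          using True by (simp add: r_def measurable_def space_measure_of_conv sets_measure_of_conv)
      qed (simp add: r_def)
    qed
    moreover have "h \<in> borel_measurable path_space"
      using measurable_cong_sets [OF sets_M refl] \<open>h \<in> borel_measurable M\<close> by blast
    ultimately have "(\<lambda>\<omega>. h (r \<omega>)) \<in> borel_measurable (sigma UNIV ?G)" by (rule measurable_compose)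
    moreover have "h (r \<omega>) = h \<omega>" for \<omega> by (rule dep [of n]) (simp add: r_def)
    ultimately have "h \<in> borel_measurable (sigma UNIV ?G)" by simp
    from measurable_sets [OF this B] show "h -` B \<in> sigma_sets UNIV ?G"
      by (simp add: space_measure_of_conv sets_measure_of_conv)
  qed
  define c where "c = (\<integral>\<omega>. h \<omega> \<partial>M)"
  have triv: "prob (h -` B) = 0 \<or> prob (h -` B) = 1" if "B \<in> sets borel" for B
    using tail mem [OF that] by (simp add: tail_trivial_def sp)
  have "AE \<omega> in M. h \<omega> \<ge> c"
  proof -
    have ev: "h -` {..<c} \<in> events" using measurable_sets [of h M borel "{..<c}"] by (simp add: sp)
    have "prob (h -` {..<c}) \<noteq> 1"
    proof
      assume "prob (h -` {..<c}) = 1"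
      then have "AE \<omega> in M. h \<omega> < c" using prob_eq_1 [OF ev] by simp
      then have "(\<integral>\<omega>. h \<omega> \<partial>M) < (\<integral>\<omega>. c \<partial>M)"
        using h by (intro integral_less_AE_space) (auto simp: emeasure_space_1)
      then show False by (simp add: c_def prob_space)
    qed
    then have "prob (h -` {..<c}) = 0" using triv [of "{..<c}"] by simp
    then have "AE \<omega> in M. \<omega> \<notin> h -` {..<c}" using prob_eq_0 [OF ev] by simp
    then show ?thesis by eventually_elim simp
  qed
  moreover have "AE \<omega> in M. h \<omega> \<le> c"
  proof -
    have ev: "h -` {c<..} \<in> events" using measurable_sets [of h M borel "{c<..}"] by (simp add: sp)
    have "prob (h -` {c<..}) \<noteq> 1"
    proof
      assume "prob (h -` {c<..}) = 1"
      then have "AE \<omega> in M. c < h \<omega>" using prob_eq_1 [OF ev] by simp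
      then have "(\<integral>\<omega>. c \<partial>M) < (\<integral>\<omega>. h \<omega> \<partial>M)"
        using h by (intro integral_less_AE_space) (auto simp: emeasure_space_1)
      then show False by (simp add: c_def prob_space)
    qed
    then have "prob (h -` {c<..}) = 0" using triv [of "{c<..}"] by simp
    then have "AE \<omega> in M. \<omega> \<notin> h -` {c<..}" using prob_eq_0 [OF ev] by simp
    then show ?thesis by eventually_elim simp
  qed
  ultimately show ?thesis unfolding c_def [symmetric] by eventually_elim simp
qed

text \<open>Integrates the pointwise bound of |z| by s + z^(2p) / s^(2p-1), trivial for |z| \<le> s.
  The factor 2 is harmless, as only Cauchy estimates are drawn from it.\<close>

lemma (in prob_space) L1_le_of_even_moment:
  fixes Z :: "'a \<Rightarrow> real"
  assumes p: "p \<ge> 1" and Z: "integrable M Z" "integrable M (\<lambda>x. Z x ^ (2 * p))" "(\<integral>x. Z x ^ (2 * p) \<partial>M) \<le> B ^ p"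
    and B: "0 \<le> B" "B \<le> s\<^sup>2" "s > 0"
  shows "(\<integral>x. \<bar>Z x\<bar> \<partial>M) \<le> 2 * s"
proof -
  have pt: "\<bar>z\<bar> \<le> s + z ^ (2 * p) / s ^ (2 * p - 1)" for z
  proof (cases "\<bar>z\<bar> \<le> s")
    case False
    then have "1 \<le> (\<bar>z\<bar> / s) ^ (2 * p - 1)" using B by (intro one_le_power) simp
    then have "\<bar>z\<bar> * 1 \<le> \<bar>z\<bar> * (\<bar>z\<bar> / s) ^ (2 * p - 1)" by (intro mult_left_mono) auto
    also have "\<dots> = \<bar>z\<bar> ^ Suc (2 * p - 1) / s ^ (2 * p - 1)" by (simp add: power_divide)
    also have "Suc (2 * p - 1) = 2 * p" using p by simp
    finally show ?thesis using B by (simp add: power_even_abs)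
  qed (use B in \<open>simp add: add_increasing2\<close>)
  have "(\<integral>x. \<bar>Z x\<bar> \<partial>M) \<le> (\<integral>x. s + Z x ^ (2 * p) / s ^ (2 * p - 1) \<partial>M)"
    using Z pt by (intro integral_mono) auto
  also have "\<dots> = s + (\<integral>x. Z x ^ (2 * p) \<partial>M) / s ^ (2 * p - 1)"
    using Z by (simp add: prob_space)
  also have "\<dots> \<le> s + s ^ (2 * p) / s ^ (2 * p - 1)"
  proof -
    have "(\<integral>x. Z x ^ (2 * p) \<partial>M) \<le> s ^ (2 * p)"
      using Z(3) power_mono [OF B(2,1), of p] by (simp add: power_mult)
    then show ?thesis using B by (simp add: divide_right_mono)
  qed
  also have "s ^ (2 * p) / s ^ (2 * p - 1) = s"
  proof -
    have "s ^ (2 * p) = s * s ^ (2 * p - 1)" using p by (metis mult_is_0 not_one_le_zero power_eq_if zero_neq_numeral)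
    then show ?thesis using B by simp
  qed
  finally show ?thesis by simp
qed

subsection \<open>The moment bound\<close>

context coupled_chain_lip
begin

lemma measurable_past_exp_f [measurable]: "past_exp f i \<in> borel_measurable M"
  by (rule measurable_past_exp [OF f_measurable])

lemma integrable_past_exp_f: "integrable M (past_exp f i)"
  by (rule integrable_past_exp [OF f_integrable])

lemma expectation_past_exp: "(\<integral>\<omega>. past_exp f i \<omega> \<partial>M) = (\<integral>\<omega>. f \<omega> \<partial>M)"
  using integral_past_exp_mult [of f "\<lambda>_. 1" i] f_integrable by (simp add: depends_on_past_def)

lemma L1_past_exp_diff:
  assumes "n \<le> m" and s: "s > 0" and le: "(2 * real p - 1)\<^sup>2 * cost_root * (\<Sum>i\<in>{n<..m}. osc i) \<le> s\<^sup>2"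
  shows "(\<integral>\<omega>. \<bar>past_exp f m \<omega> - past_exp f n \<omega>\<bar> \<partial>M) \<le> 2 * s"
proof -
  note mom = moment_past_exp_diff [OF \<open>n \<le> m\<close>]
  have "0 \<le> (2 * real p - 1)\<^sup>2 * cost_root * (\<Sum>i\<in>{n<..m}. osc i)"
    using cost_root(1) weighted_osc_nonneg by (simp add: sum_nonneg)
  then show ?thesis
    by (intro L1_le_of_even_moment [OF p _ conjunct1 [OF mom] conjunct2 [OF mom] _ le s])
       (simp_all add: integrable_past_exp_f)
qed

lemma osc_tail:
  assumes A: "incseq A" "\<And>n. finite (A n)" and e: "e > 0"
  shows "\<exists>N. \<forall>n\<ge>N. \<forall>m\<ge>n. (\<Sum>i\<in>A m - A n. osc i) < e"
proof -
  define a where "a n = (\<Sum>i\<in>A n. osc i)" for n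
  have "incseq a"
    unfolding a_def using A weighted_osc_nonneg by (intro monoI sum_mono2) (auto dest: incseqD)
  moreover have "a n \<le> zeta_real (1 + \<epsilon>) / 2 * D" for n
    unfolding a_def by (rule sum_weighted_osc_le [OF A(2)])
  ultimately have "convergent a"
    using incseq_convergent [of a] by (metis convergentI)
  then have "Cauchy a" by (rule convergent_Cauchy)
  then obtain N where N: "\<And>m n. m \<ge> N \<Longrightarrow> n \<ge> N \<Longrightarrow> norm (a m - a n) < e"
    using e by (meson CauchyD)
  have "(\<Sum>i\<in>A m - A n. osc i) < e" if "n \<ge> N" "m \<ge> n" for n m
  proof -
    have "(\<Sum>i\<in>A m - A n. osc i) = a m - a n"
      unfolding a_def using A that by (intro sum_diff) (auto dest: incseqD)
    also have "\<dots> < e" using N [of m n] that by simp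
    finally show ?thesis .
  qed
  then show ?thesis by blast
qed

text \<open>Serves both directions of time: \<open>\<sigma> n\<close> is the n-th time, and the sets
  \<open>A n\<close> grow so that the increments between two times are indexed by a difference of
  them.\<close>

lemma past_exp_Cauchy:
  fixes \<sigma> :: "nat \<Rightarrow> int"
  assumes A: "incseq A" "\<And>n. finite (A n)" and e: "e > 0"
    and \<sigma>: "\<And>n m. n \<le> m \<Longrightarrow> {min (\<sigma> n) (\<sigma> m)<..max (\<sigma> n) (\<sigma> m)} = A m - A n"
  shows "\<exists>N. \<forall>i\<ge>N. \<forall>j\<ge>N. (\<integral>\<omega>. \<bar>past_exp f (\<sigma> i) \<omega> - past_exp f (\<sigma> j) \<omega>\<bar> \<partial>M) < e"
proof -
  define c where "c = (2 * real p - 1)\<^sup>2 * cost_root"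
  have c: "c \<ge> 0" by (simp add: c_def cost_root)
  \<comment> \<open>The L^1 estimate returns 2s, and s = e/4 leaves room for strictness; c+1 is used
    as a divisor because c may be 0.\<close>
  obtain N where N: "\<And>n m. n \<ge> N \<Longrightarrow> m \<ge> n \<Longrightarrow> (\<Sum>i\<in>A m - A n. osc i) < (e / 4)\<^sup>2 / (c + 1)"
    using osc_tail [OF A, of "(e / 4)\<^sup>2 / (c + 1)"] e c by auto
  have *: "(\<integral>\<omega>. \<bar>past_exp f (\<sigma> i) \<omega> - past_exp f (\<sigma> j) \<omega>\<bar> \<partial>M) < e" if "i \<ge> N" "j \<ge> i" for i j
  proof -
    have "c * (\<Sum>k\<in>{min (\<sigma> i) (\<sigma> j)<..max (\<sigma> i) (\<sigma> j)}. osc k) \<le> c * ((e / 4)\<^sup>2 / (c + 1))"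
      unfolding \<sigma> [OF that(2)] using N [OF that] c by (intro mult_left_mono) auto
    also have "\<dots> = (e / 4)\<^sup>2 * (c / (c + 1))"
      by simp
    also have "\<dots> \<le> (e / 4)\<^sup>2 * 1"
      using c by (intro mult_left_mono) auto
    also have "\<dots> = (e / 4)\<^sup>2"
      by simp
    finally have "(\<integral>\<omega>. \<bar>past_exp f (max (\<sigma> i) (\<sigma> j)) \<omega> - past_exp f (min (\<sigma> i) (\<sigma> j)) \<omega>\<bar> \<partial>M) \<le> 2 * (e / 4)"
      using e unfolding c_def by (intro L1_past_exp_diff) auto
    moreover have "\<bar>past_exp f (max (\<sigma> i) (\<sigma> j)) \<omega> - past_exp f (min (\<sigma> i) (\<sigma> j)) \<omega>\<bar> =
        \<bar>past_exp f (\<sigma> i) \<omega> - past_exp f (\<sigma> j) \<omega>\<bar>" for \<omega>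
      by (auto simp: max_def min_def abs_minus_commute)
    ultimately show ?thesis using e by simp
  qed
  have "(\<integral>\<omega>. \<bar>past_exp f (\<sigma> i) \<omega> - past_exp f (\<sigma> j) \<omega>\<bar> \<partial>M) < e" if "i \<ge> N" "j \<ge> N" for i j
    using * [of i j] * [of j i] that by (cases "i \<le> j") (auto simp: abs_minus_commute)
  then show ?thesis by blast
qed

text \<open>The L^1 limit is identified on cylinders: over the window from -n to n the integral of
  g_m equals that of \<open>f\<close> as soon as m \<ge> n.\<close>

lemma future_limit:
  obtains r where "strict_mono r" "AE \<omega> in M. (\<lambda>k. past_exp f (int (r k)) \<omega>) \<longlonglongrightarrow> f \<omega>"
proof -
  have "\<exists>N. \<forall>i\<ge>N. \<forall>j\<ge>N. (\<integral>\<omega>. \<bar>past_exp f (int i) \<omega> - past_exp f (int j) \<omega>\<bar> \<partial>M) < e" if "e > 0" for e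
    by (rule past_exp_Cauchy [of "\<lambda>n. {0<..int n}"]) (use that in \<open>auto simp: incseq_def\<close>)
  from L1_Cauchy_limit [of M "\<lambda>n. past_exp f (int n)", OF integrable_past_exp_f this]
  obtain r where r: "strict_mono r"
    and AE_L: "AE \<omega> in M. (\<lambda>k. past_exp f (int (r k)) \<omega>) \<longlonglongrightarrow> lim (\<lambda>k. past_exp f (int (r k)) \<omega>)"
    and int_L: "integrable M (\<lambda>\<omega>. lim (\<lambda>k. past_exp f (int (r k)) \<omega>))"
    and L1: "(\<lambda>n. \<integral>\<omega>. \<bar>past_exp f (int n) \<omega> - lim (\<lambda>k. past_exp f (int (r k)) \<omega>)\<bar> \<partial>M) \<longlonglongrightarrow> 0"
    by blast
  define L where "L \<omega> = lim (\<lambda>k. past_exp f (int (r k)) \<omega>)" for \<omega>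
  have L: "integrable M L" "(\<lambda>n. \<integral>\<omega>. \<bar>past_exp f (int n) \<omega> - L \<omega>\<bar> \<partial>M) \<longlonglongrightarrow> 0"
    using int_L L1 by (simp_all add: L_def [abs_def])
  have "AE \<omega> in M. L \<omega> - f \<omega> = 0"
  proof (rule AE_zero_if_cylinder_integrals_zero [where J = "\<lambda>n. {- int n..int n}"])
    show "(\<Union>n. {- int n..int n}) = UNIV"
    proof (intro equalityI subsetI)
      fix k :: int
      have "k \<in> {- int (nat \<bar>k\<bar>)..int (nat \<bar>k\<bar>)}" by auto
      then show "k \<in> (\<Union>n. {- int n..int n})" by blast
    qed auto
    fix n and x :: "int \<Rightarrow> 'e"
    define C where "C = cylinder {- int n..int n} x"
    have C [measurable]: "C \<in> sets M" unfolding C_def by measurable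
    have int: "integrable M (\<lambda>\<omega>. indicator C \<omega> * L \<omega>)" "integrable M (\<lambda>\<omega>. indicator C \<omega> * f \<omega>)"
      using integrable_mult_indicator [OF C L(1)] integrable_mult_indicator [OF C f_integrable] by simp_all
    have eq: "(\<integral>\<omega>. indicator C \<omega> * past_exp f (int m) \<omega> \<partial>M) = (\<integral>\<omega>. indicator C \<omega> * f \<omega> \<partial>M)" if "n \<le> m" for m
    proof (rule integral_past_exp_mult [OF f_integrable int(2)])
      have "indicator C \<omega> = (indicator C \<omega>' :: real)" if "\<forall>k\<le>int m. \<omega> k = \<omega>' k" for \<omega> \<omega>'
        using that \<open>n \<le> m\<close> by (auto simp: C_def cylinder_def indicator_def)
      then show "depends_on_past (int m) (indicator C :: _ \<Rightarrow> real)" by (simp add: depends_on_past_def)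
    qed
    have "\<forall>\<^sub>F m in sequentially. (\<integral>\<omega>. indicator C \<omega> * past_exp f (int m) \<omega> \<partial>M) = (\<integral>\<omega>. indicator C \<omega> * f \<omega> \<partial>M)"
      using eventually_ge_at_top [of n] by (rule eventually_mono) (rule eq)
    then have "(\<lambda>m. \<integral>\<omega>. indicator C \<omega> * past_exp f (int m) \<omega> \<partial>M) \<longlonglongrightarrow> (\<integral>\<omega>. indicator C \<omega> * f \<omega> \<partial>M)"
      by (rule tendsto_eventually)
    with L1_limit_set_integral [of M "\<lambda>n. past_exp f (int n)", OF integrable_past_exp_f L(1) C L(2)]
    have "(\<integral>\<omega>. indicator C \<omega> * L \<omega> \<partial>M) = (\<integral>\<omega>. indicator C \<omega> * f \<omega> \<partial>M)"
      by (rule LIMSEQ_unique)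
    then show "(\<integral>\<omega>. indicator (cylinder {- int n..int n} x) \<omega> * (L \<omega> - f \<omega>) \<partial>M) = 0"
      using int by (simp add: right_diff_distrib C_def [symmetric])
  qed (use L f_integrable sets_M prob_space_axioms in \<open>auto simp: incseq_def\<close>)
  with AE_L have "AE \<omega> in M. (\<lambda>k. past_exp f (int (r k)) \<omega>) \<longlonglongrightarrow> f \<omega>"
    by eventually_elim (simp add: L_def)
  with r show thesis by (rule that)
qed

text \<open>For two paths that agree outside a finite window, the conditional expectations coincide
  from some index on, so the pointwise limit has the same value at both. Its mean is that of
  \<open>f\<close> by L^1 convergence.\<close>

lemma past_limit:
  assumes tail: "tail_trivial M"
  obtains r where "AE \<omega> in M. (\<lambda>k. past_exp f (- int (r k)) \<omega>) \<longlonglongrightarrow> (\<integral>\<omega>. f \<omega> \<partial>M)"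
proof -
  have "\<exists>N. \<forall>i\<ge>N. \<forall>j\<ge>N. (\<integral>\<omega>. \<bar>past_exp f (- int i) \<omega> - past_exp f (- int j) \<omega>\<bar> \<partial>M) < e" if "e > 0" for e
    by (rule past_exp_Cauchy [of "\<lambda>n. {- int n<..0}"]) (use that in \<open>auto simp: incseq_def\<close>)
  from L1_Cauchy_limit [of M "\<lambda>n. past_exp f (- int n)", OF integrable_past_exp_f this]
  obtain r where r: "strict_mono r"
    and AE_L: "AE \<omega> in M. (\<lambda>k. past_exp f (- int (r k)) \<omega>) \<longlonglongrightarrow> lim (\<lambda>k. past_exp f (- int (r k)) \<omega>)"
    and int_L: "integrable M (\<lambda>\<omega>. lim (\<lambda>k. past_exp f (- int (r k)) \<omega>))"
    and L1: "(\<lambda>n. \<integral>\<omega>. \<bar>past_exp f (- int n) \<omega> - lim (\<lambda>k. past_exp f (- int (r k)) \<omega>)\<bar> \<partial>M) \<longlonglongrightarrow> 0"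
    by blast
  define L where "L \<omega> = lim (\<lambda>k. past_exp f (- int (r k)) \<omega>)" for \<omega>
  have L: "integrable M L" "(\<lambda>n. \<integral>\<omega>. \<bar>past_exp f (- int n) \<omega> - L \<omega>\<bar> \<partial>M) \<longlonglongrightarrow> 0"
    using int_L L1 by (simp_all add: L_def [abs_def])
  have "AE \<omega> in M. L \<omega> = (\<integral>\<omega>. L \<omega> \<partial>M)"
  proof (rule AE_const_if_tail_dependent [OF prob_space_axioms sets_M tail L(1)])
    fix n and \<omega> \<omega>' :: "int \<Rightarrow> 'e" assume eq: "\<And>k. \<bar>k\<bar> \<ge> int n \<Longrightarrow> \<omega> k = \<omega>' k"
    have "past_exp f (- int (r k)) \<omega> = past_exp f (- int (r k)) \<omega>'" if "k \<ge> n" for k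
    proof (rule depends_on_pastD [OF depends_on_past_past_exp])
      fix l assume "l \<le> - int (r k)"
      then show "\<omega> l = \<omega>' l" using strict_mono_imp_increasing [OF r, of k] that by (intro eq) simp
    qed
    then have "\<forall>\<^sub>F k in sequentially. past_exp f (- int (r k)) \<omega> = past_exp f (- int (r k)) \<omega>'"
      by (auto simp: eventually_sequentially)
    \<comment> \<open>The two sequences have the same limits, whatever these are; hence
      \<open>lim\<close> agrees also at paths where the sequence diverges.\<close>
    then have "(\<lambda>k. past_exp f (- int (r k)) \<omega>) \<longlonglongrightarrow> l \<longleftrightarrow> (\<lambda>k. past_exp f (- int (r k)) \<omega>') \<longlonglongrightarrow> l" for l
      by (rule tendsto_cong)
    then show "L \<omega> = L \<omega>'" by (simp add: L_def lim_def)
  qed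
  moreover have "(\<integral>\<omega>. L \<omega> \<partial>M) = (\<integral>\<omega>. f \<omega> \<partial>M)"
  proof -
    have "(\<lambda>n. \<integral>\<omega>. past_exp f (- int n) \<omega> \<partial>M) \<longlonglongrightarrow> (\<integral>\<omega>. L \<omega> \<partial>M)"
      using L1_limit_set_integral [of M "\<lambda>n. past_exp f (- int n)", OF integrable_past_exp_f L(1) sets.top L(2)] by simp
    then show ?thesis by (simp add: expectation_past_exp LIMSEQ_const_iff)
  qed
  ultimately have "AE \<omega> in M. L \<omega> = (\<integral>\<omega>. f \<omega> \<partial>M)" by simp
  with AE_L have "AE \<omega> in M. (\<lambda>k. past_exp f (- int (r k)) \<omega>) \<longlonglongrightarrow> (\<integral>\<omega>. f \<omega> \<partial>M)"
    by eventually_elim (simp add: L_def)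
  then show thesis by (rule that)
qed

text \<open>Fatou for the differences of a late and an early conditional expectation; the sum of the
  a_i over any finite window obeys the same bound, so the moment estimate is uniform.\<close>

theorem central_moment_bound:
  assumes tail: "tail_trivial M"
  shows "(\<integral>\<^sup>+\<omega>. ennreal ((f \<omega> - (\<integral>\<omega>. f \<omega> \<partial>M)) ^ (2 * p)) \<partial>M) \<le>
    ennreal ((2 * real p - 1) ^ (2 * p) * (zeta_real (1 + \<epsilon>) / 2) ^ p * total_cost * D ^ p)"
proof -
  define B where "B = (2 * real p - 1)\<^sup>2 * cost_root * (zeta_real (1 + \<epsilon>) / 2 * D)"
  obtain r where r: "AE \<omega> in M. (\<lambda>k. past_exp f (int (r k)) \<omega>) \<longlonglongrightarrow> f \<omega>"
    using future_limit by blast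
  obtain r' where r': "AE \<omega> in M. (\<lambda>k. past_exp f (- int (r' k)) \<omega>) \<longlonglongrightarrow> (\<integral>\<omega>. f \<omega> \<partial>M)"
    using past_limit [OF tail] by blast
  define Z where "Z k \<omega> = past_exp f (int (r k)) \<omega> - past_exp f (- int (r' k)) \<omega>" for k \<omega>
  have [measurable]: "Z k \<in> borel_measurable M" for k
    unfolding Z_def [abs_def] by measurable
  have Z_le: "(\<integral>\<^sup>+\<omega>. ennreal (Z k \<omega> ^ (2 * p)) \<partial>M) \<le> ennreal (B ^ p)" for k
  proof -
    have le: "- int (r' k) \<le> int (r k)" by simp
    note mom = moment_past_exp_diff [OF le]
    have "(\<integral>\<^sup>+\<omega>. ennreal (Z k \<omega> ^ (2 * p)) \<partial>M) = ennreal (\<integral>\<omega>. Z k \<omega> ^ (2 * p) \<partial>M)"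
      using mom by (intro nn_integral_eq_integral) (simp_all add: Z_def)
    also have "\<dots> \<le> ennreal (((2 * real p - 1)\<^sup>2 * cost_root * (\<Sum>i\<in>{- int (r' k)<..int (r k)}. osc i)) ^ p)"
      using mom by (intro ennreal_leI) (simp add: Z_def)
    also have "\<dots> \<le> ennreal (B ^ p)"
      unfolding B_def using cost_root(1) weighted_osc_nonneg
      by (intro ennreal_leI power_mono mult_left_mono sum_weighted_osc_le) (auto simp: sum_nonneg)
    finally show ?thesis .
  qed
  have "(\<integral>\<^sup>+\<omega>. ennreal ((f \<omega> - (\<integral>\<omega>. f \<omega> \<partial>M)) ^ (2 * p)) \<partial>M) =
      (\<integral>\<^sup>+\<omega>. liminf (\<lambda>k. ennreal (Z k \<omega> ^ (2 * p))) \<partial>M)"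
  proof (rule nn_integral_cong_AE)
    show "AE \<omega> in M. ennreal ((f \<omega> - (\<integral>\<omega>. f \<omega> \<partial>M)) ^ (2 * p)) = liminf (\<lambda>k. ennreal (Z k \<omega> ^ (2 * p)))"
      using r r'
    proof eventually_elim
      case (elim \<omega>)
      then have "(\<lambda>k. ennreal (Z k \<omega> ^ (2 * p))) \<longlonglongrightarrow> ennreal ((f \<omega> - (\<integral>\<omega>. f \<omega> \<partial>M)) ^ (2 * p))"
        unfolding Z_def by (intro tendsto_ennrealI tendsto_intros)
      then show ?case by (rule lim_imp_Liminf [OF trivial_limit_sequentially, symmetric])
    qed
  qed
  also have "\<dots> \<le> liminf (\<lambda>k. \<integral>\<^sup>+\<omega>. ennreal (Z k \<omega> ^ (2 * p)) \<partial>M)"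
    by (rule nn_integral_liminf) measurable
  also have "\<dots> \<le> ennreal (B ^ p)"
    by (rule Liminf_le) (auto simp: Z_le)
  also have "B ^ p = (2 * real p - 1) ^ (2 * p) * (zeta_real (1 + \<epsilon>) / 2) ^ p * total_cost * D ^ p"
    by (simp add: B_def power_mult_distrib cost_root power_divide mult_ac flip: power_mult)
  finally show ?thesis .
qed

end

section \<open>Degenerate cases and the final statement\<close>

text \<open>Since T+1 \<ge> 1, every cost is at least 1. It guarantees that the constant is not 0,
  so that an infinite norm makes the bound infinite instead of 0 * infinity = 0.\<close>

lemma (in coupled_chain) one_le_sum_step_cost:
  assumes "a \<ge> 0"
  shows "1 \<le> (\<Sum>\<^sub>\<infinity>(x, y). ennreal (nu x * K x y) * step_cost a x y ^ n)"
proof -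
  have "1 \<le> meeting_cost a y z" for y z
  proof -
    interpret Pyz: prob_space "Ph y z" by (rule prob_space_Ph)
    have "1 \<le> time_pow t a" for t
      using assms by (auto simp: time_pow_def ge_one_powr_ge_zero split: enat.split)
    then have "(\<integral>\<^sup>+W. 1 \<partial>Ph y z) \<le> meeting_cost a y z"
      unfolding meeting_cost_def by (intro nn_integral_mono) simp
    then show ?thesis by (simp add: Pyz.emeasure_space_1)
  qed
  have "1 \<le> step_cost a x y" for x y
  proof -
    have "(K x has_sum 1) UNIV" using stoch by (simp add: stochastic_def)
    then have "1 = (\<integral>\<^sup>+z. ennreal (K x z) * 1 \<partial>count_space UNIV)"
      using has_sum_imp_nn_integral [of "K x" 1] by simp
    also have "\<dots> \<le> step_cost a x y"
      unfolding step_cost_eq using \<open>\<And>z y. 1 \<le> meeting_cost a y z\<close>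
      by (intro nn_integral_mono mult_left_mono) auto
    finally show ?thesis .
  qed
  then have "(\<integral>\<^sup>+\<omega>. 1 \<partial>M) \<le> (\<integral>\<^sup>+\<omega>. step_cost a (\<omega> (0 - 1)) (\<omega> 0) ^ n \<partial>M)"
    by (intro nn_integral_mono) (simp add: one_le_power)
  also have "\<dots> = (\<Sum>\<^sub>\<infinity>(x, y). ennreal (nu x * K x y) * step_cost a x y ^ n)"
    unfolding infsum_eq_nn_integral_count_space by (rule nn_integral_stationary_pair [OF law_M])
  finally show ?thesis using emeasure_space_1 by simp
qed

text \<open>Vanishing oscillations make \<open>f\<close> invariant under changes of finitely many
  coordinates, which need not make it constant; triviality of the tail does so almost
  surely.\<close>

lemma AE_const_if_delta_zero:
  fixes M :: "(int \<Rightarrow> 'a::countable) measure"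
  assumes "prob_space M" "sets M = sets path_space" "tail_trivial M" "integrable M f" and f: "lip M f"
    and zero: "\<And>i. delta f i = 0"
  shows "AE \<omega> in M. f \<omega> = (\<integral>\<omega>. f \<omega> \<partial>M)"
proof (rule AE_const_if_tail_dependent [OF assms(1-4)])
  fix n and \<omega> \<omega>' :: "int \<Rightarrow> 'a" assume eq: "\<And>k. \<bar>k\<bar> \<ge> int n \<Longrightarrow> \<omega> k = \<omega>' k"
  have "\<bar>f \<omega> - f \<omega>'\<bar> \<le> (\<Sum>i\<in>{- int n..int n}. delta f i)"
    by (rule diff_le_sum_delta [OF f]) (auto intro!: eq)
  then show "f \<omega> = f \<omega>'" by (simp add: zero)
qed

lemma sum_delta_le_delta_norm2:
  "finite I \<Longrightarrow> ennreal (\<Sum>i\<in>I. (delta f i)\<^sup>2) \<le> delta_norm2 f"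
proof -
  assume I: "finite I"
  have "ennreal (\<Sum>i\<in>I. (delta f i)\<^sup>2) = (\<integral>\<^sup>+i. ennreal ((delta f i)\<^sup>2) * indicator I i \<partial>count_space UNIV)"
    using I by (subst nn_integral_count_space' [of I]) (auto simp: sum_ennreal)
  also have "\<dots> \<le> delta_norm2 f"
    unfolding delta_norm2_def infsum_eq_nn_integral_count_space
    by (intro nn_integral_mono) (auto split: split_indicator)
  finally show ?thesis .
qed

lemma central_moment_le:
  fixes K :: "'e::countable \<Rightarrow> 'e \<Rightarrow> real"
  assumes chain: "coupled_chain K nu M Q Ph" and tail: "tail_trivial M"
    and p: "p \<ge> 1" and lip: "lip M f" and moment: "integrable M (\<lambda>\<omega>. f \<omega> ^ (2 * p))" and eps: "\<epsilon> > 0"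
  shows "(\<integral>\<^sup>+\<omega>. ennreal ((f \<omega> - (\<integral>\<omega>. f \<omega> \<partial>M)) ^ (2 * p)) \<partial>M) \<le> C_const K nu Ph p \<epsilon> * delta_norm2 f ^ p"
proof -
  interpret coupled_chain K nu M Q Ph by (rule chain)
  define S where "S = (\<Sum>\<^sub>\<infinity>(x, y). ennreal (nu x * K x y) * step_cost (1 + \<epsilon> / 2) x y ^ (2 * p))"
  define c where "c = (2 * real p - 1) ^ (2 * p) * (zeta_real (1 + \<epsilon>) / 2) ^ p"
  have C: "C_const K nu Ph p \<epsilon> = ennreal c * S"
    by (simp add: C_const_def S_def c_def step_cost_def meeting_cost_def)
  have c: "c > 0"
    using p zeta_real_pos [OF eps] by (simp add: c_def)
  have S: "S \<ge> 1"
    unfolding S_def using eps by (intro one_le_sum_step_cost) simp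
  consider "delta_norm2 f = 0" | "delta_norm2 f = \<infinity> \<or> S = \<infinity>" "delta_norm2 f \<noteq> 0"
    | "delta_norm2 f < \<infinity>" "S < \<infinity>"
    by (metis infinity_ennreal_def less_top)
  then show ?thesis
  proof cases
    case 1
    have zero: "delta f i = 0" for i
      using sum_delta_le_delta_norm2 [of "{i}" f] 1 by simp
    have [measurable]: "f \<in> borel_measurable M" using lip by (simp add: lip_def)
    have "integrable M f" using p _ moment by (rule integrable_if_even_moment) measurable
    then have "AE \<omega> in M. f \<omega> = (\<integral>\<omega>. f \<omega> \<partial>M)"
      using prob_space_axioms sets_M tail lip zero by (intro AE_const_if_delta_zero)
    then have "(\<integral>\<^sup>+\<omega>. ennreal ((f \<omega> - (\<integral>\<omega>. f \<omega> \<partial>M)) ^ (2 * p)) \<partial>M) = (\<integral>\<^sup>+\<omega>. 0 \<partial>M)"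
      using p by (intro nn_integral_cong_AE) (auto elim!: eventually_mono simp: power_0_left)
    then show ?thesis by simp
  next
    case 2
    \<comment> \<open>No factor is 0 here, so a single infinite one makes the whole bound
      infinite.\<close>
    have "ennreal c * S * delta_norm2 f ^ p = \<infinity>"
      using 2 c S p by (auto simp: ennreal_mult_eq_top_iff power_eq_top_ennreal)
    then show ?thesis by (simp add: C)
  next
    case 3
    define D where "D = enn2real (delta_norm2 f)"
    have norm_eq: "delta_norm2 f = ennreal D" using 3 by (simp add: D_def less_top)
    interpret coupled_chain_lip K nu M Q Ph f \<epsilon> D p
    proof unfold_locales
      show "(\<Sum>i\<in>I. (delta f i)\<^sup>2) \<le> D" if "finite I" for I
        using sum_delta_le_delta_norm2 [OF that, of f] unfolding norm_eq by (simp add: D_def ennreal_le_iff)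
      show "(\<Sum>\<^sub>\<infinity>(x, y). ennreal (nu x * K x y) * step_cost (1 + \<epsilon> / 2) x y ^ (2 * p)) < \<infinity>"
        using 3 by (simp add: S_def)
    qed (fact lip eps p moment)+
    have S_eq: "S = ennreal total_cost" by (simp add: S_def ennreal_total_cost)
    have nonneg: "D \<ge> 0" "total_cost \<ge> 0" by (simp_all add: D_def total_cost_def)
    have "ennreal (c * total_cost * D ^ p) = ennreal c * ennreal total_cost * ennreal D ^ p"
      using c nonneg by (simp add: ennreal_mult ennreal_power)
    then show ?thesis
      using central_moment_bound [OF tail] by (simp only: C norm_eq S_eq c_def)
  qed
qed

theorem mainTheorem4:
  fixes K :: "'e::countable \<Rightarrow> 'e \<Rightarrow> real"
    and nu :: "'e \<Rightarrow> real"
    and M :: "(int \<Rightarrow> 'e) measure"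
    and Q :: "'e \<times> 'e \<Rightarrow> 'e \<times> 'e \<Rightarrow> real"
    and Ph :: "'e \<Rightarrow> 'e \<Rightarrow> (nat \<Rightarrow> 'e \<times> 'e) measure"
    and f :: "(int \<Rightarrow> 'e) \<Rightarrow> real"
    and p :: nat
    and \<epsilon> :: real
  assumes "stochastic K" and "stationary_dist K nu" and "ergodic_chain K"
    and "stationary_chain_law K nu M" and "tail_trivial M"
    and "markovian_coupling K Q" and "\<And>y z. chain_law_from Q (y, z) (Ph y z)"
    and "p \<ge> 1"
    and "lip M f" and "integrable M (\<lambda>\<omega>. \<bar>f \<omega>\<bar> ^ (2 * p))"
    and "\<epsilon> > 0"
  shows "ennreal (\<integral>\<omega>. (f \<omega> - (\<integral>\<omega>'. f \<omega>' \<partial>M)) ^ (2 * p) \<partial>M)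
           \<le> C_const K nu Ph p \<epsilon> * delta_norm2 f ^ p
       \<and> (\<forall>t>0. ennreal (measure M {\<omega> \<in> space M. \<bar>f \<omega> - (\<integral>\<omega>'. f \<omega>' \<partial>M)\<bar> \<ge> t})
               \<le> C_const K nu Ph p \<epsilon> * delta_norm2 f ^ p / ennreal (t ^ (2 * p)))"


proof -
  have chain: "coupled_chain K nu M Q Ph"
    using assms(1,4,6,7) by (rule coupled_chain.intro)
  interpret coupled_chain K nu M Q Ph by (rule chain)
  define \<mu> where "\<mu> = (\<integral>\<omega>. f \<omega> \<partial>M)"
  define Z where "Z \<omega> = (f \<omega> - \<mu>) ^ (2 * p)" for \<omega>
  have [measurable]: "f \<in> borel_measurable M" using \<open>lip M f\<close> by (simp add: lip_def)
  have moment: "integrable M (\<lambda>\<omega>. f \<omega> ^ (2 * p))"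
    using assms(10) by (simp add: power_even_abs)
  \<comment> \<open>A Bochner integral defaults to 0 without integrability; this makes the central
    moment of the statement genuine and equal to the nonnegative integral already bounded.\<close>
  have int_Z: "integrable M Z"
    using integrable_even_power_add [of p f M "\<lambda>_. - \<mu>"] \<open>p \<ge> 1\<close> moment
    by (simp add: Z_def [abs_def])
  have Z_nonneg: "Z \<omega> \<ge> 0" for \<omega> by (simp add: Z_def)
  have bound: "ennreal (\<integral>\<omega>. Z \<omega> \<partial>M) \<le> C_const K nu Ph p \<epsilon> * delta_norm2 f ^ p"
    using central_moment_le [OF chain \<open>tail_trivial M\<close> \<open>p \<ge> 1\<close> \<open>lip M f\<close> moment \<open>\<epsilon> > 0\<close>] int_Z Z_nonneg
    by (subst nn_integral_eq_integral [symmetric]) (auto simp: Z_def \<mu>_def)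
  have "ennreal (measure M {\<omega> \<in> space M. \<bar>f \<omega> - \<mu>\<bar> \<ge> t}) \<le> C_const K nu Ph p \<epsilon> * delta_norm2 f ^ p / ennreal (t ^ (2 * p))"
    if t: "t > 0" for t
  proof -
    \<comment> \<open>Markov's inequality is applied to the 2p-th power, whose level t^(2p)
      corresponds to level t of the deviation.\<close>
    have "t ^ (2 * p) \<le> Z \<omega> \<longleftrightarrow> t \<le> \<bar>f \<omega> - \<mu>\<bar>" for \<omega>
    proof -
      have "Z \<omega> = \<bar>f \<omega> - \<mu>\<bar> ^ (2 * p)" by (simp add: Z_def power_even_abs)
      then show ?thesis using t \<open>p \<ge> 1\<close> by (simp add: power_mono_iff)
    qed
    then have "measure M {\<omega> \<in> space M. \<bar>f \<omega> - \<mu>\<bar> \<ge> t} = measure M {\<omega> \<in> space M. Z \<omega> \<ge> t ^ (2 * p)}"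
      by simp
    also have "\<dots> \<le> (\<integral>\<omega>. Z \<omega> \<partial>M) / t ^ (2 * p)"
      using int_Z Z_nonneg t by (intro integral_Markov_inequality_measure [where A = "{}"]) auto
    finally have "ennreal (measure M {\<omega> \<in> space M. \<bar>f \<omega> - \<mu>\<bar> \<ge> t}) \<le> ennreal (\<integral>\<omega>. Z \<omega> \<partial>M) / ennreal (t ^ (2 * p))"
      using t Z_nonneg by (subst divide_ennreal) (auto intro!: ennreal_leI)
    also have "\<dots> \<le> C_const K nu Ph p \<epsilon> * delta_norm2 f ^ p / ennreal (t ^ (2 * p))"
      by (rule divide_right_mono_ennreal [OF bound])
    finally show ?thesis .
  qed
  with bound show ?thesis by (simp add: Z_def \<mu>_def)
qed

end
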